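(* Let $d\ge 1$ be an integer, $\alpha\in(0,d\wedge 2)$ and $\delta\in(0,\alpha)$, and let $\tilde p(t,x,y)$ be the heat kernel of $\mathcal L=\Delta^{\alpha/2}+\kappa_\delta|x|^{-\alpha}$ described in the context. Then $\tilde p$ is jointly continuous on $(0,\infty)\times\mathbb{R}^d\times\mathbb{R}^d$, and there is a constant $c\ge1$ such that for all $t>0$ and $x,y\in\mathbb{R}^d$, $$c^{-1}F(t,x,y)\le \tilde p(t,x,y)\le c\,F(t,x,y),\qquad F(t,x,y):=\Big(1\wedge \frac{|x|}{t^{1/\alpha}}\Big)^{\delta}\Big(1\wedge \frac{|y|}{t^{1/\alpha}}\Big)^{\delta}\Big(t^{-d/\alpha}\wedge \frac{t}{|x-y|^{d+\alpha}}\Big).$$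
   Context: Let $p(t,x,y)=p(t,x-y)$ ($t>0$, $x,y\in\mathbb{R}^d$) be the heat kernel of the fractional Laplacian $\Delta^{\alpha/2}=-(-\Delta)^{\alpha/2}$, i.e. the transition density of the rotationally symmetric $\alpha$-stable Lévy process $(X_t)_{t\ge0}$ on $\mathbb{R}^d$ (with $\int e^{i\xi\cdot z}p(t,z)\,dz=e^{-t|\xi|^\alpha}$). For $\beta\in(0,\alpha)$ put $\kappa_\beta=\frac{2^\alpha\Gamma(\frac{\alpha-\beta}{2})\Gamma(\frac{d+\beta}{2})}{\Gamma(\frac{-\beta}{2})\Gamma(\frac{d+\beta-\alpha}{2})}$, where $\Gamma(-\beta/2)=\int_0^\infty r^{-1-\beta/2}(e^{-r}-1)\,dr<0$; so $\kappa_\beta<0$. Let $q(x)=\kappa_\delta|x|^{-\alpha}$ and $\mathbb{R}^d_0=\mathbb{R}^d\setminus\{0\}$. The Feynman–Kac semigroup $\tilde P_tf(x)=\mathbb{E}^x\big[f(X_t)\exp(\int_0^t q(X_s)\,ds)\big]$, $f\in C_\infty(\mathbb{R}^d_0)$, $x\in\mathbb{R}^d_0$, has a symmetric kernel $\tilde p(t,x,y)$ on $(0,\infty)\times\mathbb{R}^d_0\times\mathbb{R}^d_0$ (i.e. $\tilde P_tf(x)=\int\tilde p(t,x,y)f(y)\,dy$) satisfying the Chapman–Kolmogorov equations; it is extended by $\tilde p(t,x,y)=0$ when $x=0$ or $y=0$. This $\tilde p$ is called the heat kernel of $\mathcal L$. *)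

theory Defs
  imports "HOL-Probability.Probability"
begin

text \<open>Constant kappa_beta (d = dimension). Gamma is the library Gamma function
  (analytic continuation; for -beta/2 in (-1,0) it equals the integral in the paper).\<close>
definition kappa :: "nat \<Rightarrow> real \<Rightarrow> real \<Rightarrow> real" where
  "kappa d \<alpha> \<beta> = 2 powr \<alpha> * Gamma ((\<alpha> - \<beta>) / 2) * Gamma ((real d + \<beta>) / 2)
      / (Gamma (- \<beta> / 2) * Gamma ((real d + \<beta> - \<alpha>) / 2))"

text \<open>X is a rotationally symmetric alpha-stable Levy process started at 0 on the
  probability space M (with cadlag paths); the process started at x is x + X.\<close>
definition is_stable_process ::
  "'b measure \<Rightarrow> real \<Rightarrow> (real \<Rightarrow> 'b \<Rightarrow> 'a::euclidean_space) \<Rightarrow> bool" where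
  "is_stable_process M \<alpha> X \<longleftrightarrow>
     prob_space M \<and>
     (\<forall>t. X t \<in> borel_measurable M) \<and>
     (\<forall>\<omega>\<in>space M. X 0 \<omega> = 0) \<and>
     (\<forall>\<omega>\<in>space M. \<forall>s. continuous (at_right s) (\<lambda>r. X r \<omega>) \<and>
                        (\<exists>l. ((\<lambda>r. X r \<omega>) \<longlongrightarrow> l) (at_left s))) \<and>
     (\<forall>(n::nat) (\<tau>::nat \<Rightarrow> real). 0 \<le> \<tau> 0 \<longrightarrow> (\<forall>i<n. \<tau> i < \<tau> (Suc i)) \<longrightarrow>
        prob_space.indep_vars M (\<lambda>_. borel) (\<lambda>i \<omega>. X (\<tau> (Suc i)) \<omega> - X (\<tau> i) \<omega>) {..<n}) \<and>
     (\<forall>s t (\<xi>::'a). 0 \<le> s \<longrightarrow> s \<le> t \<longrightarrow>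
        (LINT \<omega>|M. cis (\<xi> \<bullet> (X t \<omega> - X s \<omega>))) = complex_of_real (exp (- (t - s) * norm \<xi> powr \<alpha>)))"

text \<open>Feynman-Kac weight exp(int_0^t q(x + X_s) ds) with q(z) = kap |z|^(-alpha) \<le> 0
  (kap < 0); the integral of -q \<ge> 0 is a nonnegative integral, and the weight is 0 when it is infinite.\<close>
definition FK_weight ::
  "real \<Rightarrow> real \<Rightarrow> (real \<Rightarrow> 'b \<Rightarrow> 'a::euclidean_space) \<Rightarrow> real \<Rightarrow> 'a \<Rightarrow> 'b \<Rightarrow> real" where
  "FK_weight kap \<alpha> X t x \<omega> =
     (let I = (\<integral>\<^sup>+ s\<in>{0..t}. ennreal (- kap * norm (x + X s \<omega>) powr (- \<alpha>)) \<partial>lborel)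
      in if I = \<infinity> then 0 else exp (- enn2real I))"

text \<open>C_infinity(R^d_0): continuous functions on R^d \ {0} vanishing at infinity and at 0,
  identified with continuous functions on R^d with f 0 = 0 vanishing at infinity.\<close>
definition C_infty_punctured :: "('a::euclidean_space \<Rightarrow> real) set" where
  "C_infty_punctured = {f. continuous_on (UNIV - {0}) f \<and> (f \<longlongrightarrow> 0) (at 0)
                          \<and> (f \<longlongrightarrow> 0) at_infinity \<and> f 0 = 0}"

definition is_FK_heat_kernel ::
  "'b measure \<Rightarrow> real \<Rightarrow> real \<Rightarrow> (real \<Rightarrow> 'b \<Rightarrow> 'a::euclidean_space)
     \<Rightarrow> (real \<Rightarrow> 'a \<Rightarrow> 'a \<Rightarrow> real) \<Rightarrow> bool" where
  "is_FK_heat_kernel M kap \<alpha> X pt \<longleftrightarrow>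
     (\<forall>t>0. \<forall>x y. pt t x y = pt t y x) \<and>
     (\<forall>t>0. \<forall>x. pt t x 0 = 0 \<and> pt t 0 x = 0) \<and>
     (\<forall>s>0. \<forall>t>0. \<forall>x y. integrable lborel (\<lambda>z. pt s x z * pt t z y) \<and>
        pt (s + t) x y = (LINT z|lborel. pt s x z * pt t z y)) \<and>
     (\<forall>f\<in>C_infty_punctured. \<forall>t>0. \<forall>x. x \<noteq> 0 \<longrightarrow>
        integrable lborel (\<lambda>y. pt t x y * f y) \<and>
        (LINT y|lborel. pt t x y * f y) = (LINT \<omega>|M. f (x + X t \<omega>) * FK_weight kap \<alpha> X t x \<omega>))"

text \<open>The two-sided bound F(t,x,y); t/|x-y|^(d+alpha) is read as +infinity when x = y.\<close>
definition Fbound :: "nat \<Rightarrow> real \<Rightarrow> real \<Rightarrow> real \<Rightarrow> 'a::real_normed_vector \<Rightarrow> 'a \<Rightarrow> real" where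
  "Fbound d \<alpha> \<delta> t x y =
     (min 1 (norm x / t powr (1 / \<alpha>))) powr \<delta> * (min 1 (norm y / t powr (1 / \<alpha>))) powr \<delta> *
     (if x = y then t powr (- real d / \<alpha>)
      else min (t powr (- real d / \<alpha>)) (t / norm (x - y) powr (real d + \<alpha>)))"

end

theory Submission
  imports Defs
begin

text \<open>
  The function \<open>h x = |x|\<^sup>\<delta>\<close> is invariant for the Feynman-Kac semigroup. Indeed the stable semigroup satisfies
  \<open>P\<^sub>t h = h + |\<kappa>| \<integral>\<^sub>0\<^sup>t P\<^sub>s |z|\<^bsup>\<delta>-\<alpha>\<^esup> ds\<close> (Gamma integrals and Fourier inversion), and the
  potential cancels the integral to first order: a step of length \<open>\<tau>\<close> changes \<open>h\<close> by \<open>O(\<tau>\<^bsup>1+\<delta>/\<alpha>\<^esup> |x|\<^bsup>-\<alpha>\<^esup>)\<close>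
  only, and the errors of the \<open>t/\<tau>\<close> steps that make up time \<open>t\<close> sum to something that vanishes with \<open>\<tau>\<close>.
  Invariance combined with \<open>pt \<le> C t\<^bsup>-d/\<alpha>\<^esup>\<close> gives a recursion between times
  \<open>t\<close> and \<open>t/2\<close> for the survival mass \<open>\<integral> pt t x z dz\<close>, whose iteration bounds that mass by
  \<open>C (1 \<and> |x|/t\<^bsup>1/\<alpha>\<^esup>)\<^sup>\<delta>\<close>; by Chapman-Kolmogorov this controls \<open>pt\<close> near the diagonal, and a second iteration,
  convergent because \<open>\<delta> < \<alpha>\<close>, controls it far from the diagonal. Conversely, invariance and the upper bound force a
  mass of order \<open>(1 \<and> |x|/t\<^bsup>1/\<alpha>\<^esup>)\<^sup>\<delta>\<close> into an annulus of radii comparable to \<open>t\<^bsup>1/\<alpha>\<^esup>\<close>, on which convexity of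
  the exponential bounds \<open>pt\<close> from below by the stable density. The latter is built by subordinating Gaussian densities;
  only one-time and two-time laws of the process enter.
\<close>

section \<open>Uniqueness of measures\<close>

lemma open_indicator_tendsto:
  fixes U :: "'a::metric_space set"
  assumes "open U" "U \<noteq> UNIV"
  shows "(\<lambda>n. min 1 (real n * infdist x (- U))) \<longlonglongrightarrow> indicator U x"
proof (cases "x \<in> U")
  case True
  have dist_pos: "infdist x (- U) > 0"
    using assms True in_closed_iff_infdist_zero[of "- U" x] infdist_nonneg[of x "- U"] by fastforce
  obtain N :: nat where N: "1 / infdist x (- U) < real N" using reals_Archimedean2 by blast
  have "eventually (\<lambda>n. min 1 (real n * infdist x (- U)) = 1) sequentially"
    using eventually_ge_at_top[of N]
  proof eventually_elim
    case (elim n)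
    have "1 < real N * infdist x (- U)" using N dist_pos by (simp add: field_simps)
    also have "\<dots> \<le> real n * infdist x (- U)" using elim dist_pos by (intro mult_right_mono) auto
    finally show ?case by simp
  qed
  then show ?thesis using True by (simp add: tendsto_eventually)
qed simp

context
  fixes N :: "'a::metric_space measure" and M :: "'b measure"
    and G :: "'a \<Rightarrow> real" and g :: "'b \<Rightarrow> real" and Y :: "'b \<Rightarrow> 'a"
  assumes sets_N [measurable_cong]: "sets N = sets borel"
    and integrable_G [measurable]: "integrable N G"
    and integrable_g [measurable]: "integrable M g"
    and measurable_Y [measurable]: "Y \<in> borel_measurable M"
begin

lemma weighted_integral_eq_limit:
  assumes integral_F: "\<And>n. (LINT y|N. G y * F n y) = (LINT \<omega>|M. g \<omega> * F n (Y \<omega>))"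
    and [measurable]: "\<And>n. F n \<in> borel_measurable borel" "h \<in> borel_measurable borel"
    and bound: "\<And>n y. \<bar>F n y\<bar> \<le> 1" and lim: "\<And>y. (\<lambda>n. F n y) \<longlonglongrightarrow> h y"
  shows "(LINT y|N. G y * h y) = (LINT \<omega>|M. g \<omega> * h (Y \<omega>))"
proof (rule LIMSEQ_unique)
  show "(\<lambda>n. LINT y|N. G y * F n y) \<longlonglongrightarrow> (LINT y|N. G y * h y)"
    by (rule integral_dominated_convergence[where w="\<lambda>y. \<bar>G y\<bar>"])
       (use integrable_G lim bound in \<open>auto simp: abs_mult intro!: tendsto_mult mult_left_le\<close>)
  show "(\<lambda>n. LINT y|N. G y * F n y) \<longlonglongrightarrow> (LINT \<omega>|M. g \<omega> * h (Y \<omega>))"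
    unfolding integral_F
    by (rule integral_dominated_convergence[where w="\<lambda>\<omega>. \<bar>g \<omega>\<bar>"])
       (use integrable_g lim bound in \<open>auto simp: abs_mult intro!: tendsto_mult mult_left_le\<close>)
qed

lemma weighted_integral_eq_open:
  assumes cont: "\<And>f :: 'a \<Rightarrow> real. continuous_on UNIV f \<Longrightarrow> (\<And>x. 0 \<le> f x) \<Longrightarrow> (\<And>x. f x \<le> 1) \<Longrightarrow>
      (LINT y|N. G y * f y) = (LINT \<omega>|M. g \<omega> * f (Y \<omega>))"
    and U: "open U"
  shows "(LINT y|N. G y * indicator U y) = (LINT \<omega>|M. g \<omega> * indicator U (Y \<omega>))"
proof (cases "U = UNIV")
  case True
  then show ?thesis using cont[of "\<lambda>_. 1"] by simp
next
  case False
  let ?F = "\<lambda>n x. min 1 (real n * infdist x (- U))"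
  have continuous_F: "continuous_on UNIV (?F n)" for n by (intro continuous_intros)
  show ?thesis
  proof (rule weighted_integral_eq_limit[where F="?F"])
    show "(LINT y|N. G y * ?F n y) = (LINT \<omega>|M. g \<omega> * ?F n (Y \<omega>))" for n
      by (rule cont[OF continuous_F]) (auto simp: infdist_nonneg)
  qed (use U continuous_F open_indicator_tendsto[OF U False] in
      \<open>auto intro!: borel_measurable_continuous_onI borel_measurable_indicator simp: infdist_nonneg\<close>)
qed

lemma integrable_mult_indicator_borel:
  assumes "A \<in> sets borel"
  shows "integrable N (\<lambda>y. G y * indicator A y)" "integrable M (\<lambda>\<omega>. g \<omega> * indicator A (Y \<omega>))"
proof -
  show "integrable N (\<lambda>y. G y * indicator A y)"
    using assms integrable_G sets_N by (intro integrable_real_mult_indicator) auto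
  have "integrable M (\<lambda>\<omega>. g \<omega> * indicator (Y -` A \<inter> space M) \<omega>)"
    using measurable_sets[OF measurable_Y assms] integrable_g by (rule integrable_real_mult_indicator)
  then show "integrable M (\<lambda>\<omega>. g \<omega> * indicator A (Y \<omega>))"
    by (rule Bochner_Integration.integrable_cong[THEN iffD1, rotated 2]) (auto simp: indicator_def)
qed

lemma weighted_integral_eq_Compl:
  assumes B: "B \<in> sets borel"
    and total: "(LINT y|N. G y) = (LINT \<omega>|M. g \<omega>)"
    and eq_B: "(LINT y|N. G y * indicator B y) = (LINT \<omega>|M. g \<omega> * indicator B (Y \<omega>))"
  shows "(LINT y|N. G y * indicator (UNIV - B) y) = (LINT \<omega>|M. g \<omega> * indicator (UNIV - B) (Y \<omega>))"
proof -
  have "(LINT y|N. G y * indicator (UNIV - B) y) = (LINT y|N. G y - G y * indicator B y)"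
    by (rule Bochner_Integration.integral_cong) (auto simp: indicator_def)
  also have "\<dots> = (LINT \<omega>|M. g \<omega> - g \<omega> * indicator B (Y \<omega>))"
    using eq_B total integrable_mult_indicator_borel[OF B] integrable_G integrable_g by simp
  also have "\<dots> = (LINT \<omega>|M. g \<omega> * indicator (UNIV - B) (Y \<omega>))"
    by (rule Bochner_Integration.integral_cong) (auto simp: indicator_def)
  finally show ?thesis .
qed

lemma weighted_integral_eq_disjoint_UN:
  fixes B :: "nat \<Rightarrow> 'a set"
  assumes B [measurable]: "\<And>i. B i \<in> sets borel" and disjoint: "disjoint_family B"
    and eq_B: "\<And>i. (LINT y|N. G y * indicator (B i) y) = (LINT \<omega>|M. g \<omega> * indicator (B i) (Y \<omega>))"
  shows "(LINT y|N. G y * indicator (\<Union>i. B i) y) = (LINT \<omega>|M. g \<omega> * indicator (\<Union>i. B i) (Y \<omega>))"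
proof -
  let ?F = "\<lambda>n y. \<Sum>i<n. indicator (B i) y :: real"
  have partial_union: "?F n y = indicator (\<Union>i<n. B i) y" for n y
    by (rule indicator_UN_disjoint[symmetric]) (use disjoint in \<open>auto simp: disjoint_family_on_def\<close>)
  show ?thesis
  proof (rule weighted_integral_eq_limit[where F="?F"])
    show "(LINT y|N. G y * ?F n y) = (LINT \<omega>|M. g \<omega> * ?F n (Y \<omega>))" for n
      unfolding sum_distrib_left by (subst (1 2) Bochner_Integration.integral_sum)
        (simp_all add: integrable_mult_indicator_borel B eq_B)
    show "\<bar>?F n y\<bar> \<le> 1" for n y unfolding partial_union by simp
    show "(\<lambda>n. ?F n y) \<longlonglongrightarrow> indicator (\<Union>i. B i) y" for y
      unfolding partial_union by (rule LIMSEQ_indicator_UN)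
  qed auto
qed

lemma weighted_integral_eq_borel:
  assumes cont: "\<And>f :: 'a \<Rightarrow> real. continuous_on UNIV f \<Longrightarrow> (\<And>x. 0 \<le> f x) \<Longrightarrow> (\<And>x. f x \<le> 1) \<Longrightarrow>
      (LINT y|N. G y * f y) = (LINT \<omega>|M. g \<omega> * f (Y \<omega>))"
    and A: "A \<in> sets borel"
  shows "(LINT y|N. G y * indicator A y) = (LINT \<omega>|M. g \<omega> * indicator A (Y \<omega>))"
proof -
  have total: "(LINT y|N. G y) = (LINT \<omega>|M. g \<omega>)" using cont[of "\<lambda>_. 1"] by simp
  have generator: "Int_stable {U::'a set. open U}" "{U::'a set. open U} \<subseteq> Pow UNIV"
    by (auto simp: Int_stable_def)
  have "A \<in> sigma_sets UNIV {U. open U}" using A by (simp add: sets_borel)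
  with generator show ?thesis
  proof (induct rule: sigma_sets_induct_disjoint)
    case (basic U)
    then show ?case by (intro weighted_integral_eq_open cont) simp_all
  next
    case empty
    show ?case by simp
  next
    case (compl B)
    then show ?case by (intro weighted_integral_eq_Compl total) (simp_all add: borel_def)
  next
    case (union B)
    then show ?case by (intro weighted_integral_eq_disjoint_UN) (auto simp: borel_def)
  qed
qed

lemma weight_AE_nonneg:
  assumes cont: "\<And>f :: 'a \<Rightarrow> real. continuous_on UNIV f \<Longrightarrow> (\<And>x. 0 \<le> f x) \<Longrightarrow> (\<And>x. f x \<le> 1) \<Longrightarrow>
      (LINT y|N. G y * f y) = (LINT \<omega>|M. g \<omega> * f (Y \<omega>))"
    and g_nonneg: "\<And>\<omega>. 0 \<le> g \<omega>" and sigma_finite: "sigma_finite_measure N"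
  shows "AE y in N. 0 \<le> G y"
proof (rule sigma_finite_measure.density_nonneg[OF sigma_finite integrable_G])
  fix A assume "A \<in> sets N"
  then have A: "A \<in> sets borel" using sets_N by simp
  have "0 \<le> (LINT \<omega>|M. g \<omega> * indicator A (Y \<omega>))" using g_nonneg by simp
  also have "\<dots> = (LINT y|N. G y * indicator A y)" by (rule weighted_integral_eq_borel[OF cont A, symmetric])
  finally show "0 \<le> set_lebesgue_integral N A G" by (simp add: set_lebesgue_integral_def mult.commute)
qed

lemma nn_integral_weighted_eq:
  assumes cont: "\<And>f :: 'a \<Rightarrow> real. continuous_on UNIV f \<Longrightarrow> (\<And>x. 0 \<le> f x) \<Longrightarrow> (\<And>x. f x \<le> 1) \<Longrightarrow>
      (LINT y|N. G y * f y) = (LINT \<omega>|M. g \<omega> * f (Y \<omega>))"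
    and nonneg: "AE y in N. 0 \<le> G y" "\<And>\<omega>. 0 \<le> g \<omega>" and [measurable]: "f \<in> borel_measurable borel"
  shows "(\<integral>\<^sup>+y. ennreal (G y) * f y \<partial>N) = (\<integral>\<^sup>+\<omega>. ennreal (g \<omega>) * f (Y \<omega>) \<partial>M)"
proof -
  have "density N (\<lambda>y. ennreal (G y)) = distr (density M (\<lambda>\<omega>. ennreal (g \<omega>))) borel Y"
  proof (rule measure_eqI)
    fix A assume "A \<in> sets (density N (\<lambda>y. ennreal (G y)))"
    then have A [measurable]: "A \<in> sets borel" using sets_N by simp
    have "emeasure (density N (\<lambda>y. ennreal (G y))) A = (\<integral>\<^sup>+y. ennreal (G y * indicator A y) \<partial>N)"
      by (simp add: emeasure_density nn_integral_set_ennreal)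
    also have "\<dots> = ennreal (LINT y|N. G y * indicator A y)"
      using integrable_mult_indicator_borel(1)[OF A] nonneg(1)
      by (intro nn_integral_eq_integral) auto
    also have "\<dots> = ennreal (LINT \<omega>|M. g \<omega> * indicator A (Y \<omega>))"
      by (rule arg_cong[where f=ennreal]) (rule weighted_integral_eq_borel[OF cont A])
    also have "\<dots> = (\<integral>\<^sup>+\<omega>. ennreal (g \<omega> * indicator A (Y \<omega>)) \<partial>M)"
      using integrable_mult_indicator_borel(2)[OF A] nonneg(2) by (intro nn_integral_eq_integral[symmetric]) auto
    also have "\<dots> = (\<integral>\<^sup>+\<omega>. ennreal (g \<omega>) * indicator (Y -` A \<inter> space M) \<omega> \<partial>M)"
      by (rule nn_integral_cong) (simp add: indicator_def)
    also have "\<dots> = emeasure (distr (density M (\<lambda>\<omega>. ennreal (g \<omega>))) borel Y) A"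
      by (simp add: emeasure_distr emeasure_density)
    finally show "emeasure (density N (\<lambda>y. ennreal (G y))) A
        = emeasure (distr (density M (\<lambda>\<omega>. ennreal (g \<omega>))) borel Y) A" .
  qed (simp add: sets_N)
  then have "(\<integral>\<^sup>+y. f y \<partial>density N (\<lambda>y. ennreal (G y))) = (\<integral>\<^sup>+y. f y \<partial>distr (density M (\<lambda>\<omega>. ennreal (g \<omega>))) borel Y)"
    by simp
  then show ?thesis by (simp add: nn_integral_density nn_integral_distr)
qed

end

lemma finite_measure_eqI_continuous:
  fixes M N :: "'a::metric_space measure"
  assumes "finite_measure M" "finite_measure N"
    and sets_M: "sets M = sets borel" and sets_N: "sets N = sets borel"
    and integral_eq: "\<And>f :: 'a \<Rightarrow> real. continuous_on UNIV f \<Longrightarrow> (\<And>x. 0 \<le> f x) \<Longrightarrow> (\<And>x. f x \<le> 1) \<Longrightarrow>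
      (LINT x|M. f x) = (LINT x|N. f x)"
  shows "M = N"
proof (rule measure_eqI)
  interpret M: finite_measure M by fact
  interpret N: finite_measure N by fact
  fix A assume "A \<in> sets M"
  then have A: "A \<in> sets borel" using sets_M by simp
  have "(LINT x|M. 1 * indicator A x) = (LINT x|N. 1 * (indicator A x :: real))"
    by (rule weighted_integral_eq_borel[OF sets_M _ _ _ _ A, where Y="\<lambda>x. x"])
       (use integral_eq in \<open>simp_all add: measurable_ident_sets[OF sets_N]\<close>)
  then show "emeasure M A = emeasure N A"
    using A sets_M sets_N by (simp add: M.emeasure_eq_measure N.emeasure_eq_measure)
qed (simp add: sets_M sets_N)

section \<open>Gaussian densities and characteristic functions\<close>

definition gauss :: "real \<Rightarrow> 'a::euclidean_space \<Rightarrow> real" where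
  "gauss u x = (4 * pi * u) powr (- real DIM('a) / 2) * exp (- (norm x)\<^sup>2 / (4 * u))"

lemma gauss_nonneg [simp]: "0 \<le> gauss u x"
  by (simp add: gauss_def)

lemma borel_measurable_gauss [measurable]:
  "(\<lambda>(u, x::'a::euclidean_space). gauss u x) \<in> borel_measurable (borel \<Otimes>\<^sub>M borel)"
  unfolding gauss_def by measurable

lemma char_normal_density:
  fixes t :: real
  assumes "u > 0"
  defines "\<sigma> \<equiv> sqrt (2 * u)"
  shows "integrable lborel (\<lambda>x. complex_of_real (normal_density 0 \<sigma> x) * cis (t * x))"
    and "(LINT x|lborel. complex_of_real (normal_density 0 \<sigma> x) * cis (t * x)) = exp (- u * t\<^sup>2)"
proof -
  have \<sigma>_pos: "\<sigma> > 0" using assms by simp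
  show "integrable lborel (\<lambda>x. complex_of_real (normal_density 0 \<sigma> x) * cis (t * x))"
    by (rule Bochner_Integration.integrable_bound[OF integrable_normal_density[of \<sigma> 0]])
       (use \<sigma>_pos in \<open>auto simp: norm_mult cis_conv_exp\<close>)
  have rescale: "\<sigma> *\<^sub>R (complex_of_real (normal_density 0 \<sigma> (\<sigma> * x)) * cis (t * (\<sigma> * x)))
      = std_normal_density x *\<^sub>R cis (t * \<sigma> * x)" for x
  proof -
    have "\<sigma> * normal_density 0 \<sigma> (\<sigma> * x) = std_normal_density x"
      using \<sigma>_pos assms by (simp add: normal_density_def real_sqrt_mult power_mult_distrib field_simps)
    then show ?thesis
      by (simp add: scaleR_conv_of_real mult.assoc[symmetric] of_real_mult[symmetric] del: of_real_mult)
  qed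
  have "(LINT x|lborel. complex_of_real (normal_density 0 \<sigma> x) * cis (t * x))
     = \<sigma> *\<^sub>R (LINT x|lborel. complex_of_real (normal_density 0 \<sigma> (\<sigma> * x)) * cis (t * (\<sigma> * x)))"
    using lborel_integral_real_affine[of \<sigma> "\<lambda>x. complex_of_real (normal_density 0 \<sigma> x) * cis (t * x)" 0] \<sigma>_pos
    by simp
  also have "\<dots> = (LINT x|lborel. std_normal_density x *\<^sub>R cis (t * \<sigma> * x))"
    by (subst integral_scaleR_right[symmetric]) (simp only: rescale)
  also have "\<dots> = char std_normal_distribution (t * \<sigma>)"
    unfolding char_def by (subst integral_density) (auto simp: cis_conv_exp)
  also have "\<dots> = exp (- u * t\<^sup>2)"
    using assms by (simp add: char_std_normal_distribution power_mult_distrib)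
  finally show "(LINT x|lborel. complex_of_real (normal_density 0 \<sigma> x) * cis (t * x)) = exp (- u * t\<^sup>2)" .
qed

lemma cis_sum: "finite A \<Longrightarrow> cis (sum f A) = (\<Prod>i\<in>A. cis (f i))"
  by (induction A rule: finite_induct) (auto simp: cis_mult[symmetric])

lemma gauss_eq_prod:
  fixes x :: "'a::euclidean_space"
  assumes "u > 0"
  shows "gauss u x = (\<Prod>b\<in>Basis. normal_density 0 (sqrt (2 * u)) (x \<bullet> b))"
proof -
  have normalization: "(\<Prod>b\<in>(Basis :: 'a set). 1 / sqrt (4 * pi * u)) = (4 * pi * u) powr (- real DIM('a) / 2)"
    using assms by (simp add: powr_half_sqrt[symmetric] powr_minus_divide powr_powr
        powr_realpow[symmetric] power_one_over)
  have exponential: "(\<Prod>b\<in>Basis. exp (- (x \<bullet> b)\<^sup>2 / (4 * u))) = exp (- (norm x)\<^sup>2 / (4 * u))"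
    by (simp add: exp_sum[symmetric] sum_divide_distrib[symmetric] sum_negf norm_eq_sqrt_inner
        euclidean_inner[of x x] power2_eq_square sum_nonneg)
  show ?thesis unfolding gauss_def normalization[symmetric] exponential[symmetric] prod.distrib[symmetric]
    using assms by (intro prod.cong) (auto simp: normal_density_def mult.assoc)
qed

lemma
  fixes \<xi> :: "'a::euclidean_space"
  assumes "u > 0"
  shows integrable_gauss_cis: "integrable lborel (\<lambda>x::'a. complex_of_real (gauss u x) * cis (\<xi> \<bullet> x))"
    and char_gauss: "(LINT x|lborel. complex_of_real (gauss u x) * cis (\<xi> \<bullet> x)) = exp (- u * (norm \<xi>)\<^sup>2)"
proof -
  interpret product_sigma_finite "\<lambda>_::'a. lborel :: real measure" ..
  let ?f = "\<lambda>b y. complex_of_real (normal_density 0 (sqrt (2 * u)) y) * cis ((\<xi> \<bullet> b) * y)"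
  have factors: "complex_of_real (gauss u x) * cis (\<xi> \<bullet> x) = (\<Prod>b\<in>Basis. ?f b (x \<bullet> b))" for x :: 'a
    by (simp add: gauss_eq_prod[OF assms] prod.distrib cis_sum[symmetric] euclidean_inner[of \<xi> x])
  have coordinate: "(\<Sum>b\<in>Basis. f b *\<^sub>R b) \<bullet> c = f c" if "c \<in> Basis" for f :: "'a \<Rightarrow> real" and c
    using that by (simp add: inner_sum_left inner_Basis if_distrib cong: if_cong)
  have measurable_coordinates: "(\<lambda>f. \<Sum>b\<in>Basis. f b *\<^sub>R b) \<in> (\<Pi>\<^sub>M b\<in>(Basis::'a set). lborel) \<rightarrow>\<^sub>M borel"
    by measurable
  have measurable_integrand: "(\<lambda>x::'a. complex_of_real (gauss u x) * cis (\<xi> \<bullet> x)) \<in> borel_measurable borel"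
    unfolding cis_conv_exp by measurable
  have integrable_factor: "integrable lborel (?f b)" for b :: 'a by (rule char_normal_density(1)[OF assms])
  have "integrable (\<Pi>\<^sub>M b\<in>(Basis::'a set). lborel) (\<lambda>f. \<Prod>b\<in>Basis. ?f b (f b))"
    by (rule product_integrable_prod) (use integrable_factor in auto)
  then show "integrable lborel (\<lambda>x::'a. complex_of_real (gauss u x) * cis (\<xi> \<bullet> x))"
    by (subst lborel_eq, subst integrable_distr_eq[OF measurable_coordinates measurable_integrand])
       (simp add: factors coordinate cong: prod.cong)
  have "(LINT x|lborel. complex_of_real (gauss u x) * cis (\<xi> \<bullet> x))
      = integral\<^sup>L (\<Pi>\<^sub>M b\<in>(Basis::'a set). lborel) (\<lambda>f. \<Prod>b\<in>Basis. ?f b (f b))"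
    by (subst lborel_eq, subst integral_distr[OF measurable_coordinates measurable_integrand])
       (simp add: factors coordinate cong: prod.cong)
  also have "\<dots> = (\<Prod>b\<in>(Basis::'a set). complex_of_real (exp (- u * (\<xi> \<bullet> b)\<^sup>2)))"
    by (subst product_integral_prod) (use integrable_factor char_normal_density(2)[OF assms] in auto)
  also have "\<dots> = exp (- u * (norm \<xi>)\<^sup>2)"
    by (simp add: of_real_prod[symmetric] exp_sum[symmetric] norm_eq_sqrt_inner sum_nonneg sum_negf
        euclidean_inner[of \<xi> \<xi>] power2_eq_square sum_distrib_left[symmetric] mult.assoc
        del: of_real_prod)
  finally show "(LINT x|lborel. complex_of_real (gauss u x) * cis (\<xi> \<bullet> x)) = exp (- u * (norm \<xi>)\<^sup>2)" .
qed

lemma integrable_gauss: "u > 0 \<Longrightarrow> integrable lborel (gauss u :: 'a::euclidean_space \<Rightarrow> real)"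
  using integrable_gauss_cis[of u "0::'a"] by (simp add: complex_of_real_integrable_eq)

lemma integral_gauss: "u > 0 \<Longrightarrow> (LINT x|lborel. gauss u (x::'a::euclidean_space)) = 1"
  using char_gauss[of u "0::'a"] by (simp add: integral_complex_of_real)

lemma nn_integral_lborel_affine:
  fixes f :: "'a::euclidean_space \<Rightarrow> ennreal"
  assumes [measurable]: "f \<in> borel_measurable borel" and c: "c \<noteq> 0"
  shows "(\<integral>\<^sup>+x. f x \<partial>lborel) = ennreal (\<bar>c\<bar> ^ DIM('a)) * (\<integral>\<^sup>+x. f (t + c *\<^sub>R x) \<partial>lborel)"
  using c by (subst lborel_affine[of c t])
    (simp_all add: nn_integral_density nn_integral_distr nn_integral_cmult ennreal_mult'')

lemma nn_integral_lborel_translate: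
  fixes f :: "'a::euclidean_space \<Rightarrow> ennreal"
  assumes "f \<in> borel_measurable borel"
  shows "(\<integral>\<^sup>+z. f (x + z) \<partial>lborel) = (\<integral>\<^sup>+z. f z \<partial>lborel)"
  using nn_integral_lborel_affine[OF assms, of 1 x] by simp

lemma nn_integral_lborel_reflect:
  fixes f :: "'a::euclidean_space \<Rightarrow> ennreal"
  assumes "f \<in> borel_measurable borel"
  shows "(\<integral>\<^sup>+z. f (- z) \<partial>lborel) = (\<integral>\<^sup>+z. f z \<partial>lborel)"
  using nn_integral_lborel_affine[OF assms, of "- 1" 0] by simp

lemma integral_lborel_affine:
  fixes f :: "'a::euclidean_space \<Rightarrow> 'b::{banach, second_countable_topology}"
  assumes [measurable]: "f \<in> borel_measurable borel" and c: "c > 0"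
  shows "(LINT x|lborel. f x) = c ^ DIM('a) *\<^sub>R (LINT x|lborel. f (t + c *\<^sub>R x))"
  using c by (subst lborel_affine[of c t]) (simp_all add: integral_density integral_distr)

lemma integral_lborel_translate:
  fixes f :: "'a::euclidean_space \<Rightarrow> 'b::{banach, second_countable_topology}"
  assumes "f \<in> borel_measurable borel"
  shows "(LINT z|lborel. f (x + z)) = (LINT z|lborel. f z)"
  using integral_lborel_affine[OF assms, of 1 x] by simp

lemma integrable_lborel_translate_iff:
  fixes f :: "'a::euclidean_space \<Rightarrow> 'b::{banach, second_countable_topology}"
  assumes [measurable]: "f \<in> borel_measurable borel"
  shows "integrable lborel (\<lambda>z. f (x + z)) \<longleftrightarrow> integrable lborel f"
  by (subst (2) lborel_affine[of 1 x]) (simp_all add: density_1 integrable_distr_eq)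

lemma gauss_scale:
  fixes x :: "'a::euclidean_space"
  assumes "c > 0" "u > 0"
  shows "gauss (c\<^sup>2 * u) (c *\<^sub>R x) = gauss u x / c ^ DIM('a)"
proof -
  have "(4 * pi * (c\<^sup>2 * u)) powr (- real DIM('a) / 2)
      = (4 * pi * u) powr (- real DIM('a) / 2) * (c\<^sup>2) powr (- real DIM('a) / 2)"
    using assms by (simp add: powr_mult[symmetric] mult_ac)
  also have "(c\<^sup>2) powr (- real DIM('a) / 2) = 1 / c ^ DIM('a)"
    using assms by (simp add: powr_powr powr_minus_divide powr_realpow flip: powr_numeral)
  finally show ?thesis using assms by (simp add: gauss_def power_mult_distrib)
qed

lemma integral_gauss_translate:
  fixes f :: "'a::euclidean_space \<Rightarrow> real"
  assumes [measurable]: "f \<in> borel_measurable borel" and c: "c > 0"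
  shows "(LINT z|lborel. f z * gauss (c\<^sup>2) (z - y)) = (LINT v|lborel. f (y + c *\<^sub>R v) * gauss 1 v)"
proof -
  have "(LINT z|lborel. f z * gauss (c\<^sup>2) (z - y)) =
    c ^ DIM('a) *\<^sub>R (LINT v|lborel. f (y + c *\<^sub>R v) * gauss (c\<^sup>2) (y + c *\<^sub>R v - y))"
    by (rule integral_lborel_affine) (use c in auto)
  then show ?thesis using c gauss_scale[of c 1, where 'a='a] by simp
qed

lemma integral_gauss_char:
  fixes M :: "'a::euclidean_space measure"
  assumes "finite_measure M" and sets[measurable_cong]: "sets M = sets borel" and u: "u > 0"
  defines "r \<equiv> 1 / (4 * u)"
  shows "complex_of_real (LINT y|M. gauss u (z - y)) = of_real ((4 * pi * u) powr (- real DIM('a) / 2)) *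
    (LINT \<xi>|lborel. of_real (gauss r \<xi>) * cis (z \<bullet> \<xi>) * (LINT y|M. cis ((- \<xi>) \<bullet> y)))"
proof -
  interpret M: finite_measure M by fact
  interpret pair_sigma_finite M "lborel :: 'a measure" ..
  have r: "r > 0" using u by (simp add: r_def)
  let ?F = "\<lambda>y \<xi>. complex_of_real (gauss r \<xi>) * cis ((z - y) \<bullet> \<xi>)"
  let ?c = "(4 * pi * u) powr (- real DIM('a) / 2)"
  have [measurable]: "(\<lambda>(y, \<xi>). ?F y \<xi>) \<in> borel_measurable (M \<Otimes>\<^sub>M lborel)"
    unfolding cis_conv_exp by measurable
  have integrable_F: "integrable (M \<Otimes>\<^sub>M lborel) (\<lambda>(y, \<xi>). ?F y \<xi>)"
  proof (rule Fubini_integrable)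
    show "integrable M (\<lambda>x. LINT y|lborel. cmod (case (x, y) of (y, \<xi>) \<Rightarrow> ?F y \<xi>))"
      using integral_gauss[OF r, where 'a='a] by (simp add: norm_mult)
    show "AE x in M. integrable lborel (\<lambda>y. case (x, y) of (y, \<xi>) \<Rightarrow> ?F y \<xi>)"
      using integrable_gauss_cis[OF r] by (intro AE_I2) auto
  qed measurable
  have "complex_of_real (gauss u (z - y)) = of_real ?c * (LINT \<xi>|lborel. ?F y \<xi>)" for y
    using char_gauss[OF r, of "z - y"] u by (simp add: gauss_def r_def)
  then have "complex_of_real (LINT y|M. gauss u (z - y)) = of_real ?c * (LINT y|M. LINT \<xi>|lborel. ?F y \<xi>)"
    by (simp flip: integral_complex_of_real)
  also have "(LINT y|M. LINT \<xi>|lborel. ?F y \<xi>) = (LINT \<xi>|lborel. LINT y|M. ?F y \<xi>)"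
    using Fubini_integral[OF integrable_F] by simp
  also have "\<dots> = (LINT \<xi>|lborel. of_real (gauss r \<xi>) * cis (z \<bullet> \<xi>) * (LINT y|M. cis ((- \<xi>) \<bullet> y)))"
  proof (rule Bochner_Integration.integral_cong[OF refl])
    fix \<xi>
    have "?F y \<xi> = of_real (gauss r \<xi>) * cis (z \<bullet> \<xi>) * cis ((- \<xi>) \<bullet> y)" for y
      by (simp add: cis_mult inner_diff_left inner_commute[of \<xi>] mult.assoc)
    then show "(LINT y|M. ?F y \<xi>) = of_real (gauss r \<xi>) * cis (z \<bullet> \<xi>) * (LINT y|M. cis ((- \<xi>) \<bullet> y))"
      by (simp only: integral_mult_right_zero)
  qed
  finally show ?thesis .
qed

context
  fixes M :: "'a::euclidean_space measure" and f :: "'a \<Rightarrow> real"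
  assumes finite_M: "finite_measure M" and sets_M [measurable_cong]: "sets M = sets borel"
    and continuous_f: "continuous_on UNIV f" and f_nonneg: "\<And>x. 0 \<le> f x" and f_le_1: "\<And>x. f x \<le> 1"
begin

interpretation M: finite_measure M by (rule finite_M)

lemma measurable_f: "f \<in> borel_measurable borel"
  using continuous_f by (rule borel_measurable_continuous_onI)

lemma norm_mult_gauss_le: "norm (f x * gauss u w) \<le> norm (gauss u (w::'a))"
  using f_nonneg[of x] f_le_1[of x] by (simp add: abs_mult mult_left_le_one_le)

lemma norm_integral_shift_gauss_le: "norm (LINT v|lborel. f (y + c *\<^sub>R v) * gauss 1 (v::'a)) \<le> 1"
proof -
  note [measurable] = measurable_f
  have "norm (LINT v|lborel. f (y + c *\<^sub>R v) * gauss 1 (v::'a)) \<le> (LINT v|lborel. gauss 1 (v::'a))"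
    by (rule Bochner_Integration.integral_norm_bound_integral)
       (use norm_mult_gauss_le f_nonneg in
        \<open>auto intro!: Bochner_Integration.integrable_bound[OF integrable_gauss[of 1]]\<close>)
  then show ?thesis by (simp add: integral_gauss)
qed

lemma integral_gauss_convolution:
  assumes c: "c > 0"
  shows "(LINT z|lborel. f z * (LINT y|M. gauss (c\<^sup>2) (z - y)))
    = (LINT y|M. LINT v|lborel. f (y + c *\<^sub>R v) * gauss 1 v)"
proof -
  interpret pair_sigma_finite M "lborel :: 'a measure" ..
  note [measurable] = measurable_f
  have "integrable (M \<Otimes>\<^sub>M lborel) (\<lambda>(y, z). f z * gauss (c\<^sup>2) (z - y))"
  proof (rule Fubini_integrable)
    have "(LINT z|lborel. norm (f z * gauss (c\<^sup>2) (z - y))) = (LINT v|lborel. f (y + c *\<^sub>R v) * gauss 1 v)" for y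
      using integral_gauss_translate[OF measurable_f c, of y] f_nonneg by (simp add: abs_mult)
    then show "integrable M (\<lambda>y. LINT z|lborel. norm (case (y, z) of (y, z) \<Rightarrow> f z * gauss (c\<^sup>2) (z - y)))"
      using norm_integral_shift_gauss_le by (simp only: prod.case) (intro M.integrable_const_bound[where B=1], auto)
    have "integrable lborel (\<lambda>z. f z * gauss (c\<^sup>2) (z - y))" for y
      using integrable_lborel_translate_iff[of "gauss (c\<^sup>2)" "- y"] integrable_gauss[of "c\<^sup>2", where 'a='a] c
      by (intro Bochner_Integration.integrable_bound[OF _ _ AE_I2[OF norm_mult_gauss_le]]) auto
    then show "AE y in M. integrable lborel (\<lambda>z. case (y, z) of (y, z) \<Rightarrow> f z * gauss (c\<^sup>2) (z - y))" by simp
  qed measurable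
  from Fubini_integral[OF this] show ?thesis
    using integral_gauss_translate[OF measurable_f c] by simp
qed

lemma integral_shift_gauss_tendsto:
  "(\<lambda>n. LINT y|M. LINT v|lborel. f (y + (1 / real (Suc n)) *\<^sub>R v) * gauss 1 v) \<longlonglongrightarrow> (LINT y|M. f y)"
proof (rule integral_dominated_convergence[where w="\<lambda>_. 1"])
  note [measurable] = measurable_f
  have "(\<lambda>n. LINT v|lborel. f (y + (1 / real (Suc n)) *\<^sub>R v) * gauss 1 v) \<longlonglongrightarrow> (LINT v|lborel. f y * gauss 1 (v::'a))" for y
  proof (rule integral_dominated_convergence[where w="gauss 1"])
    have "(\<lambda>n. f (y + (1 / real (Suc n)) *\<^sub>R v)) \<longlonglongrightarrow> f y" for v
    proof (rule isCont_tendsto_compose[of y f])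
      show "isCont f y" using continuous_f by (simp add: continuous_on_eq_continuous_at)
      have "(\<lambda>n. y + (1 / real (Suc n)) *\<^sub>R v) \<longlonglongrightarrow> y + 0 *\<^sub>R v"
        using LIMSEQ_inverse_real_of_nat by (intro tendsto_intros) (simp add: inverse_eq_divide)
      then show "(\<lambda>n. y + (1 / real (Suc n)) *\<^sub>R v) \<longlonglongrightarrow> y" by simp
    qed
    then show "AE v in lborel. (\<lambda>n. f (y + (1 / real (Suc n)) *\<^sub>R v) * gauss 1 v) \<longlonglongrightarrow> f y * gauss 1 v"
      by (intro AE_I2 tendsto_mult tendsto_const)
  qed (use integrable_gauss[of 1, where 'a='a] norm_mult_gauss_le in auto)
  then show "AE y in M. (\<lambda>n. LINT v|lborel. f (y + (1 / real (Suc n)) *\<^sub>R v) * gauss 1 v) \<longlonglongrightarrow> f y"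
    by (simp add: integral_gauss)
qed (use measurable_f[measurable] norm_integral_shift_gauss_le in auto)

lemma integral_gauss_convolution_tendsto:
  "(\<lambda>n. LINT z|lborel. f z * (LINT y|M. gauss ((1 / real (Suc n))\<^sup>2) (z - y))) \<longlonglongrightarrow> (LINT y|M. f y)"
  using integral_shift_gauss_tendsto by (simp add: integral_gauss_convolution del: of_nat_Suc)

end

lemma finite_measure_eqI_char:
  fixes M N :: "'a::euclidean_space measure"
  assumes finite: "finite_measure M" "finite_measure N"
    and sets: "sets M = sets borel" "sets N = sets borel"
    and char: "\<And>\<xi>. (LINT y|M. cis (\<xi> \<bullet> y)) = (LINT y|N. cis (\<xi> \<bullet> y))"
  shows "M = N"
proof (rule finite_measure_eqI_continuous[OF finite sets])
  fix f :: "'a \<Rightarrow> real" assume f: "continuous_on UNIV f" "\<And>x. 0 \<le> f x" "\<And>x. f x \<le> 1"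
  have "(LINT y|M. gauss u (z - y)) = (LINT y|N. gauss u (z - y))" if "u > 0" for u z
    using integral_gauss_char[OF finite(1) sets(1) that, of z] integral_gauss_char[OF finite(2) sets(2) that, of z]
    unfolding char by (metis of_real_eq_iff)
  then show "(LINT x|M. f x) = (LINT x|N. f x)"
    using integral_gauss_convolution_tendsto[OF finite(1) sets(1) f]
      integral_gauss_convolution_tendsto[OF finite(2) sets(2) f]
    by (simp add: LIMSEQ_unique)
qed

section \<open>The one-sided stable law\<close>

lemma nn_integral_powr_Icc_0:
  fixes s R :: real
  assumes "s > 0" "R \<ge> 0"
  shows "(\<integral>\<^sup>+v\<in>{0..R}. ennreal (v powr (s - 1)) \<partial>lborel) = ennreal (R powr s / s)"
  using has_integral_powr_from_0[of "s - 1" R] assms by (intro nn_integral_has_integral_lebesgue') auto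

lemma nn_integral_powr_atLeast:
  fixes s R :: real
  assumes "s > 0" "R > 0"
  shows "(\<integral>\<^sup>+v\<in>{R..}. ennreal (v powr (- s - 1)) \<partial>lborel) = ennreal (R powr (- s) / s)"
  using has_integral_powr_to_inf[of "- s - 1" R] assms by (intro nn_integral_has_integral_lebesgue') auto

lemma one_minus_exp_ge_linear:
  fixes v :: real
  assumes "0 \<le> v" "v \<le> 1"
  shows "(1 - exp (- 1)) * v \<le> 1 - exp (- v)"
  using convex_onD[OF exp_convex, of v 0 "-1"] assms by (simp add: algebra_simps)

lemma one_minus_exp_le:
  fixes v :: real
  shows "1 - exp (- v) \<le> v"
  using exp_ge_add_one_self[of "- v"] by simp

lemma power_Suc_tendsto_exp_minus:
  fixes z :: "nat \<Rightarrow> real"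
  assumes z_nonneg: "\<And>n. 0 \<le> z n" and lim: "(\<lambda>n. real (Suc n) * (1 - z n)) \<longlonglongrightarrow> L"
  shows "(\<lambda>n. z n ^ Suc n) \<longlonglongrightarrow> exp (- L)"
proof (rule tendsto_sandwich)
  have "(\<lambda>n. 1 - (real (Suc n) * (1 - z n)) * (1 / real (Suc n))) \<longlonglongrightarrow> 1 - L * 0"
    using LIMSEQ_inverse_real_of_nat by (intro tendsto_intros lim) (simp add: inverse_eq_divide)
  then have z_lim: "z \<longlonglongrightarrow> 1" by (simp del: of_nat_Suc)
  show "\<forall>\<^sub>F n in sequentially. z n ^ Suc n \<le> exp (- (real (Suc n) * (1 - z n)))"
  proof (intro always_eventually allI)
    fix n
    have "z n \<le> exp (- (1 - z n))" using exp_ge_add_one_self[of "z n - 1"] by simp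
    then have "z n ^ Suc n \<le> exp (- (1 - z n)) ^ Suc n" using z_nonneg by (intro power_mono) auto
    also have "\<dots> = exp (real (Suc n) * - (1 - z n))" by (rule exp_of_nat_mult[symmetric])
    finally show "z n ^ Suc n \<le> exp (- (real (Suc n) * (1 - z n)))" by (simp only: mult_minus_right)
  qed
  have "\<forall>\<^sub>F n in sequentially. 0 < z n" by (rule order_tendstoD[OF z_lim]) simp
  then show "\<forall>\<^sub>F n in sequentially. exp (- (real (Suc n) * (1 - z n) / z n)) \<le> z n ^ Suc n"
  proof eventually_elim
    case (elim n)
    have "1 / z n \<le> exp ((1 - z n) / z n)"
      using exp_ge_add_one_self[of "(1 - z n) / z n"] elim by (simp add: field_simps)
    then have "exp (- ((1 - z n) / z n)) \<le> z n" using elim by (simp add: exp_minus field_simps)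
    then have "exp (- ((1 - z n) / z n)) ^ Suc n \<le> z n ^ Suc n" by (intro power_mono) auto
    then show ?case by (simp add: exp_of_nat_mult[symmetric] del: power_Suc of_nat_Suc)
  qed
  have "(\<lambda>n. exp (- (real (Suc n) * (1 - z n) / z n))) \<longlonglongrightarrow> exp (- (L / 1))"
    by (intro tendsto_intros lim z_lim) simp
  then show "(\<lambda>n. exp (- (real (Suc n) * (1 - z n) / z n))) \<longlonglongrightarrow> exp (- L)" by simp
qed (intro tendsto_intros lim)

context
  fixes \<mu> :: "nat \<Rightarrow> real measure" and N :: "real measure"
  assumes distributions: "\<And>n. real_distribution (\<mu> n)" "real_distribution N"
    and weak_conv: "weak_conv_m \<mu> N"
    and nonneg: "\<And>n. AE u in \<mu> n. 0 \<le> u"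
begin

interpretation N: real_distribution N by (rule distributions)

lemma weak_conv_m_AE_nonneg: "AE u in N. 0 \<le> u"
proof -
  let ?f = "\<lambda>u::real. min 1 (max 0 (- u))"
  have "(LINT u|\<mu> n. ?f u) = 0" for n
    by (rule integral_eq_zero_AE) (use nonneg[of n] in \<open>auto elim!: eventually_mono\<close>)
  then have "(LINT u|N. ?f u) = 0"
    using weak_conv_imp_integral_bdd_continuous_conv[OF distributions weak_conv, of ?f 1]
    by (simp add: LIMSEQ_const_iff continuous_intros)
  moreover have "integrable N ?f" by (rule N.integrable_const_bound[where B=1]) auto
  ultimately have "AE u in N. ?f u = 0" by (subst (asm) integral_nonneg_eq_0_iff_AE) auto
  then show ?thesis by eventually_elim (auto simp: min_def max_def split: if_splits)
qed

lemma weak_conv_m_laplace: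
  assumes l: "l > 0"
  shows "(\<lambda>n. LINT u|\<mu> n. exp (- (l * u))) \<longlonglongrightarrow> (LINT u|N. exp (- (l * u)))"
proof -
  let ?f = "\<lambda>u::real. exp (- (l * max 0 u))"
  have truncation: "(LINT u|\<nu>. ?f u) = (LINT u|\<nu>. exp (- (l * u)))"
    if "real_distribution \<nu>" "AE u in \<nu>. 0 \<le> u" for \<nu>
  proof (rule integral_cong_AE)
    interpret real_distribution \<nu> by fact
    show "?f \<in> borel_measurable \<nu>" "(\<lambda>u. exp (- (l * u))) \<in> borel_measurable \<nu>" by measurable
    show "AE u in \<nu>. ?f u = exp (- (l * u))" using that(2) by eventually_elim simp
  qed
  have "(\<lambda>n. LINT u|\<mu> n. ?f u) \<longlonglongrightarrow> (LINT u|N. ?f u)"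
    by (rule weak_conv_imp_integral_bdd_continuous_conv[OF distributions weak_conv, where B=1])
       (use l in \<open>auto intro!: continuous_intros\<close>)
  then show ?thesis
    by (simp add: truncation[OF distributions(1) nonneg] truncation[OF distributions(2) weak_conv_m_AE_nonneg])
qed

end

lemma (in real_distribution) AE_pos_if_laplace_tendsto_0:
  assumes nonneg: "AE u in M. 0 \<le> u"
    and lim: "((\<lambda>l. LINT u|M. exp (- (l * u))) \<longlongrightarrow> 0) at_top"
  shows "AE u in M. 0 < u"
proof -
  have "measure M {0} \<le> (LINT u|M. exp (- (l * u)))" if l: "l > 0" for l :: real
  proof -
    have "measure M {0} = (LINT u|M. indicator {0} u)" by simp
    also have "\<dots> \<le> (LINT u|M. exp (- (l * u)))"
    proof (rule integral_mono_AE)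
      show "integrable M (indicator {0} :: real \<Rightarrow> real)"
        by (rule integrable_const_bound[where B=1]) (auto simp: indicator_def)
      show "integrable M (\<lambda>u. exp (- (l * u)))"
        by (rule integrable_const_bound[where B=1]) (use nonneg l in \<open>auto elim!: eventually_mono\<close>)
    qed (auto simp: indicator_def)
    finally show ?thesis .
  qed
  then have "\<forall>\<^sub>F l in at_top. measure M {0} \<le> (LINT u|M. exp (- (l * u)))"
    by (rule eventually_mono[OF eventually_gt_at_top[of 0]])
  from tendsto_lowerbound[OF lim this] have "measure M {0} = 0"
    using measure_nonneg[of M "{0}"] by simp
  then have "AE u in M. u \<noteq> 0" by (intro AE_I[of _ _ "{0}"]) (auto simp: emeasure_eq_measure)
  with nonneg show ?thesis by eventually_elim auto
qed

text \<open>The one-sided stable law of index \<open>a\<close> is the weak limit of normalized sums of independent variables with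
  the Pareto density \<open>a u\<^bsup>-a-1\<^esup>\<close> on \<open>[1, \<infinity>)\<close>.\<close>

locale pareto =
  fixes a :: real
  assumes a: "0 < a" "a < 1"
begin

definition pareto_law :: "real measure" where
  "pareto_law = density lborel (\<lambda>u. ennreal (a * (indicator {1..} u * u powr (- a - 1))))"

definition defect_density :: "real \<Rightarrow> real" where
  "defect_density v = indicator {0<..} v * ((1 - exp (- v)) * (a * v powr (- a - 1)))"

definition tail_defect :: "real \<Rightarrow> real" where
  "tail_defect l = (LINT v|lborel. indicator {l..} v * defect_density v)"

definition total_defect :: real where
  "total_defect = (LINT v|lborel. defect_density v)"

definition pareto_laplace :: "real \<Rightarrow> real" where
  "pareto_laplace l = (LINT u|pareto_law. exp (- (l * u)))"

lemma sets_pareto_law [measurable_cong, simp]: "sets pareto_law = sets borel"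
  by (simp add: pareto_law_def)

lemma space_pareto_law [simp]: "space pareto_law = UNIV"
  by (simp add: pareto_law_def)

lemma AE_pareto_law: "AE u in pareto_law. 1 \<le> u"
  unfolding pareto_law_def by (subst AE_density) (auto simp: indicator_def intro!: AE_I2)

lemma prob_space_pareto_law: "prob_space pareto_law"
proof
  have "emeasure pareto_law UNIV = (\<integral>\<^sup>+u. ennreal a * (ennreal (u powr (- a - 1)) * indicator {1..} u) \<partial>lborel)"
    unfolding pareto_law_def using a
    by (subst emeasure_density) (auto intro!: nn_integral_cong simp: indicator_def simp flip: ennreal_mult)
  also have "\<dots> = 1"
    using a nn_integral_powr_atLeast[of a 1] by (subst nn_integral_cmult) (auto simp flip: ennreal_mult)
  finally show "emeasure pareto_law (space pareto_law) = 1" by simp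
qed

interpretation pareto_law: prob_space pareto_law by (rule prob_space_pareto_law)

lemma defect_density_nonneg [simp]: "0 \<le> defect_density v"
  using a by (auto simp: defect_density_def indicator_def)

lemma measurable_defect_density [measurable]: "defect_density \<in> borel_measurable borel"
  unfolding defect_density_def[abs_def] by measurable

lemma defect_density_le_near: "v > 0 \<Longrightarrow> defect_density v \<le> v powr ((1 - a) - 1)"
proof -
  assume v: "v > 0"
  have "(1 - exp (- v)) * (a * v powr (- a - 1)) \<le> v * (1 * v powr (- a - 1))"
    using a v one_minus_exp_le[of v] by (intro mult_mono) auto
  also have "\<dots> = v powr ((1 - a) - 1)" using v by (simp add: powr_diff powr_minus)
  finally show ?thesis using v by (simp add: defect_density_def)
qed

lemma defect_density_le_far: "v > 0 \<Longrightarrow> defect_density v \<le> v powr (- a - 1)"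
proof -
  assume v: "v > 0"
  have "(1 - exp (- v)) * (a * v powr (- a - 1)) \<le> 1 * (1 * v powr (- a - 1))"
    using a v by (intro mult_mono) auto
  then show ?thesis using v by (simp add: defect_density_def)
qed

lemma integrable_defect_density: "integrable lborel defect_density"
proof (rule integrableI_nonneg)
  have "(\<integral>\<^sup>+v. ennreal (defect_density v) \<partial>lborel) \<le> (\<integral>\<^sup>+v. ennreal (v powr ((1 - a) - 1)) * indicator {0..1} v
      + ennreal (v powr (- a - 1)) * indicator {1..} v \<partial>lborel)"
  proof (rule nn_integral_mono)
    fix v :: real
    consider (nonpos) "v \<le> 0" | (near) "0 < v" "v \<le> 1" | (far) "1 < v" by linarith
    then show "ennreal (defect_density v) \<le> ennreal (v powr ((1 - a) - 1)) * indicator {0..1} v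
      + ennreal (v powr (- a - 1)) * indicator {1..} v"
    proof cases
      case nonpos
      then show ?thesis by (simp add: defect_density_def)
    next
      case near
      then show ?thesis using defect_density_le_near[of v] by (intro add_increasing2) (auto intro: ennreal_leI)
    next
      case far
      then show ?thesis using defect_density_le_far[of v] by (intro add_increasing) (auto intro: ennreal_leI)
    qed
  qed
  also have "\<dots> < \<infinity>"
    using a nn_integral_powr_Icc_0[of "1 - a" 1] nn_integral_powr_atLeast[of a 1]
    by (subst nn_integral_add) auto
  finally show "(\<integral>\<^sup>+v. ennreal (defect_density v) \<partial>lborel) < \<infinity>" .
qed auto

lemma integrable_tail_defect: "integrable lborel (\<lambda>v. indicator {l..} v * defect_density v)"
  by (rule Bochner_Integration.integrable_bound[OF integrable_defect_density]) (auto simp: indicator_def)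

lemma tail_defect_nonneg: "0 \<le> tail_defect l"
  unfolding tail_defect_def by (rule integral_nonneg_AE) auto

lemma tail_defect_le: "tail_defect l \<le> total_defect"
  unfolding tail_defect_def total_defect_def
  by (rule integral_mono[OF integrable_tail_defect integrable_defect_density]) (auto simp: indicator_def)

lemma tail_defect_tendsto:
  assumes "X \<longlonglongrightarrow> 0"
  shows "(\<lambda>n. tail_defect (X n)) \<longlonglongrightarrow> total_defect"
  unfolding tail_defect_def total_defect_def
proof (rule integral_dominated_convergence[OF _ _ integrable_defect_density])
  show "AE v in lborel. (\<lambda>n. indicator {X n..} v * defect_density v) \<longlonglongrightarrow> defect_density v"
  proof (intro AE_I2)
    fix v :: real
    show "(\<lambda>n. indicator {X n..} v * defect_density v) \<longlonglongrightarrow> defect_density v"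
    proof (cases "v > 0")
      case True
      have "eventually (\<lambda>n. X n < v) sequentially" using assms True by (rule order_tendstoD)
      then have "eventually (\<lambda>n. indicator {X n..} v * defect_density v = defect_density v) sequentially"
        by eventually_elim (auto simp: indicator_def)
      then show ?thesis by (rule tendsto_eventually)
    qed (simp add: defect_density_def)
  qed
qed (auto simp: indicator_def)

lemma integrable_exp_pareto: "l > 0 \<Longrightarrow> integrable pareto_law (\<lambda>u. exp (- (l * u)))"
  using AE_pareto_law by (intro pareto_law.integrable_const_bound[where B=1]) (auto elim: AE_mp)

lemma one_minus_pareto_laplace:
  assumes l: "l > 0"
  shows "1 - pareto_laplace l = l powr a * tail_defect l"
proof -
  let ?density = "\<lambda>u. a * (indicator {1..} u * u powr (- a - 1))"
  have "1 - pareto_laplace l = (LINT u|pareto_law. 1 - exp (- (l * u)))"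
    using integrable_exp_pareto[OF l] pareto_law.prob_space
    unfolding pareto_laplace_def by (subst Bochner_Integration.integral_diff) auto
  also have "\<dots> = (LINT u|lborel. ?density u * (1 - exp (- (l * u))))"
    unfolding pareto_law_def using a by (subst integral_density) (auto simp: indicator_def)
  also have "\<dots> = (LINT u|lborel. (1 / l) * (?density (u / l) * (1 - exp (- u))))"
    using lborel_integral_real_affine[of "1 / l" "\<lambda>u. ?density u * (1 - exp (- (l * u)))" 0] l by simp
  also have "\<dots> = (LINT u|lborel. l powr a * (indicator {l..} u * defect_density u))"
  proof (rule Bochner_Integration.integral_cong[OF refl])
    fix u :: real
    have "(1 / l) * (u / l) powr (- a - 1) = l powr a * u powr (- a - 1)" if "u > 0"
      using that l by (simp add: powr_divide powr_diff powr_minus field_simps)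
    then show "(1 / l) * (?density (u / l) * (1 - exp (- u))) = l powr a * (indicator {l..} u * defect_density u)"
      using l by (cases "u \<ge> l") (auto simp: defect_density_def indicator_def field_simps)
  qed
  finally show ?thesis by (simp add: tail_defect_def)
qed

lemma pareto_laplace_nonneg: "0 \<le> pareto_laplace l"
  unfolding pareto_laplace_def by (rule integral_nonneg_AE) auto

lemma pareto_laplace_le_1: "l > 0 \<Longrightarrow> pareto_laplace l \<le> 1"
  using one_minus_pareto_laplace[of l] tail_defect_nonneg[of l]
  by (metis diff_ge_0_iff_ge mult_nonneg_nonneg powr_ge_zero)

lemma total_defect_pos: "total_defect > 0"
proof -
  have "pareto_laplace 1 \<le> (LINT u|pareto_law. exp (- 1))" unfolding pareto_laplace_def
    by (rule integral_mono_AE) (use integrable_exp_pareto[of 1] AE_pareto_law in auto)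
  also have "\<dots> < 1" using pareto_law.prob_space by simp
  finally show ?thesis using one_minus_pareto_laplace[of 1] tail_defect_le[of 1] by simp
qed

definition norming :: "nat \<Rightarrow> real" where
  "norming n = (real (Suc n) * total_defect) powr (- 1 / a)"

definition normalized_sum :: "nat \<Rightarrow> real measure" where
  "normalized_sum n = distr (\<Pi>\<^sub>M i\<in>{..<Suc n}. pareto_law) borel (\<lambda>w. norming n * (\<Sum>i<Suc n. w i))"

lemma norming_pos: "norming n > 0"
  using total_defect_pos by (simp add: norming_def)

lemma norming_powr: "norming n powr a = 1 / (real (Suc n) * total_defect)"
  unfolding norming_def powr_powr using a total_defect_pos by (simp add: powr_minus_divide)

lemma norming_tendsto_0: "norming \<longlonglongrightarrow> 0"
proof -
  have "filterlim (\<lambda>n. real (Suc n) * total_defect) at_top sequentially"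
    using total_defect_pos by real_asymp
  then show ?thesis unfolding norming_def[abs_def] by (rule tendsto_neg_powr[rotated]) (use a in simp)
qed

lemma real_distribution_normalized_sum: "real_distribution (normalized_sum n)"
proof -
  interpret product_prob_space "\<lambda>_. pareto_law" "{..<Suc n}" ..
  show ?thesis unfolding normalized_sum_def by (rule real_distribution_distr) measurable
qed

lemma normalized_sum_nonneg: "AE u in normalized_sum n. 0 \<le> u"
proof -
  interpret finite_product_prob_space "\<lambda>_. pareto_law" "{..<Suc n}" by standard simp
  have "AE w in (\<Pi>\<^sub>M i\<in>{..<Suc n}. pareto_law). 1 \<le> w i" if "i < Suc n" for i
    by (rule AE_PiM_component) (use that AE_pareto_law prob_space_pareto_law in auto)
  then have "AE w in (\<Pi>\<^sub>M i\<in>{..<Suc n}. pareto_law). \<forall>i\<in>{..<Suc n}. 1 \<le> w i"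
    by (intro AE_finite_allI) auto
  then have "AE w in (\<Pi>\<^sub>M i\<in>{..<Suc n}. pareto_law). 0 \<le> norming n * (\<Sum>i<Suc n. w i)"
  proof eventually_elim
    case (elim w)
    have "0 \<le> w i" if "i < Suc n" for i using elim[rule_format, of i] that by simp
    then show ?case using norming_pos[of n] by (intro mult_nonneg_nonneg sum_nonneg) auto
  qed
  then show ?thesis unfolding normalized_sum_def by (subst AE_distr_iff) auto
qed

lemma laplace_normalized_sum:
  assumes l: "l > 0"
  shows "(LINT u|normalized_sum n. exp (- (l * u))) = pareto_laplace (l * norming n) ^ Suc n"
proof -
  interpret product_sigma_finite "\<lambda>_::nat. pareto_law" ..
  have "(LINT u|normalized_sum n. exp (- (l * u)))
      = integral\<^sup>L (\<Pi>\<^sub>M i\<in>{..<Suc n}. pareto_law) (\<lambda>w. exp (- (l * (norming n * (\<Sum>i<Suc n. w i)))))"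
    unfolding normalized_sum_def by (subst integral_distr) auto
  also have "\<dots> = integral\<^sup>L (\<Pi>\<^sub>M i\<in>{..<Suc n}. pareto_law) (\<lambda>w. \<Prod>i<Suc n. exp (- (l * norming n * w i)))"
    by (simp add: exp_sum[symmetric] sum_negf sum_distrib_left mult.assoc del: sum.lessThan_Suc prod.lessThan_Suc)
  also have "\<dots> = (\<Prod>i<Suc n. pareto_laplace (l * norming n))" unfolding pareto_laplace_def
    by (subst product_integral_prod) (use integrable_exp_pareto[of "l * norming n"] l norming_pos[of n] in auto)
  finally show ?thesis by simp
qed

lemma Suc_mult_one_minus_laplace:
  assumes l: "l > 0"
  shows "real (Suc n) * (1 - pareto_laplace (l * norming n)) = l powr a / total_defect * tail_defect (l * norming n)"
  using one_minus_pareto_laplace[of "l * norming n"] l norming_pos[of n] total_defect_pos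
  by (simp add: powr_mult norming_powr del: of_nat_Suc)

lemma one_minus_laplace_normalized_sum_le:
  assumes l: "l > 0"
  shows "1 - (LINT u|normalized_sum n. exp (- (l * u))) \<le> l powr a"
proof -
  let ?defect = "1 - pareto_laplace (l * norming n)"
  have pos: "l * norming n > 0" using l norming_pos[of n] by simp
  have "1 + real (Suc n) * (- ?defect) \<le> (1 + - ?defect) ^ Suc n"
    by (rule Bernoulli_inequality) (use pareto_laplace_nonneg pareto_laplace_le_1[OF pos] in auto)
  then have "1 - pareto_laplace (l * norming n) ^ Suc n \<le> real (Suc n) * ?defect" by (simp add: algebra_simps)
  also have "\<dots> \<le> l powr a / total_defect * total_defect"
    unfolding Suc_mult_one_minus_laplace[OF l] using total_defect_pos by (intro mult_left_mono tail_defect_le) auto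
  also have "\<dots> = l powr a" using total_defect_pos by simp
  finally show ?thesis using laplace_normalized_sum[OF l] by simp
qed

lemma laplace_normalized_sum_tendsto:
  assumes l: "l > 0"
  shows "(\<lambda>n. LINT u|normalized_sum n. exp (- (l * u))) \<longlonglongrightarrow> exp (- (l powr a))"
  unfolding laplace_normalized_sum[OF l]
proof (rule power_Suc_tendsto_exp_minus[OF pareto_laplace_nonneg])
  have "(\<lambda>n. l * norming n) \<longlonglongrightarrow> 0" using tendsto_mult_right_zero[OF norming_tendsto_0] .
  then have "(\<lambda>n. l powr a / total_defect * tail_defect (l * norming n)) \<longlonglongrightarrow> l powr a / total_defect * total_defect"
    by (intro tendsto_intros tail_defect_tendsto)
  then show "(\<lambda>n. real (Suc n) * (1 - pareto_laplace (l * norming n))) \<longlonglongrightarrow> l powr a"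
    unfolding Suc_mult_one_minus_laplace[OF l] using total_defect_pos by simp
qed

lemma normalized_sum_tail_le:
  assumes R: "R > 0"
  shows "measure (normalized_sum n) {R<..} \<le> R powr (- a) / (1 - exp (- 1))"
proof -
  interpret real_distribution "normalized_sum n" by (rule real_distribution_normalized_sum)
  let ?f = "\<lambda>u. 1 - exp (- (1 / R * u))"
  have integrable_exp: "integrable (normalized_sum n) (\<lambda>u. exp (- (1 / R * u)))"
    by (rule integrable_const_bound[where B=1]) (use normalized_sum_nonneg[of n] R in \<open>auto elim!: eventually_mono\<close>)
  have "measure (normalized_sum n) {R<..}
      \<le> measure (normalized_sum n) {u \<in> space (normalized_sum n). 1 - exp (- 1) \<le> ?f u}"
    using R by (intro finite_measure_mono) (auto simp: space_eq_univ field_simps)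
  also have "\<dots> \<le> (LINT u|normalized_sum n. ?f u) / (1 - exp (- 1))"
    by (rule integral_Markov_inequality_measure[where A="{}"])
       (use integrable_exp normalized_sum_nonneg[of n] R in \<open>auto elim!: eventually_mono\<close>)
  also have "(LINT u|normalized_sum n. ?f u) = 1 - (LINT u|normalized_sum n. exp (- (1 / R * u)))"
    using integrable_exp prob_space by (subst Bochner_Integration.integral_diff) auto
  also have "\<dots> / (1 - exp (- 1)) \<le> (1 / R) powr a / (1 - exp (- 1))"
    using one_minus_laplace_normalized_sum_le[of "1 / R" n] R by (intro divide_right_mono) auto
  finally show ?thesis using R by (simp add: powr_divide powr_minus_divide)
qed

lemma tight_normalized_sum: "tight normalized_sum"
  unfolding tight_def
proof (intro conjI allI impI real_distribution_normalized_sum)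
  fix \<epsilon> :: real assume \<epsilon>: "\<epsilon> > 0"
  define gap :: real where "gap = 1 - exp (- 1)"
  have gap_pos: "gap > 0" by (simp add: gap_def)
  define R where "R = (gap * \<epsilon> / 2) powr (- 1 / a)"
  have R: "R > 0" using \<epsilon> gap_pos by (simp add: R_def)
  have R_powr: "R powr (- a) / gap = \<epsilon> / 2" using \<epsilon> gap_pos a by (simp add: R_def powr_powr)
  have "1 - \<epsilon> < measure (normalized_sum n) {- 1<..R}" for n
  proof -
    interpret real_distribution "normalized_sum n" by (rule real_distribution_normalized_sum)
    have tail: "measure (normalized_sum n) {R<..} \<le> \<epsilon> / 2"
      using normalized_sum_tail_le[OF R, of n] by (simp only: R_powr flip: gap_def)
    have "measure (normalized_sum n) {- 1<..R} + measure (normalized_sum n) {R<..}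
        = measure (normalized_sum n) {- 1<..}"
      using R by (subst finite_measure_Union[symmetric])
        (auto intro: arg_cong[where f="measure (normalized_sum n)"] simp: ivl_disj_un)
    moreover have "measure (normalized_sum n) {- 1<..} = 1"
      by (subst prob_eq_1) (use normalized_sum_nonneg[of n] in \<open>auto elim!: eventually_mono\<close>)
    ultimately show ?thesis using tail \<epsilon> by simp
  qed
  then show "\<exists>x y. x < y \<and> (\<forall>n. 1 - \<epsilon> < measure (normalized_sum n) {x<..y})"
    using R by (intro exI[of _ "- 1"] exI[of _ R]) auto
qed

theorem one_sided_stable_law_exists:
  "\<exists>N. real_distribution N \<and> (AE u in N. 0 < u) \<and> (\<forall>l>0. (LINT u|N. exp (- (l * u))) = exp (- (l powr a)))"
proof -
  obtain r N where r: "strict_mono (r :: nat \<Rightarrow> nat)" and N: "real_distribution N"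
    and weak_conv: "weak_conv_m (\<lambda>n. normalized_sum (r n)) N"
    using tight_imp_convergent_subsubsequence[OF tight_normalized_sum, of id] by (auto simp: strict_mono_def comp_def)
  interpret N: real_distribution N by fact
  note limit_law = real_distribution_normalized_sum N weak_conv normalized_sum_nonneg
  have laplace: "(LINT u|N. exp (- (l * u))) = exp (- (l powr a))" if "l > 0" for l
    using LIMSEQ_unique[OF weak_conv_m_laplace[OF limit_law that]]
      LIMSEQ_subseq_LIMSEQ[OF laplace_normalized_sum_tendsto[OF that] r] by (simp add: comp_def)
  have "((\<lambda>l. exp (- (l powr a))) \<longlongrightarrow> 0) at_top" using a by real_asymp
  then have "((\<lambda>l. LINT u|N. exp (- (l * u))) \<longlongrightarrow> 0) at_top"
    by (rule Lim_transform_eventually) (use eventually_gt_at_top[of 0] in \<open>eventually_elim, simp add: laplace\<close>)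
  then have "AE u in N. 0 < u"
    by (rule N.AE_pos_if_laplace_tendsto_0[OF weak_conv_m_AE_nonneg[OF limit_law]])
  then show ?thesis using N laplace by blast
qed

end

section \<open>The isotropic stable density\<close>

definition stable_profile :: "real \<Rightarrow> real \<Rightarrow> 'a::euclidean_space \<Rightarrow> real" where
  "stable_profile \<alpha> t x = (if x = 0 then t powr (- real DIM('a) / \<alpha>)
     else min (t powr (- real DIM('a) / \<alpha>)) (t / norm x powr (real DIM('a) + \<alpha>)))"

lemma stable_profile_pos: "t > 0 \<Longrightarrow> 0 < stable_profile \<alpha> t x"
  by (simp add: stable_profile_def)

lemma stable_profile_scale:
  fixes x :: "'a::euclidean_space"
  assumes "t > 0" "\<alpha> > 0"
  shows "stable_profile \<alpha> t x = t powr (- real DIM('a) / \<alpha>) * stable_profile \<alpha> 1 ((1 / t powr (1 / \<alpha>)) *\<^sub>R x)"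
proof (cases "x = 0")
  case False
  let ?d = "real DIM('a)" and ?y = "(1 / t powr (1 / \<alpha>)) *\<^sub>R x"
  have "norm ?y powr (?d + \<alpha>) = norm x powr (?d + \<alpha>) / t powr (1 / \<alpha> * (?d + \<alpha>))"
    using assms by (simp add: powr_divide powr_powr)
  also have "1 / \<alpha> * (?d + \<alpha>) = ?d / \<alpha> + 1" using assms by (simp add: field_simps)
  also have "t powr (?d / \<alpha> + 1) = t powr (?d / \<alpha>) * t" using assms by (simp add: powr_add)
  finally have "t powr (- ?d / \<alpha>) * (1 / norm ?y powr (?d + \<alpha>)) = t / norm x powr (?d + \<alpha>)"
    using assms False by (simp add: powr_minus field_simps)
  moreover have "stable_profile \<alpha> 1 ?y = min 1 (1 / norm ?y powr (?d + \<alpha>))"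
    using assms False by (simp add: stable_profile_def)
  ultimately have "t powr (- ?d / \<alpha>) * stable_profile \<alpha> 1 ?y = min (t powr (- ?d / \<alpha>)) (t / norm x powr (?d + \<alpha>))"
    by (simp only: min_mult_distrib_left powr_ge_zero if_True mult_1_right)
  then show ?thesis using False by (simp add: stable_profile_def)
qed (use assms in \<open>simp add: stable_profile_def\<close>)

locale stable_kernel =
  fixes \<alpha> C0 :: real and p :: "real \<Rightarrow> 'a::euclidean_space \<Rightarrow> real"
  assumes alpha: "0 < \<alpha>" "\<alpha> < 2" "\<alpha> < real DIM('a)"
    and C0: "C0 \<ge> 1"
    and p_lower: "\<And>t x. t > 0 \<Longrightarrow> stable_profile \<alpha> t x / C0 \<le> p t x"
    and p_upper: "\<And>t x. t > 0 \<Longrightarrow> p t x \<le> C0 * stable_profile \<alpha> t x"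
    and continuous_p: "continuous_on ({0<..} \<times> UNIV) (\<lambda>(t, x). p t x)"
    and measurable_p [measurable]: "(\<lambda>(t, x). p t x) \<in> borel_measurable (borel \<Otimes>\<^sub>M borel)"
    and p_nonneg [simp]: "\<And>t x. 0 \<le> p t x"
    and p_minus: "\<And>t x. p t (- x) = p t x"
    and char_p: "\<And>t \<xi>. t > 0 \<Longrightarrow> (LINT y|lborel. complex_of_real (p t y) * cis (\<xi> \<bullet> y)) = exp (- t * norm \<xi> powr \<alpha>)"

lemma exp_ge_powr:
  fixes y q :: real
  assumes "y > 0" "q > 0"
  shows "(y / q) powr q \<le> exp y"
proof -
  have "y / q \<le> exp (y / q)" using exp_ge_add_one_self[of "y / q"] by linarith
  then have "(y / q) powr q \<le> exp (y / q) powr q" using assms by (intro powr_mono2) auto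
  also have "\<dots> = exp y" using assms by (simp add: powr_def)
  finally show ?thesis .
qed

lemma nn_integral_Gamma_scaled:
  fixes s u :: real
  assumes s: "s > 0" and u: "u > 0"
  shows "(\<integral>\<^sup>+l\<in>{0..}. ennreal (l powr (s - 1) * exp (- (u * l))) \<partial>lborel) = ennreal (Gamma s * u powr (- s))"
proof -
  let ?I = "\<integral>\<^sup>+l\<in>{0..}. ennreal (l powr (s - 1) * exp (- (u * l))) \<partial>lborel"
  have "ennreal (Gamma s) = (\<integral>\<^sup>+t. ennreal (indicator {0..} t * t powr (s - 1) / exp t) \<partial>lborel)"
    by (rule Gamma_conv_nn_integral_real[OF s])
  also have "\<dots> = ennreal u * (\<integral>\<^sup>+t. ennreal (indicator {0..} (u * t) * (u * t) powr (s - 1) / exp (u * t)) \<partial>lborel)"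
    using u by (subst nn_integral_real_affine[where c=u and t=0]) auto
  also have "(\<integral>\<^sup>+t. ennreal (indicator {0..} (u * t) * (u * t) powr (s - 1) / exp (u * t)) \<partial>lborel)
      = (\<integral>\<^sup>+t. ennreal (u powr (s - 1)) * (ennreal (t powr (s - 1) * exp (- (u * t))) * indicator {0..} t) \<partial>lborel)"
    using u by (intro nn_integral_cong)
      (auto simp: indicator_def powr_mult exp_minus field_simps zero_le_mult_iff simp flip: ennreal_mult)
  also have "ennreal u * \<dots> = ennreal (u powr s) * ?I"
    using u by (subst nn_integral_cmult) (auto simp: powr_diff mult.assoc[symmetric] simp flip: ennreal_mult)
  finally have "ennreal (u powr (- s)) * ennreal (Gamma s) = ennreal (u powr (- s) * u powr s) * ?I"
    by (simp add: ennreal_mult mult.assoc)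
  also have "u powr (- s) * u powr s = 1" using u by (simp add: powr_minus field_simps)
  finally show ?thesis using s by (simp add: ennreal_mult' mult.commute)
qed

lemma powr_mult_exp_powr_le:
  fixes l s a :: real
  assumes l: "l > 0" and s: "s > 0" and a: "a > 0"
  defines "q \<equiv> (s + 1) / a"
  shows "l powr (s - 1) * exp (- (l powr a)) \<le> q powr q * l powr (- 1 - 1)"
proof -
  have q: "q > 0" "a * q = s + 1" using s a by (simp_all add: q_def)
  have "l powr (s - 1) * l powr 2 / q powr q = (l powr a / q) powr q"
    using l q by (simp add: powr_divide powr_powr powr_add[symmetric] del: powr_numeral) (simp add: add.commute)
  also have "\<dots> \<le> exp (l powr a)" using l q by (intro exp_ge_powr) auto
  finally have "l powr (s - 1) * l powr 2 \<le> q powr q * exp (l powr a)" using q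
    by (simp add: pos_divide_le_eq mult.commute)
  then show ?thesis using l by (simp add: exp_minus powr_minus field_simps)
qed

text \<open>Splits \<open>v\<close> into the small, intermediate and large range; integrated against the stable law with
  \<open>v = u / r\<close> it bounds the mass of the shell \<open>{e r..A r}\<close> from below.\<close>

lemma one_minus_exp_le_shell:
  fixes v e A :: real
  assumes v: "v > 0" and e: "e > 0" and A: "A > 0"
  defines "gap \<equiv> 1 - exp (- 1)"
  shows "1 - exp (- v) \<le> e / gap * (1 - exp (- (v / e))) + indicator {e..A} v + 1 / gap * (1 - exp (- (v / A)))"
proof -
  have gap: "gap > 0" by (simp add: gap_def)
  have small_nonneg: "0 \<le> e / gap * (1 - exp (- (v / e)))" and large_nonneg: "0 \<le> 1 / gap * (1 - exp (- (v / A)))"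
    using v e A gap by simp_all
  have at_most_1: "1 - exp (- v) \<le> 1" by simp
  consider (small) "v < e" | (intermediate) "v \<in> {e..A}" | (large) "v > A" by fastforce
  then show ?thesis
  proof cases
    case small
    have "gap * (v / e) \<le> 1 - exp (- (v / e))" unfolding gap_def
      by (rule one_minus_exp_ge_linear) (use v e small in auto)
    then have "v \<le> e / gap * (1 - exp (- (v / e)))" using e gap by (simp add: field_simps)
    then show ?thesis using one_minus_exp_le[of v] large_nonneg by (simp add: indicator_def)
  next
    case intermediate
    then have "(indicator {e..A} v :: real) = 1" by simp
    then show ?thesis using at_most_1 small_nonneg large_nonneg by linarith
  next
    case large
    have "exp (- (v / A)) \<le> exp (- 1)" using large A by (simp add: field_simps)
    then have "1 \<le> 1 / gap * (1 - exp (- (v / A)))" using gap by (simp add: gap_def field_simps)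
    moreover have "(indicator {e..A} v :: real) = 0" using large by simp
    ultimately show ?thesis using at_most_1 small_nonneg by linarith
  qed
qed

lemma powr_mult_exp_inverse_le:
  fixes v m :: real
  assumes v: "v > 0" and m: "m > 0"
  shows "v powr (- m) * exp (- 1 / (4 * v)) \<le> max 1 ((4 * (m + 1)) powr (m + 1)) / (1 - exp (- 1)) * (1 - exp (- v))"
proof -
  define gap :: real where "gap = 1 - exp (- 1)"
  define B where "B = max 1 ((4 * (m + 1)) powr (m + 1))"
  have gap: "gap > 0" and B: "B \<ge> 1" by (simp_all add: gap_def B_def)
  have "v powr (- m) * exp (- 1 / (4 * v)) \<le> B / gap * (1 - exp (- v))"
  proof (cases "v \<le> 1")
    case True
    let ?c = "(4 * (m + 1)) powr (m + 1) * v powr (m + 1)"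
    have c_pos: "?c > 0" using v m by simp
    have "1 / (4 * v) / (m + 1) = 1 / ((4 * (m + 1)) * v)" by simp
    then have "1 / ?c = (1 / (4 * v) / (m + 1)) powr (m + 1)"
      using v m by (simp only: powr_divide powr_mult powr_one_eq_one)
    also have "\<dots> \<le> exp (1 / (4 * v))" using v m by (intro exp_ge_powr) auto
    finally have "1 \<le> exp (1 / (4 * v)) * ?c" using c_pos by (simp only: pos_divide_le_eq)
    then have "exp (- 1 / (4 * v)) \<le> ?c" by (simp add: exp_minus inverse_eq_divide pos_divide_le_eq mult.commute)
    then have "v powr (- m) * exp (- 1 / (4 * v)) \<le> v powr (- m) * ?c" by (intro mult_left_mono) auto
    also have "\<dots> = (4 * (m + 1)) powr (m + 1) * v" using v by (simp add: powr_minus powr_add)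
    also have "\<dots> \<le> B / gap * (gap * v)" using v gap by (simp add: B_def)
    also have "\<dots> \<le> B / gap * (1 - exp (- v))"
      using one_minus_exp_ge_linear[of v] v True B gap by (intro mult_left_mono) (auto simp: gap_def)
    finally show ?thesis .
  next
    case False
    have "v powr (- m) \<le> v powr 0" using False m by (intro powr_mono) auto
    then have "v powr (- m) * exp (- 1 / (4 * v)) \<le> 1 * 1" using False by (intro mult_mono) auto
    also have "\<dots> \<le> B / gap * gap" using B gap by simp
    also have "\<dots> \<le> B / gap * (1 - exp (- v))" using False B gap by (intro mult_left_mono) (auto simp: gap_def)
    finally show ?thesis .
  qed
  then show ?thesis by (simp add: gap_def B_def)
qed

locale subordinator = real_distribution N for N :: "real measure" +
  fixes \<alpha> :: real
  assumes alpha: "0 < \<alpha>" "\<alpha> < 2"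
    and N_pos: "AE u in N. 0 < u"
    and laplace: "\<And>l. l > 0 \<Longrightarrow> (LINT u|N. exp (- (l * u))) = exp (- (l powr (\<alpha> / 2)))"
begin

abbreviation a :: real where "a \<equiv> \<alpha> / 2"

lemma integrable_exp: "l > 0 \<Longrightarrow> integrable N (\<lambda>u. exp (- (l * u)))"
  by (rule integrable_const_bound[where B=1]) (use N_pos in \<open>auto elim!: eventually_mono\<close>)

lemma integral_one_minus_exp: "l > 0 \<Longrightarrow> (LINT u|N. 1 - exp (- (l * u))) = 1 - exp (- (l powr a))"
  using integrable_exp prob_space by (subst Bochner_Integration.integral_diff) (auto simp: laplace)

lemma integral_one_minus_exp_le: "l > 0 \<Longrightarrow> (LINT u|N. 1 - exp (- (l * u))) \<le> l powr a"
  using one_minus_exp_le[of "l powr a"] by (simp add: integral_one_minus_exp)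

lemma nn_integral_powr_mult_exp:
  assumes "l > 0"
  shows "(\<integral>\<^sup>+u. ennreal (l powr (s - 1) * exp (- (u * l))) \<partial>N) = ennreal (l powr (s - 1) * exp (- (l powr a)))"
  using assms integrable_exp[of l] laplace[of l] by (subst nn_integral_eq_integral) (auto simp: mult.commute)

lemma nn_integral_powr_mult_exp_finite:
  assumes s: "s > 0"
  shows "(\<integral>\<^sup>+l. (\<integral>\<^sup>+u. ennreal (l powr (s - 1) * exp (- (u * l))) * indicator {0..} l \<partial>N) \<partial>lborel) < \<infinity>"
proof -
  define q where "q = (s + 1) / a"
  have "(\<integral>\<^sup>+l. (\<integral>\<^sup>+u. ennreal (l powr (s - 1) * exp (- (u * l))) * indicator {0..} l \<partial>N) \<partial>lborel)
     \<le> (\<integral>\<^sup>+l. ennreal (l powr (s - 1)) * indicator {0..1} l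
          + ennreal (q powr q) * (ennreal (l powr (- 1 - 1)) * indicator {1..} l) \<partial>lborel)"
  proof (rule nn_integral_mono)
    fix l :: real
    consider (nonpos) "l \<le> 0" | (near) "0 < l" "l \<le> 1" | (far) "l > 1" by linarith
    then show "(\<integral>\<^sup>+u. ennreal (l powr (s - 1) * exp (- (u * l))) * indicator {0..} l \<partial>N)
      \<le> ennreal (l powr (s - 1)) * indicator {0..1} l
          + ennreal (q powr q) * (ennreal (l powr (- 1 - 1)) * indicator {1..} l)"
    proof cases
      case nonpos
      then show ?thesis by (cases "l = 0") auto
    next
      case near
      then show ?thesis
        using nn_integral_powr_mult_exp[of l s] by (auto intro!: add_increasing2 ennreal_leI mult_left_le)
    next
      case far
      then show ?thesis
        using nn_integral_powr_mult_exp[of l s] powr_mult_exp_powr_le[of l s a] s alpha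
        by (auto intro!: ennreal_leI simp: q_def simp flip: ennreal_mult)
    qed
  qed
  also have "\<dots> < \<infinity>"
    using s nn_integral_powr_Icc_0[of s 1] nn_integral_powr_atLeast[of 1 1]
    by (subst nn_integral_add) (auto simp: nn_integral_cmult ennreal_mult_less_top)
  finally show ?thesis .
qed

lemma integrable_neg_moment:
  assumes s: "s > 0"
  shows "integrable N (\<lambda>u. u powr (- s))"
proof (rule integrableI_nonneg)
  interpret pair_sigma_finite N "lborel :: real measure" ..
  have "ennreal (Gamma s) * (\<integral>\<^sup>+u. ennreal (u powr (- s)) \<partial>N) = (\<integral>\<^sup>+u. ennreal (Gamma s * u powr (- s)) \<partial>N)"
    using s by (subst nn_integral_cmult[symmetric]) (auto simp: ennreal_mult)
  also have "\<dots> = (\<integral>\<^sup>+u. (\<integral>\<^sup>+l\<in>{0..}. ennreal (l powr (s - 1) * exp (- (u * l))) \<partial>lborel) \<partial>N)"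
    by (rule nn_integral_cong_AE) (use N_pos in \<open>eventually_elim, simp add: nn_integral_Gamma_scaled[OF s]\<close>)
  also have "\<dots> = (\<integral>\<^sup>+l. (\<integral>\<^sup>+u. ennreal (l powr (s - 1) * exp (- (u * l))) * indicator {0..} l \<partial>N) \<partial>lborel)"
    by (rule Fubini'[symmetric]) measurable
  also have "\<dots> < \<infinity>" by (rule nn_integral_powr_mult_exp_finite[OF s])
  finally show "(\<integral>\<^sup>+u. ennreal (u powr (- s)) \<partial>N) < \<infinity>"
    using Gamma_real_pos[OF s] by (auto simp: less_top[symmetric] ennreal_mult_top)
qed auto

lemma integrable_one_minus_exp: "l > 0 \<Longrightarrow> integrable N (\<lambda>u. 1 - exp (- (l * u)))"
  using integrable_exp by simp

lemma measure_shell_lower: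
  assumes r: "r \<ge> 1" and e: "e > 0" and A: "A > 0"
  defines "gap \<equiv> 1 - exp (- 1)"
  shows "r powr (- a) * (gap - (e powr (1 - a) + A powr (- a)) / gap) \<le> measure N {e * r..A * r}"
proof -
  have gap: "gap > 0" by (simp add: gap_def)
  let ?small = "LINT u|N. 1 - exp (- (1 / (e * r) * u))" and ?large = "LINT u|N. 1 - exp (- (1 / (A * r) * u))"
  have integrable_shell: "integrable N (indicator {e * r..A * r} :: real \<Rightarrow> real)"
    by (rule integrable_const_bound[where B=1]) (auto simp: indicator_def)
  have "gap * (1 / r) powr a \<le> 1 - exp (- ((1 / r) powr a))" unfolding gap_def
    by (rule one_minus_exp_ge_linear) (use r alpha in \<open>auto intro!: powr_le1\<close>)
  also have "\<dots> = (LINT u|N. 1 - exp (- (1 / r * u)))" using integral_one_minus_exp[of "1 / r"] r by simp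
  also have "\<dots> \<le> (LINT u|N. e / gap * (1 - exp (- (1 / (e * r) * u))) + indicator {e * r..A * r} u
      + 1 / gap * (1 - exp (- (1 / (A * r) * u))))"
  proof (rule integral_mono_AE)
    show "AE u in N. 1 - exp (- (1 / r * u)) \<le> e / gap * (1 - exp (- (1 / (e * r) * u)))
        + indicator {e * r..A * r} u + 1 / gap * (1 - exp (- (1 / (A * r) * u)))"
      using N_pos
    proof eventually_elim
      case (elim u)
      have "indicator {e..A} (u / r) = (indicator {e * r..A * r} u :: real)"
        using r by (auto simp: indicator_def field_simps)
      then show ?case
        using one_minus_exp_le_shell[of "u / r" e A] elim r e A by (simp add: gap_def mult.commute)
    qed
  qed (use integrable_one_minus_exp[of "1 / r"] integrable_one_minus_exp[of "1 / (e * r)"]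
      integrable_one_minus_exp[of "1 / (A * r)"] integrable_shell r e A in auto)
  also have "\<dots> = e / gap * ?small + measure N {e * r..A * r} + 1 / gap * ?large"
    using integrable_one_minus_exp[of "1 / (e * r)"] integrable_one_minus_exp[of "1 / (A * r)"] integrable_shell r e A
    by (subst Bochner_Integration.integral_add) (auto simp del: Bochner_Integration.integral_diff)
  also have "\<dots> \<le> e / gap * (1 / (e * r)) powr a + measure N {e * r..A * r} + 1 / gap * (1 / (A * r)) powr a"
    using integral_one_minus_exp_le[of "1 / (e * r)"] integral_one_minus_exp_le[of "1 / (A * r)"] r e A gap
    by (intro add_mono mult_left_mono) auto
  also have "e / gap * (1 / (e * r)) powr a = r powr (- a) * (e powr (1 - a) / gap)"
    using e r by (simp add: powr_divide powr_diff powr_mult powr_minus_divide)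
  also have "1 / gap * (1 / (A * r)) powr a = r powr (- a) * (A powr (- a) / gap)"
    using A r by (simp add: powr_divide powr_minus powr_mult divide_simps)
  also have "(1 / r) powr a = r powr (- a)" using r by (simp add: powr_divide powr_minus_divide)
  finally show ?thesis by (simp add: algebra_simps add_divide_distrib)
qed

lemma measure_shell_ge:
  obtains e A c where "e > 0" "A > 0" "c > 0" "\<And>r. r \<ge> 1 \<Longrightarrow> c * r powr (- a) \<le> measure N {e * r..A * r}"
proof -
  define gap :: real where "gap = 1 - exp (- 1)"
  have gap: "gap > 0" by (simp add: gap_def)
  define e where "e = (gap\<^sup>2 / 4) powr (1 / (1 - a))"
  define A where "A = (gap\<^sup>2 / 4) powr (- 1 / a)"
  have e: "e > 0" and A: "A > 0" using gap by (auto simp: e_def A_def)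
  have e_powr: "e powr (1 - a) = gap\<^sup>2 / 4" using alpha gap by (simp add: e_def powr_powr)
  have A_powr: "A powr (- a) = gap\<^sup>2 / 4" using alpha gap by (simp add: A_def powr_powr)
  have "gap - (e powr (1 - a) + A powr (- a)) / gap = gap / 2"
    unfolding e_powr A_powr using gap by (simp add: power2_eq_square)
  then have "gap / 2 * r powr (- a) \<le> measure N {e * r..A * r}" if "r \<ge> 1" for r
    using measure_shell_lower[OF that e A] by (simp only: mult.commute flip: gap_def)
  with that[OF e A, of "gap / 2"] gap show ?thesis by simp
qed

definition density :: "real \<Rightarrow> 'b::euclidean_space \<Rightarrow> real" where
  "density t x = (LINT u|N. gauss (t powr (2 / \<alpha>) * u) x)"

lemma gauss_le: "u > 0 \<Longrightarrow> gauss u (x::'b::euclidean_space)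
    \<le> (4 * pi) powr (- real DIM('b) / 2) * u powr (- (real DIM('b) / 2))"
  by (simp add: gauss_def powr_mult)

lemma integrable_gauss_bound:
  "integrable N (\<lambda>u. (4 * pi) powr (- real DIM('b::euclidean_space) / 2) * u powr (- (real DIM('b) / 2)))"
  by (intro integrable_mult_right integrable_neg_moment) simp

lemma integrable_gauss_N: "integrable N (\<lambda>u. gauss u (x::'b::euclidean_space))"
proof (rule Bochner_Integration.integrable_bound[OF integrable_gauss_bound[where 'b='b]])
  show "AE u in N. norm (gauss u x) \<le> norm ((4 * pi) powr (- real DIM('b) / 2) * u powr (- (real DIM('b) / 2)))"
    using N_pos by eventually_elim (use gauss_le[where 'b='b] in auto)
qed measurable

lemma density_nonneg: "0 \<le> density t x"
  unfolding density_def by (rule integral_nonneg_AE) simp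

lemma measurable_density: "(\<lambda>(t, x). density t x) \<in> borel_measurable (borel \<Otimes>\<^sub>M borel)"
  unfolding density_def by measurable

lemma density_1: "density 1 x = (LINT u|N. gauss u x)"
  by (simp add: density_def)

lemma density_scale:
  fixes x :: "'b::euclidean_space"
  assumes t: "t > 0"
  shows "density t x = t powr (- real DIM('b) / \<alpha>) * density 1 ((1 / t powr (1 / \<alpha>)) *\<^sub>R x)"
proof -
  let ?c = "t powr (1 / \<alpha>)"
  have c_pos: "?c > 0" using t by simp
  have "AE u in N. gauss (t powr (2 / \<alpha>) * u) x = t powr (- real DIM('b) / \<alpha>) * gauss u ((1 / ?c) *\<^sub>R x)"
    using N_pos
  proof eventually_elim
    case (elim u)
    have "t powr (2 / \<alpha>) = ?c\<^sup>2" using t by (simp add: powr_powr flip: powr_numeral)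
    moreover have "?c ^ DIM('b) = t powr (real DIM('b) / \<alpha>)" using t by (simp add: powr_powr flip: powr_realpow)
    ultimately show ?case using gauss_scale[OF c_pos elim, of "(1 / ?c) *\<^sub>R x"] c_pos by (simp add: powr_minus_divide)
  qed
  then have "density t x = (LINT u|N. t powr (- real DIM('b) / \<alpha>) * gauss u ((1 / ?c) *\<^sub>R x))"
    unfolding density_def by (intro integral_cong_AE) auto
  then show ?thesis by (simp add: density_1)
qed

lemma density_1_le_const:
  "density 1 (x::'b::euclidean_space) \<le> (LINT u|N. (4 * pi) powr (- real DIM('b) / 2) * u powr (- (real DIM('b) / 2)))"
  unfolding density_1
  by (rule integral_mono_AE[OF integrable_gauss_N integrable_gauss_bound])
     (use N_pos gauss_le[where 'b='b] in \<open>auto elim!: eventually_mono\<close>)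

lemma density_1_le_far:
  fixes x :: "'b::euclidean_space"
  assumes x: "x \<noteq> 0"
  defines "m \<equiv> real DIM('b) / 2"
  defines "D \<equiv> (4 * pi) powr (- m) * (max 1 ((4 * (m + 1)) powr (m + 1)) / (1 - exp (- 1)))"
  shows "density 1 x \<le> D / norm x powr (real DIM('b) + \<alpha>)"
proof -
  let ?r = "(norm x)\<^sup>2"
  have r: "?r > 0" using x by simp
  have m: "m > 0" by (simp add: m_def)
  have D: "D \<ge> 0" unfolding D_def by (intro mult_nonneg_nonneg divide_nonneg_nonneg) auto
  have "density 1 x \<le> (LINT u|N. (D * ?r powr (- m)) * (1 - exp (- (1 / ?r * u))))" unfolding density_1
  proof (rule integral_mono_AE[OF integrable_gauss_N])
    show "AE u in N. gauss u x \<le> (D * ?r powr (- m)) * (1 - exp (- (1 / ?r * u)))"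
      using N_pos
    proof eventually_elim
      case (elim u)
      have "gauss u x = (4 * pi) powr (- m) * ?r powr (- m) * ((u / ?r) powr (- m) * exp (- 1 / (4 * (u / ?r))))"
        using elim x r by (simp add: gauss_def m_def powr_mult powr_divide)
      also have "\<dots> \<le> (4 * pi) powr (- m) * ?r powr (- m) *
          (max 1 ((4 * (m + 1)) powr (m + 1)) / (1 - exp (- 1)) * (1 - exp (- (u / ?r))))"
        using elim r m by (intro mult_left_mono powr_mult_exp_inverse_le) auto
      finally show ?case by (simp add: D_def mult_ac)
    qed
  qed (use integrable_exp[of "1 / ?r"] r in auto)
  also have "\<dots> \<le> (D * ?r powr (- m)) * (1 / ?r) powr a"
    using integral_one_minus_exp_le[of "1 / ?r"] r D by (subst integral_mult_right_zero, intro mult_left_mono) auto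
  also have "?r powr (- m) = norm x powr (- real DIM('b))" using x by (simp add: powr_powr m_def flip: powr_numeral)
  also have "(1 / ?r) powr a = norm x powr (- \<alpha>)"
    using x by (simp add: powr_divide powr_powr powr_minus_divide flip: powr_numeral)
  finally show ?thesis using x by (simp add: powr_add powr_minus_divide)
qed

lemma density_1_upper:
  obtains C where "C > 0" "\<And>x::'b::euclidean_space. density 1 x \<le> C * stable_profile \<alpha> 1 x"
proof -
  obtain C1 where near: "density 1 x \<le> C1" for x :: 'b using density_1_le_const[where 'b='b] by blast
  obtain C2 where far: "density 1 x \<le> C2 / norm x powr (real DIM('b) + \<alpha>)" if "x \<noteq> 0" for x :: 'b
    using density_1_le_far[where 'b='b] by blast
  let ?C = "max 1 (max C1 C2)"
  have "density 1 x \<le> ?C * stable_profile \<alpha> 1 x" for x :: 'b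
  proof (cases "x = 0")
    case True
    then show ?thesis using near[of x] by (simp add: stable_profile_def)
  next
    case False
    have "density 1 x \<le> ?C * 1" using near[of x] by simp
    moreover have "C2 / norm x powr (real DIM('b) + \<alpha>) \<le> ?C * (1 / norm x powr (real DIM('b) + \<alpha>))"
      by (simp add: divide_right_mono)
    ultimately show ?thesis using far[OF False] False by (auto simp: stable_profile_def min_def)
  qed
  then show ?thesis using that[of ?C] by simp
qed

lemma gauss_ge_on_shell:
  fixes x :: "'b::euclidean_space"
  assumes u: "0 < u" "e * (norm x)\<^sup>2 \<le> u" "u \<le> A * (norm x)\<^sup>2" and e: "e > 0"
  shows "(4 * pi * A * (norm x)\<^sup>2) powr (- real DIM('b) / 2) * exp (- 1 / (4 * e)) \<le> gauss u x"
  unfolding gauss_def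
proof (rule mult_mono)
  show "(4 * pi * A * (norm x)\<^sup>2) powr (- real DIM('b) / 2) \<le> (4 * pi * u) powr (- real DIM('b) / 2)"
    using u by (intro powr_mono2') auto
  show "exp (- 1 / (4 * e)) \<le> exp (- (norm x)\<^sup>2 / (4 * u))" using u e by (simp add: field_simps)
qed auto

lemma density_1_ge_far:
  obtains c where "c > 0" "\<And>x::'b::euclidean_space. norm x \<ge> 1 \<Longrightarrow> c / norm x powr (real DIM('b) + \<alpha>) \<le> density 1 x"
proof -
  let ?d = "real DIM('b)"
  obtain e A b where shell: "e > 0" "A > 0" "b > 0" "\<And>r. r \<ge> 1 \<Longrightarrow> b * r powr (- a) \<le> measure N {e * r..A * r}"
    using measure_shell_ge by metis
  define c where "c = (4 * pi * A) powr (- ?d / 2) * exp (- 1 / (4 * e)) * b"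
  have c: "c > 0" using shell by (simp add: c_def)
  have "c / norm x powr (?d + \<alpha>) \<le> density 1 x" if x: "norm x \<ge> 1" for x :: 'b
  proof -
    let ?r = "(norm x)\<^sup>2" and ?g = "(4 * pi * A * (norm x)\<^sup>2) powr (- ?d / 2) * exp (- 1 / (4 * e))"
    have r: "?r \<ge> 1" and norm_pos: "norm x > 0" using x by (simp, linarith)
    have "?r powr (- ?d / 2) = norm x powr (- ?d)" "?r powr (- a) = norm x powr (- \<alpha>)"
      using norm_pos by (simp_all add: powr_powr flip: powr_numeral)
    then have "c / norm x powr (?d + \<alpha>) = ?g * (b * ?r powr (- a))"
      using shell(2) norm_pos by (simp add: c_def powr_mult[of "4 * pi * A" ?r] powr_add powr_minus_divide)
    also have "\<dots> \<le> ?g * measure N {e * ?r..A * ?r}" using shell(4)[OF r] by (intro mult_left_mono) auto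
    also have "\<dots> = (LINT u|N. ?g * indicator {e * ?r..A * ?r} u)" by simp
    also have "\<dots> \<le> density 1 x" unfolding density_1
    proof (rule integral_mono_AE[OF _ integrable_gauss_N])
      show "integrable N (\<lambda>u. ?g * indicator {e * ?r..A * ?r} u)"
        by (intro integrable_mult_right integrable_const_bound[where B=1]) (auto simp: indicator_def)
      show "AE u in N. ?g * indicator {e * ?r..A * ?r} u \<le> gauss u x"
        using N_pos
      proof eventually_elim
        case (elim u)
        then have "?g \<le> gauss u x" if "u \<in> {e * ?r..A * ?r}"
          using that shell(1) by (intro gauss_ge_on_shell) auto
        then show ?case by (simp add: indicator_def)
      qed
    qed
    finally show ?thesis .
  qed
  with that[OF c] show ?thesis by blast
qed

lemma density_1_antimono:
  fixes x y :: "'b::euclidean_space"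
  assumes "norm x \<le> norm y"
  shows "density 1 y \<le> density 1 x"
  unfolding density_1
proof (rule integral_mono_AE[OF integrable_gauss_N integrable_gauss_N])
  show "AE u in N. gauss u y \<le> gauss u x"
    using N_pos
    by eventually_elim (use assms in \<open>auto simp: gauss_def divide_right_mono power_mono intro!: mult_left_mono\<close>)
qed

lemma density_1_lower:
  obtains c where "c > 0" "\<And>x::'b::euclidean_space. c * stable_profile \<alpha> 1 x \<le> density 1 x"
proof -
  obtain c where c: "c > 0" "\<And>x::'b. norm x \<ge> 1 \<Longrightarrow> c / norm x powr (real DIM('b) + \<alpha>) \<le> density 1 x"
    using density_1_ge_far by metis
  have "c * stable_profile \<alpha> 1 x \<le> density 1 x" for x :: 'b
  proof (cases "norm x \<ge> 1")
    case True
    then have "x \<noteq> 0" by auto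
    then have "c * stable_profile \<alpha> 1 x \<le> c * (1 / norm x powr (real DIM('b) + \<alpha>))"
      using c(1) by (intro mult_left_mono) (auto simp: stable_profile_def)
    then show ?thesis using c(2)[OF True] by simp
  next
    case False
    obtain b :: 'b where b: "norm b = 1" using vector_choose_size[of 1] by auto
    have "c * stable_profile \<alpha> 1 x \<le> c * 1" using c(1) by (intro mult_left_mono) (auto simp: stable_profile_def)
    also have "\<dots> \<le> density 1 b" using c(2)[of b] b by simp
    also have "\<dots> \<le> density 1 x" using False b by (intro density_1_antimono) simp
    finally show ?thesis .
  qed
  with that[OF c(1)] show ?thesis by blast
qed

lemma continuous_density_1: "continuous_on UNIV (density 1 :: 'b::euclidean_space \<Rightarrow> real)"
  unfolding continuous_on_sequentially density_1 comp_def
proof safe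
  fix X :: "nat \<Rightarrow> 'b" and x assume X: "X \<longlonglongrightarrow> x"
  show "(\<lambda>n. LINT u|N. gauss u (X n)) \<longlonglongrightarrow> (LINT u|N. gauss u x)"
  proof (rule integral_dominated_convergence[OF _ _ integrable_gauss_bound[where 'b='b]])
    show "AE u in N. norm (gauss u (X n)) \<le> (4 * pi) powr (- real DIM('b) / 2) * u powr (- (real DIM('b) / 2))" for n
      using N_pos by eventually_elim (use gauss_le[where 'b='b] in auto)
    show "AE u in N. (\<lambda>n. gauss u (X n)) \<longlonglongrightarrow> gauss u x"
      using N_pos by eventually_elim (use X in \<open>auto simp: gauss_def intro!: tendsto_intros\<close>)
  qed measurable
qed

lemma continuous_density: "continuous_on ({0<..} \<times> UNIV) (\<lambda>(t, x::'b::euclidean_space). density t x)"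
proof -
  have "continuous_on ({0<..} \<times> UNIV) (\<lambda>(t, x::'b). t powr (- real DIM('b) / \<alpha>)
      * density 1 ((1 / t powr (1 / \<alpha>)) *\<^sub>R x))"
    unfolding case_prod_beta
    by (intro continuous_intros continuous_on_compose2[OF continuous_density_1]) auto
  then show ?thesis
    by (rule continuous_on_eq) (clarsimp, rule density_scale[symmetric, simplified minus_divide_left[symmetric]], simp)
qed

lemma integrable_gauss_cis_N:
  fixes \<xi> :: "'b::euclidean_space"
  assumes c: "c > 0"
  shows "integrable (N \<Otimes>\<^sub>M lborel) (\<lambda>(u, y). complex_of_real (gauss (c * u) y) * cis (\<xi> \<bullet> y))" (is "integrable _ ?F")
proof -
  interpret pair_sigma_finite N "lborel :: 'b measure" ..
  have measurable_F: "?F \<in> borel_measurable (N \<Otimes>\<^sub>M lborel)"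
    unfolding cis_conv_exp by measurable
  show ?thesis
  proof (rule Fubini_integrable[OF measurable_F])
    have "AE u in N. 1 = (LINT y|lborel. cmod (?F (u, y)))"
      using N_pos by eventually_elim (use c in \<open>simp add: norm_mult integral_gauss\<close>)
    then show "integrable N (\<lambda>u. LINT y|lborel. cmod (?F (u, y)))"
      by (rule integrable_cong_AE_imp[rotated 2]) (use measurable_F in measurable)
    show "AE u in N. integrable lborel (\<lambda>y. ?F (u, y))"
      using N_pos by eventually_elim (use c in \<open>simp add: integrable_gauss_cis\<close>)
  qed
qed

lemma char_density:
  fixes \<xi> :: "'b::euclidean_space"
  assumes t: "t > 0"
  shows "(LINT y|lborel. complex_of_real (density t y) * cis (\<xi> \<bullet> y)) = exp (- t * norm \<xi> powr \<alpha>)"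
proof -
  interpret pair_sigma_finite N "lborel :: 'b measure" ..
  let ?c = "t powr (2 / \<alpha>)"
  have c_pos: "?c > 0" using t by simp
  have "(LINT y|lborel. complex_of_real (density t y) * cis (\<xi> \<bullet> y))
      = (LINT y|lborel. LINT u|N. complex_of_real (gauss (?c * u) y) * cis (\<xi> \<bullet> y))"
    by (rule Bochner_Integration.integral_cong[OF refl]) (simp add: density_def)
  also have "\<dots> = (LINT u|N. LINT y|lborel. complex_of_real (gauss (?c * u) y) * cis (\<xi> \<bullet> y))"
    by (rule Fubini_integral[OF integrable_gauss_cis_N[OF c_pos]])
  also have "\<dots> = (LINT u|N. complex_of_real (exp (- (?c * (norm \<xi>)\<^sup>2 * u))))"
  proof (rule integral_cong_AE)
    show "AE u in N. (LINT y|lborel. complex_of_real (gauss (?c * u) y) * cis (\<xi> \<bullet> y))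
        = complex_of_real (exp (- (?c * (norm \<xi>)\<^sup>2 * u)))"
      using N_pos by eventually_elim (use c_pos char_gauss[of "?c * _" \<xi>] in \<open>simp add: mult_ac\<close>)
  qed (use borel_measurable_integrable[OF integrable_gauss_cis_N[OF c_pos]] in measurable)
  also have "\<dots> = of_real (LINT u|N. exp (- (?c * (norm \<xi>)\<^sup>2 * u)))" by simp
  also have "(LINT u|N. exp (- (?c * (norm \<xi>)\<^sup>2 * u))) = exp (- t * norm \<xi> powr \<alpha>)"
  proof (cases "\<xi> = 0")
    case True
    then show ?thesis using prob_space alpha by simp
  next
    case False
    have "(?c * (norm \<xi>)\<^sup>2) powr a = t * norm \<xi> powr \<alpha>"
      using t False alpha by (simp add: powr_mult powr_powr flip: powr_numeral)
    then show ?thesis using laplace[of "?c * (norm \<xi>)\<^sup>2"] t False by simp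
  qed
  finally show ?thesis .
qed

lemma stable_kernel_density:
  assumes "\<alpha> < real DIM('b)"
  shows "\<exists>C0. stable_kernel \<alpha> C0 (density :: real \<Rightarrow> 'b::euclidean_space \<Rightarrow> real)"
proof -
  obtain C where C: "C > 0" "\<And>x::'b. density 1 x \<le> C * stable_profile \<alpha> 1 x" using density_1_upper by metis
  obtain c where c: "c > 0" "\<And>x::'b. c * stable_profile \<alpha> 1 x \<le> density 1 x" using density_1_lower by metis
  define C0 where "C0 = max 1 (max C (1 / c))"
  have C0: "C0 \<ge> 1" "C \<le> C0" "1 / c \<le> C0" by (simp_all add: C0_def)
  then have c_lower: "1 / C0 \<le> c" using c(1) by (simp add: field_simps)
  have bounds: "stable_profile \<alpha> t x / C0 \<le> density t x" "density t x \<le> C0 * stable_profile \<alpha> t x"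
    if t: "t > 0" for t and x :: 'b
  proof -
    let ?y = "(1 / t powr (1 / \<alpha>)) *\<^sub>R x"
    have pos: "stable_profile \<alpha> 1 ?y > 0" by (rule stable_profile_pos) simp
    have "stable_profile \<alpha> 1 ?y / C0 \<le> density 1 ?y" "density 1 ?y \<le> C0 * stable_profile \<alpha> 1 ?y"
      using order_trans[OF mult_right_mono[OF c_lower less_imp_le[OF pos]] c(2)]
        order_trans[OF C(2) mult_right_mono[OF C0(2) less_imp_le[OF pos]]] by simp_all
    then show "stable_profile \<alpha> t x / C0 \<le> density t x" "density t x \<le> C0 * stable_profile \<alpha> t x"
      unfolding stable_profile_scale[OF t alpha(1), of x] density_scale[OF t, of x]
      by (simp_all only: times_divide_eq_right[symmetric] mult.left_commute[of C0] mult_left_mono powr_ge_zero)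
  qed
  have "stable_kernel \<alpha> C0 (density :: real \<Rightarrow> 'b \<Rightarrow> real)"
    by unfold_locales
       (use alpha assms C0(1) bounds continuous_density char_density in
        \<open>auto simp: measurable_density density_nonneg density_def gauss_def\<close>)
  then show ?thesis by blast
qed

end

theorem stable_kernel_exists:
  assumes "0 < \<alpha>" "\<alpha> < 2" "\<alpha> < real DIM('a::euclidean_space)"
  obtains C0 and p :: "real \<Rightarrow> 'a::euclidean_space \<Rightarrow> real" where "stable_kernel \<alpha> C0 p"
proof -
  interpret pareto "\<alpha> / 2" using assms by unfold_locales auto
  obtain N where "real_distribution N" "AE u in N. 0 < u"
    "\<And>l. l > 0 \<Longrightarrow> (LINT u|N. exp (- (l * u))) = exp (- (l powr (\<alpha> / 2)))"
    using one_sided_stable_law_exists by auto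
  then interpret subordinator N \<alpha>
    using assms by (simp add: subordinator_def subordinator_axioms_def)
  show ?thesis using stable_kernel_density[OF assms(3)] that by blast
qed

section \<open>Powers of the norm\<close>

definition sphere_area :: "'a::euclidean_space itself \<Rightarrow> real" where
  "sphere_area _ = real DIM('a) * unit_ball_vol (real DIM('a))"

lemma sphere_area_nonneg [simp]: "0 \<le> sphere_area T"
  by (simp add: sphere_area_def)

lemma distr_norm_lborel:
  "distr (lborel :: 'a::euclidean_space measure) borel norm = density lborel (\<lambda>r.
     ennreal (sphere_area TYPE('a)) * (ennreal (r powr (real DIM('a) - 1)) * indicator {0..} r))"
  (is "?D = ?R")
proof (rule measure_eqI_generator_eq[where \<Omega>=UNIV and E="range atMost" and A="\<lambda>n. {..real n}"])
  have "real DIM('a) > 0" by simp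
  have cball_eq: "norm -` {..r} = cball (0::'a) r" for r by auto
  have emeasure_D: "emeasure ?D {..r} = ennreal (unit_ball_vol (real DIM('a)) * r ^ DIM('a))" if "r \<ge> 0" for r
    using that by (simp add: emeasure_distr cball_eq emeasure_cball)
  show "emeasure ?D X = emeasure ?R X" if X: "X \<in> range atMost" for X
  proof -
    obtain r where r: "X = {..r}" using X by auto
    let ?c = "ennreal (sphere_area TYPE('a))"
    have "emeasure ?R X = (\<integral>\<^sup>+v. ?c * (ennreal (v powr (real DIM('a) - 1)) * indicator {0..r} v) \<partial>lborel)"
      unfolding r by (subst emeasure_density) (auto intro!: nn_integral_cong simp: indicator_def)
    also have "\<dots> = emeasure ?D X"
    proof (cases "r \<ge> 0")
      case True
      then show ?thesis
        unfolding r emeasure_D[OF True]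
        by (subst nn_integral_cmult)
           (auto simp: nn_integral_powr_Icc_0 sphere_area_def powr_realpow' simp flip: ennreal_mult)
    next
      case False
      then show ?thesis unfolding r by (simp add: emeasure_distr cball_eq)
    qed
    finally show ?thesis ..
  qed
  show "emeasure ?D {..real n} \<noteq> \<infinity>" for n by (simp add: emeasure_D)
  show "(\<Union>n. {..real n}) = UNIV" using real_arch_simple by auto
  show "Int_stable (range atMost :: real set set)" by (auto simp: Int_stable_def intro: Int_atMost)
  show "range (\<lambda>n. {..real n}) \<subseteq> range atMost" by auto
qed (simp_all add: borel_eq_atMost)

lemma nn_integral_radial:
  assumes [measurable]: "f \<in> borel_measurable borel"
  shows "(\<integral>\<^sup>+x. f (norm (x::'a::euclidean_space)) \<partial>lborel) = ennreal (sphere_area TYPE('a)) *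
    (\<integral>\<^sup>+r. ennreal (r powr (real DIM('a) - 1)) * indicator {0..} r * f r \<partial>lborel)"
proof -
  have "(\<integral>\<^sup>+x. f (norm (x::'a)) \<partial>lborel) = (\<integral>\<^sup>+r. f r \<partial>distr (lborel :: 'a measure) borel norm)"
    by (subst nn_integral_distr) auto
  then show ?thesis
    unfolding distr_norm_lborel
    by (simp add: nn_integral_density nn_integral_cmult mult.assoc)
qed

lemma nn_integral_norm_powr_cball:
  assumes s: "s < real DIM('a::euclidean_space)" and R: "R \<ge> 0"
  shows "(\<integral>\<^sup>+x\<in>cball (0::'a) R. ennreal (norm x powr (- s)) \<partial>lborel)
    = ennreal (sphere_area TYPE('a) / (real DIM('a) - s) * R powr (real DIM('a) - s))"
proof -
  let ?d = "real DIM('a)"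
  have "(\<integral>\<^sup>+x\<in>cball (0::'a) R. ennreal (norm x powr (- s)) \<partial>lborel)
      = (\<integral>\<^sup>+x. ennreal (norm (x::'a) powr (- s)) * indicator {..R} (norm x) \<partial>lborel)"
    by (rule nn_integral_cong) (simp add: indicator_def)
  also have "\<dots> = ennreal (sphere_area TYPE('a)) *
      (\<integral>\<^sup>+r. ennreal (r powr (?d - 1)) * indicator {0..} r * (ennreal (r powr (- s)) * indicator {..R} r) \<partial>lborel)"
    by (rule nn_integral_radial) measurable
  also have "(\<integral>\<^sup>+r. ennreal (r powr (?d - 1)) * indicator {0..} r * (ennreal (r powr (- s)) * indicator {..R} r) \<partial>lborel)
      = (\<integral>\<^sup>+r\<in>{0..R}. ennreal (r powr ((?d - s) - 1)) \<partial>lborel)"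
    by (rule nn_integral_cong) (auto simp: indicator_def algebra_simps simp flip: ennreal_mult powr_add)
  also have "\<dots> = ennreal (R powr (?d - s) / (?d - s))"
    using s R by (intro nn_integral_powr_Icc_0) auto
  finally show ?thesis using s by (simp flip: ennreal_mult)
qed

lemma nn_integral_norm_powr_outside:
  assumes s: "real DIM('a::euclidean_space) < s" and R: "R > 0"
  shows "(\<integral>\<^sup>+x\<in>{x::'a. R \<le> norm x}. ennreal (norm x powr (- s)) \<partial>lborel)
    = ennreal (sphere_area TYPE('a) / (s - real DIM('a)) * R powr (real DIM('a) - s))"
proof -
  let ?d = "real DIM('a)"
  have "(\<integral>\<^sup>+x\<in>{x::'a. R \<le> norm x}. ennreal (norm x powr (- s)) \<partial>lborel)
      = (\<integral>\<^sup>+x. ennreal (norm (x::'a) powr (- s)) * indicator {R..} (norm x) \<partial>lborel)"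
    by (rule nn_integral_cong) (simp add: indicator_def)
  also have "\<dots> = ennreal (sphere_area TYPE('a)) *
      (\<integral>\<^sup>+r. ennreal (r powr (?d - 1)) * indicator {0..} r * (ennreal (r powr (- s)) * indicator {R..} r) \<partial>lborel)"
    by (rule nn_integral_radial) measurable
  also have "(\<integral>\<^sup>+r. ennreal (r powr (?d - 1)) * indicator {0..} r * (ennreal (r powr (- s)) * indicator {R..} r) \<partial>lborel)
      = (\<integral>\<^sup>+r\<in>{R..}. ennreal (r powr (- (s - ?d) - 1)) \<partial>lborel)"
    using R by (intro nn_integral_cong) (auto simp: indicator_def algebra_simps simp flip: ennreal_mult powr_add)
  also have "\<dots> = ennreal (R powr (- (s - ?d)) / (s - ?d))"
    using s R by (intro nn_integral_powr_atLeast) auto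
  finally show ?thesis using s by (simp flip: ennreal_mult)
qed

lemma integrable_if_norm_powr_le:
  fixes f :: "'a::euclidean_space \<Rightarrow> real"
  assumes near_exponent: "b < real DIM('a)" and far_exponent: "real DIM('a) < c" and A: "A \<ge> 0"
    and [measurable]: "f \<in> borel_measurable borel"
    and near: "\<And>x. x \<noteq> 0 \<Longrightarrow> norm x \<le> 1 \<Longrightarrow> \<bar>f x\<bar> \<le> A * norm x powr (- b)"
    and far: "\<And>x. norm x \<ge> 1 \<Longrightarrow> \<bar>f x\<bar> \<le> A * norm x powr (- c)"
  shows "integrable lborel f"
proof (rule integrableI_bounded)
  let ?near = "\<lambda>x::'a. ennreal (norm x powr (- b)) * indicator (cball 0 1) x"
    and ?far = "\<lambda>x::'a. ennreal (norm x powr (- c)) * indicator {x. 1 \<le> norm x} x"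
  have [measurable]: "cball (0::'a) 1 \<in> sets borel" by (simp add: borel_closed)
  have "AE x in lborel. x \<noteq> (0::'a)" by (rule AE_lborel_singleton)
  then have "AE x in lborel. ennreal (norm (f x)) \<le> ennreal A * ?near x + ennreal A * ?far x"
  proof eventually_elim
    case (elim x)
    show ?case
    proof (cases "norm x \<le> 1")
      case True
      then have "ennreal (norm (f x)) \<le> ennreal A * ?near x"
        using near[OF elim True] A by (simp add: ennreal_leI flip: ennreal_mult)
      then show ?thesis by (rule add_increasing2[rotated]) simp
    next
      case False
      then have "ennreal (norm (f x)) \<le> ennreal A * ?far x"
        using far[of x] A by (simp add: ennreal_leI flip: ennreal_mult)
      then show ?thesis by (rule add_increasing[rotated]) simp
    qed
  qed
  then have "(\<integral>\<^sup>+x. ennreal (norm (f x)) \<partial>lborel) \<le> (\<integral>\<^sup>+x. ennreal A * ?near x + ennreal A * ?far x \<partial>lborel)"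
    by (rule nn_integral_mono_AE)
  also have "\<dots> < \<infinity>"
    using nn_integral_norm_powr_cball[OF near_exponent, of 1] nn_integral_norm_powr_outside[OF far_exponent, of 1]
    by (simp add: nn_integral_add nn_integral_cmult ennreal_mult_less_top)
  finally show "(\<integral>\<^sup>+x. ennreal (norm (f x)) \<partial>lborel) < \<infinity>" .
qed measurable

lemma powr_add_le:
  fixes u v a :: real
  assumes "0 \<le> u" "0 \<le> v" "0 < a" "a \<le> 1"
  shows "(u + v) powr a \<le> u powr a + v powr a"
proof (cases "u + v = 0")
  case False
  then have sum_pos: "u + v > 0" using assms by linarith
  have fraction: "w \<le> w powr a" if "0 \<le> w" "w \<le> 1" for w :: real
    using powr_mono'[of a 1 w] that assms by (cases "w = 0") auto
  have "1 = u / (u + v) + v / (u + v)" using sum_pos by (simp flip: add_divide_distrib)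
  also have "\<dots> \<le> (u / (u + v)) powr a + (v / (u + v)) powr a"
    using assms sum_pos by (intro add_mono fraction) auto
  also have "\<dots> = (u powr a + v powr a) / (u + v) powr a"
    using assms by (simp add: powr_divide add_divide_distrib)
  finally show ?thesis using sum_pos by (simp add: le_divide_eq)
qed (use assms in auto)

lemma powr_midpoint_concave:
  fixes u v a :: real
  assumes "0 \<le> u" "0 \<le> v" "0 < a" "a \<le> 1"
  shows "u powr a + v powr a \<le> 2 * ((u + v) / 2) powr a"
proof (cases "u = 0 \<or> v = 0")
  case True
  have "w powr a \<le> 2 * (w / 2) powr a" if "0 \<le> w" for w :: real
  proof -
    have "w powr a * 2 powr a \<le> w powr a * 2 powr 1" using assms by (intro mult_left_mono powr_mono) auto
    then show ?thesis by (simp add: powr_divide field_simps)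
  qed
  then show ?thesis using True assms by auto
next
  case False
  have "concave_on {0<..} (\<lambda>x. x powr a)"
  proof (rule f''_le0_imp_concave)
    fix x :: real assume "x \<in> {0<..}"
    then show "((\<lambda>x. x powr a) has_real_derivative a * x powr (a - 1)) (at x)"
      "((\<lambda>x. a * x powr (a - 1)) has_real_derivative a * ((a - 1) * x powr (a - 1 - 1))) (at x)"
      "a * ((a - 1) * x powr (a - 1 - 1)) \<le> 0"
      using assms by (auto intro!: derivative_eq_intros simp: mult_le_0_iff)
  qed simp
  from concave_onD[OF this, of "1 / 2" u v] False assms show ?thesis by (simp add: add_divide_distrib)
qed

lemma norm_powr_second_difference_le:
  fixes x z :: "'a::real_inner"
  assumes "0 < \<delta>" "\<delta> \<le> 2"
  shows "norm (x + z) powr \<delta> + norm (x - z) powr \<delta> \<le> 2 * (norm x powr \<delta> + norm z powr \<delta>)"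
proof -
  have square: "((norm y)\<^sup>2) powr (\<delta> / 2) = norm y powr \<delta>" for y :: 'a
    by (cases "y = 0") (simp_all add: powr_powr flip: powr_numeral)
  have "(norm (x + z))\<^sup>2 + (norm (x - z))\<^sup>2 = 2 * ((norm x)\<^sup>2 + (norm z)\<^sup>2)"
    by (simp add: power2_norm_eq_inner inner_add inner_diff inner_commute)
  then have "norm (x + z) powr \<delta> + norm (x - z) powr \<delta> \<le> 2 * ((norm x)\<^sup>2 + (norm z)\<^sup>2) powr (\<delta> / 2)"
    using powr_midpoint_concave[of "(norm (x + z))\<^sup>2" "(norm (x - z))\<^sup>2" "\<delta> / 2"] assms
    by (simp add: square add_divide_distrib)
  also have "((norm x)\<^sup>2 + (norm z)\<^sup>2) powr (\<delta> / 2) \<le> norm x powr \<delta> + norm z powr \<delta>"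
    using powr_add_le[of "(norm x)\<^sup>2" "(norm z)\<^sup>2" "\<delta> / 2"] assms by (simp add: square)
  finally show ?thesis by simp
qed

section \<open>The stable semigroup\<close>

lemma stable_profile_minus_commute: "stable_profile \<alpha> t (x - y) = stable_profile \<alpha> t (y - x)"
  by (simp add: stable_profile_def norm_minus_commute)

lemma stable_profile_le_sup:
  "stable_profile \<alpha> t (x::'a::euclidean_space) \<le> t powr (- real DIM('a) / \<alpha>)"
  by (simp add: stable_profile_def)

lemma stable_profile_le_tail:
  "x \<noteq> 0 \<Longrightarrow> stable_profile \<alpha> t (x::'a::euclidean_space) \<le> t / norm x powr (real DIM('a) + \<alpha>)"
  by (simp add: stable_profile_def)

lemma stable_profile_geI:
  fixes x :: "'a::euclidean_space"
  assumes "c \<le> t powr (- real DIM('a) / \<alpha>)" "x \<noteq> 0 \<Longrightarrow> c \<le> t / norm x powr (real DIM('a) + \<alpha>)"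
  shows "c \<le> stable_profile \<alpha> t x"
  using assms by (simp add: stable_profile_def)

lemma stable_profile_le_interpolated:
  fixes x :: "'a::euclidean_space"
  assumes x: "x \<noteq> 0" and t: "t > 0" and \<alpha>: "\<alpha> > 0" and \<gamma>: "0 \<le> \<gamma>" "\<gamma> \<le> \<alpha>"
  shows "stable_profile \<alpha> t x \<le> t powr (\<gamma> / \<alpha>) * norm x powr (- (real DIM('a) + \<gamma>))"
proof (cases "norm x \<le> t powr (1 / \<alpha>)")
  case True
  have "t powr (- real DIM('a) / \<alpha>) = t powr (\<gamma> / \<alpha>) * (t powr (1 / \<alpha>)) powr (- (real DIM('a) + \<gamma>))"
    by (simp add: powr_powr diff_divide_distrib flip: powr_add)
  also have "\<dots> \<le> t powr (\<gamma> / \<alpha>) * norm x powr (- (real DIM('a) + \<gamma>))"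
    using True x \<gamma> by (intro mult_left_mono powr_mono2') auto
  finally show ?thesis using stable_profile_le_sup[of \<alpha> t x] by simp
next
  case False
  have "t = t powr (\<gamma> / \<alpha>) * (t powr (1 / \<alpha>)) powr (\<alpha> - \<gamma>)"
    using t \<alpha> by (simp add: powr_powr diff_divide_distrib flip: powr_add)
  also have "\<dots> \<le> t powr (\<gamma> / \<alpha>) * norm x powr (\<alpha> - \<gamma>)"
    using False \<gamma> by (intro mult_left_mono powr_mono2) auto
  finally have "t / norm x powr (real DIM('a) + \<alpha>)
      \<le> t powr (\<gamma> / \<alpha>) * norm x powr (\<alpha> - \<gamma>) / norm x powr (real DIM('a) + \<alpha>)"
    by (intro divide_right_mono) auto
  also have "\<dots> = t powr (\<gamma> / \<alpha>) * norm x powr (- (real DIM('a) + \<gamma>))"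
    by (simp only: times_divide_eq_right[symmetric] powr_diff[symmetric]) (simp add: algebra_simps)
  finally show ?thesis using stable_profile_le_tail[OF x, of \<alpha> t] by simp
qed

lemma stable_profile_compare:
  fixes x y :: "'a::euclidean_space"
  assumes \<alpha>: "\<alpha> > 0" and times: "s > 0" "t > 0" "m \<ge> 1" "s \<le> m * t" "t \<le> m * s"
    and points: "k \<ge> 1" "norm y \<le> k * norm x"
  shows "stable_profile \<alpha> s x \<le> m powr (1 + real DIM('a) / \<alpha>) * k powr (real DIM('a) + \<alpha>) * stable_profile \<alpha> t y"
proof -
  let ?d = "real DIM('a)"
  let ?K = "m powr (1 + ?d / \<alpha>) * k powr (?d + \<alpha>)"
  have K: "?K > 0" using times points by simp
  have powers_ge_1: "1 \<le> m powr (?d / \<alpha>)" "1 \<le> k powr (?d + \<alpha>)"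
    using \<alpha> times points by (auto intro!: ge_one_powr_ge_zero)
  have K_eq: "?K = m * m powr (?d / \<alpha>) * k powr (?d + \<alpha>)" using times by (simp add: powr_add)
  have "stable_profile \<alpha> s x / ?K \<le> stable_profile \<alpha> t y"
  proof (rule stable_profile_geI)
    have "stable_profile \<alpha> s x \<le> s powr (- ?d / \<alpha>)" by (rule stable_profile_le_sup)
    also have "\<dots> \<le> (t / m) powr (- ?d / \<alpha>)"
      using \<alpha> times by (intro powr_mono2') (auto simp: field_simps)
    also have "\<dots> = m powr (?d / \<alpha>) * t powr (- ?d / \<alpha>)"
      using times by (simp add: powr_divide powr_minus field_simps)
    also have "\<dots> \<le> ?K * t powr (- ?d / \<alpha>)"
      using times powers_ge_1 mult_mono[of "1 * m powr (?d / \<alpha>)" "m * m powr (?d / \<alpha>)" 1 "k powr (?d + \<alpha>)"]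
      by (intro mult_right_mono) (auto simp: K_eq)
    finally show "stable_profile \<alpha> s x / ?K \<le> t powr (- ?d / \<alpha>)" using K by (simp add: divide_le_eq mult.commute)
  next
    assume y: "y \<noteq> 0"
    then have x: "x \<noteq> 0" using points by auto
    have "stable_profile \<alpha> s x \<le> s / norm x powr (?d + \<alpha>)" by (rule stable_profile_le_tail[OF x])
    also have "\<dots> \<le> (m * t) / (norm y / k) powr (?d + \<alpha>)"
      using \<alpha> times points y by (intro frac_le powr_mono2) (auto simp: field_simps)
    also have "\<dots> = (m * k powr (?d + \<alpha>)) * (t / norm y powr (?d + \<alpha>))"
      using points by (simp add: powr_divide)
    also have "\<dots> \<le> ?K * (t / norm y powr (?d + \<alpha>))"
      unfolding K_eq using times powers_ge_1 by (intro mult_right_mono) auto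
    finally show "stable_profile \<alpha> s x / ?K \<le> t / norm y powr (?d + \<alpha>)"
      using K by (simp add: divide_le_eq mult.commute)
  qed
  then show ?thesis using K by (simp add: divide_le_eq mult.commute)
qed

lemma stable_profile_le_tail_mono:
  fixes z :: "'a::euclidean_space"
  assumes "\<alpha> > 0" "0 < s" "s \<le> t" "0 < r" "r \<le> norm z"
  shows "stable_profile \<alpha> s z \<le> t / r powr (real DIM('a) + \<alpha>)"
proof -
  have "stable_profile \<alpha> s z \<le> s / norm z powr (real DIM('a) + \<alpha>)"
    using assms by (intro stable_profile_le_tail) auto
  also have "\<dots> \<le> t / r powr (real DIM('a) + \<alpha>)" using assms by (intro frac_le powr_mono2) auto
  finally show ?thesis .
qed

lemma min_stable_profile_le:
  fixes x y :: "'a::euclidean_space"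
  assumes \<alpha>: "\<alpha> > 0" and s: "s > 0" and t: "t > 0"
  defines "K \<equiv> 2 powr (real DIM('a) / \<alpha> + real DIM('a) + \<alpha>)"
  shows "min (stable_profile \<alpha> s x) (stable_profile \<alpha> t y) \<le> K * stable_profile \<alpha> (s + t) (x + y)"
proof -
  let ?d = "real DIM('a)"
  let ?m = "min (stable_profile \<alpha> s x) (stable_profile \<alpha> t y)"
  have K: "K > 0" "2 powr (?d / \<alpha>) \<le> K" "2 powr (?d + \<alpha>) \<le> K"
    using \<alpha> by (auto simp: K_def intro!: powr_mono)
  have "?m / K \<le> stable_profile \<alpha> (s + t) (x + y)"
  proof (rule stable_profile_geI)
    have "?m \<le> max s t powr (- ?d / \<alpha>)"
      using stable_profile_le_sup[of \<alpha> s x] stable_profile_le_sup[of \<alpha> t y] by (auto simp: max_def min_def)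
    also have "\<dots> \<le> ((s + t) / 2) powr (- ?d / \<alpha>)" using \<alpha> s t by (intro powr_mono2') (auto simp: max_def)
    also have "\<dots> = 2 powr (?d / \<alpha>) * (s + t) powr (- ?d / \<alpha>)"
      using s t by (simp add: powr_divide powr_minus field_simps)
    also have "\<dots> \<le> K * (s + t) powr (- ?d / \<alpha>)" using K by (intro mult_right_mono) auto
    finally show "?m / K \<le> (s + t) powr (- ?d / \<alpha>)" using K by (simp add: divide_le_eq mult.commute)
  next
    assume xy: "x + y \<noteq> 0"
    have "norm (x + y) / 2 \<le> norm x \<or> norm (x + y) / 2 \<le> norm y"
      using norm_triangle_ineq[of x y] by linarith
    then have "?m \<le> (s + t) / (norm (x + y) / 2) powr (?d + \<alpha>)"
      using \<alpha> s t xy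
      by (auto simp: min_le_iff_disj intro: stable_profile_le_tail_mono)
    also have "\<dots> = 2 powr (?d + \<alpha>) * ((s + t) / norm (x + y) powr (?d + \<alpha>))" by (simp add: powr_divide)
    also have "\<dots> \<le> K * ((s + t) / norm (x + y) powr (?d + \<alpha>))" using K s t by (intro mult_right_mono) auto
    finally show "?m / K \<le> (s + t) / norm (x + y) powr (?d + \<alpha>)" using K by (simp add: divide_le_eq mult.commute)
  qed
  then show ?thesis using K by (simp add: divide_le_eq mult.commute)
qed

lemma stable_profile_3P:
  fixes x y :: "'a::euclidean_space"
  assumes "\<alpha> > 0" "s > 0" "t > 0"
  shows "stable_profile \<alpha> s x * stable_profile \<alpha> t y \<le> 2 powr (real DIM('a) / \<alpha> + real DIM('a) + \<alpha>) *
    stable_profile \<alpha> (s + t) (x + y) * (stable_profile \<alpha> s x + stable_profile \<alpha> t y)"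
proof -
  have pos: "stable_profile \<alpha> s x > 0" "stable_profile \<alpha> t y > 0" using assms by (auto simp: stable_profile_pos)
  then have "stable_profile \<alpha> s x * stable_profile \<alpha> t y
      \<le> min (stable_profile \<alpha> s x) (stable_profile \<alpha> t y) * (stable_profile \<alpha> s x + stable_profile \<alpha> t y)"
    by (auto simp: min_def algebra_simps)
  also have "\<dots> \<le> 2 powr (real DIM('a) / \<alpha> + real DIM('a) + \<alpha>) * stable_profile \<alpha> (s + t) (x + y) *
      (stable_profile \<alpha> s x + stable_profile \<alpha> t y)"
    using min_stable_profile_le[OF assms, of x y] pos by (intro mult_right_mono) auto
  finally show ?thesis .
qed

context stable_kernel
begin

abbreviation profile :: "real \<Rightarrow> 'a \<Rightarrow> real" where "profile \<equiv> stable_profile \<alpha>"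

lemma dim_ge_1: "1 \<le> real DIM('a)"
  using DIM_positive[where 'a='a] by linarith

lemma profile_nonneg: "t > 0 \<Longrightarrow> 0 \<le> profile t x"
  by (simp add: stable_profile_pos less_imp_le)

lemma profile_le_p: "t > 0 \<Longrightarrow> profile t x \<le> C0 * p t x"
  using p_lower[of t x] C0 by (simp add: divide_le_eq mult.commute)

lemma p_commute: "p t (x - y) = p t (y - x)"
  by (metis minus_diff_eq p_minus)

lemma p_le_interpolated:
  assumes "t > 0" "x \<noteq> 0" "0 \<le> \<gamma>" "\<gamma> \<le> \<alpha>"
  shows "p t x \<le> C0 * (t powr (\<gamma> / \<alpha>) * norm x powr (- (real DIM('a) + \<gamma>)))"
  by (rule order_trans[OF p_upper mult_left_mono[OF stable_profile_le_interpolated]]) (use assms alpha C0 in auto)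

lemma integrable_p: "t > 0 \<Longrightarrow> integrable lborel (p t)"
proof (rule ccontr)
  assume t: "t > 0" and "\<not> integrable lborel (p t)"
  then have "\<not> integrable lborel (\<lambda>y. complex_of_real (p t y))" by (simp add: complex_of_real_integrable_eq)
  then have "(LINT y|lborel. complex_of_real (p t y)) = 0" by (rule not_integrable_integral_eq)
  then show False using char_p[OF t, of 0] alpha by simp
qed

lemma integral_p: "t > 0 \<Longrightarrow> (LINT y|lborel. p t y) = 1"
  using char_p[of t 0] alpha by simp

lemma integrable_p_translate: "t > 0 \<Longrightarrow> integrable lborel (\<lambda>z. p t (z - x))"
  using integrable_lborel_translate_iff[of "p t" "- x"] integrable_p[of t] by simp

lemma integral_p_translate: "t > 0 \<Longrightarrow> (LINT z|lborel. p t (z - x)) = 1"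
  using integral_lborel_translate[of "p t" "- x"] integral_p[of t] by simp

lemma nn_integral_p: "t > 0 \<Longrightarrow> (\<integral>\<^sup>+z. ennreal (p t z) \<partial>lborel) = 1"
  using integrable_p integral_p by (subst nn_integral_eq_integral) auto

definition heat :: "real \<Rightarrow> ('a \<Rightarrow> ennreal) \<Rightarrow> 'a \<Rightarrow> ennreal" where
  "heat t f x = (\<integral>\<^sup>+z. ennreal (p t (z - x)) * f z \<partial>lborel)"

lemma measurable_heat [measurable]:
  assumes [measurable]: "f \<in> borel_measurable borel"
  shows "(\<lambda>(t, x). heat t f x) \<in> borel_measurable (borel \<Otimes>\<^sub>M borel)"
  unfolding heat_def by measurable

lemma heat_shift:
  assumes [measurable]: "f \<in> borel_measurable borel"
  shows "heat t f x = (\<integral>\<^sup>+z. ennreal (p t z) * f (x + z) \<partial>lborel)"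
  unfolding heat_def using nn_integral_lborel_translate[of "\<lambda>z. ennreal (p t (z - x)) * f z" x] by simp

lemma heat_mono: "(\<And>z. f z \<le> g z) \<Longrightarrow> heat t f x \<le> heat t g x"
  unfolding heat_def by (intro nn_integral_mono mult_left_mono) auto

lemma heat_cong_AE: "AE z in lborel. f z = g z \<Longrightarrow> heat t f x = heat t g x"
  unfolding heat_def by (intro nn_integral_cong_AE) (auto elim!: eventually_mono)

lemma heat_cmult: "f \<in> borel_measurable borel \<Longrightarrow> heat t (\<lambda>z. c * f z) x = c * heat t f x"
  unfolding heat_def by (simp add: mult.left_commute nn_integral_cmult)

lemma heat_add:
  "f \<in> borel_measurable borel \<Longrightarrow> g \<in> borel_measurable borel \<Longrightarrow> heat t (\<lambda>z. f z + g z) x = heat t f x + heat t g x"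
  unfolding heat_def by (simp add: distrib_left nn_integral_add)

lemma heat_const: "t > 0 \<Longrightarrow> heat t (\<lambda>z. c) x = c"
  unfolding heat_shift[OF borel_measurable_const] by (simp add: nn_integral_multc nn_integral_p)

lemma heat_nn_integral:
  assumes [measurable]: "(\<lambda>(z, r). F z r) \<in> borel_measurable (borel \<Otimes>\<^sub>M borel)"
  shows "heat t (\<lambda>z. \<integral>\<^sup>+r. F z r \<partial>(lborel :: real measure)) x = (\<integral>\<^sup>+r. heat t (\<lambda>z. F z r) x \<partial>lborel)"
proof -
  have "heat t (\<lambda>z. \<integral>\<^sup>+r. F z r \<partial>(lborel :: real measure)) x = (\<integral>\<^sup>+z. \<integral>\<^sup>+r. ennreal (p t (z - x)) * F z r \<partial>lborel \<partial>lborel)"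
    unfolding heat_def by (simp add: nn_integral_cmult)
  also have "\<dots> = (\<integral>\<^sup>+r. \<integral>\<^sup>+z. ennreal (p t (z - x)) * F z r \<partial>lborel \<partial>lborel)"
    by (rule lborel_pair.Fubini'[symmetric]) measurable
  finally show ?thesis by (simp add: heat_def)
qed

lemma ennreal_integral_p:
  assumes "integrable lborel (\<lambda>z. p t (z - x) * f z)" "\<And>z. 0 \<le> f z"
  shows "ennreal (LINT z|lborel. p t (z - x) * f z) = heat t (\<lambda>z. ennreal (f z)) x"
  unfolding heat_def using assms
  by (subst nn_integral_eq_integral[symmetric]) (auto simp: ennreal_mult intro!: nn_integral_cong)

lemma heat_neg_powr_near_0:
  assumes t: "t > 0" and x: "x \<noteq> 0" and \<beta>: "\<beta> < real DIM('a)" and \<gamma>: "0 \<le> \<gamma>" "\<gamma> \<le> \<alpha>"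
  shows "heat t (\<lambda>z. ennreal (norm z powr (- \<beta>)) * indicator (cball 0 (norm x / 2)) z) x
    \<le> ennreal (C0 * sphere_area TYPE('a) / (real DIM('a) - \<beta>) * 2 powr (\<beta>
        + \<gamma>) * t powr (\<gamma> / \<alpha>) * norm x powr (- (\<beta> + \<gamma>)))"
proof -
  let ?R = "norm x / 2"
  have R: "?R > 0" using x by simp
  have [measurable]: "cball (0::'a) ?R \<in> sets borel" by (simp add: borel_closed)
  let ?bound = "C0 * (t powr (\<gamma> / \<alpha>) * ?R powr (- (real DIM('a) + \<gamma>)))"
  have p_le: "p t (z - x) \<le> ?bound" if "z \<in> cball 0 ?R" for z
  proof -
    have far: "norm (z - x) \<ge> ?R" using that norm_triangle_ineq2[of x z] by (simp add: norm_minus_commute)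
    then have "z - x \<noteq> 0" using R by auto
    then have "p t (z - x) \<le> C0 * (t powr (\<gamma> / \<alpha>) * norm (z - x) powr (- (real DIM('a) + \<gamma>)))"
      by (rule p_le_interpolated[OF t _ \<gamma>])
    also have "\<dots> \<le> ?bound" using far R C0 \<gamma> by (intro mult_left_mono powr_mono2') auto
    finally show ?thesis .
  qed
  have "heat t (\<lambda>z. ennreal (norm z powr (- \<beta>)) * indicator (cball 0 ?R) z) x
      \<le> (\<integral>\<^sup>+z. ennreal ?bound * (ennreal (norm z powr (- \<beta>)) * indicator (cball (0::'a) ?R) z) \<partial>lborel)"
    unfolding heat_def
    by (rule nn_integral_mono) (use p_le in \<open>auto simp: indicator_def intro!: mult_right_mono ennreal_leI\<close>)
  also have "\<dots> = ennreal ?bound * ennreal (sphere_area TYPE('a) / (real DIM('a) - \<beta>) * ?R powr (real DIM('a) - \<beta>))"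
    using nn_integral_norm_powr_cball[OF \<beta>, of ?R] R by (subst nn_integral_cmult) auto
  also have "\<dots> = ennreal (C0 * sphere_area TYPE('a) / (real DIM('a) - \<beta>) * t powr (\<gamma> / \<alpha>) * (?R powr (- (real DIM('a)
      + \<gamma>)) * ?R powr (real DIM('a) - \<beta>)))"
    using C0 \<beta> by (simp add: mult_ac flip: ennreal_mult)
  also have "?R powr (- (real DIM('a) + \<gamma>)) * ?R powr (real DIM('a) - \<beta>) = ?R powr (- (\<beta> + \<gamma>))"
    unfolding powr_add[symmetric] by (rule arg_cong[where f="\<lambda>e. ?R powr e"]) simp
  also have "\<dots> = 2 powr (\<beta> + \<gamma>) * norm x powr (- (\<beta> + \<gamma>))"
    by (simp add: powr_divide powr_minus_divide del: minus_add_distrib)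
  finally show ?thesis by (simp add: mult_ac)
qed

definition neg_moment_const :: "real \<Rightarrow> real" where
  "neg_moment_const \<beta> = 2 powr \<beta> * (1 + C0 * sphere_area TYPE('a) / (real DIM('a) - \<beta>))"

lemma neg_moment_const_pos: "\<beta> < real DIM('a) \<Longrightarrow> neg_moment_const \<beta> > 0"
  using C0 by (simp add: neg_moment_const_def add_pos_nonneg)

lemma heat_neg_powr_le:
  assumes t: "t > 0" and x: "x \<noteq> 0" and \<beta>: "0 \<le> \<beta>" "\<beta> < real DIM('a)"
  shows "heat t (\<lambda>z. ennreal (norm z powr (- \<beta>))) x \<le> ennreal (neg_moment_const \<beta> * norm x powr (- \<beta>))"
proof -
  let ?R = "norm x / 2"
  have R: "?R > 0" using x by simp
  have [measurable]: "cball (0::'a) ?R \<in> sets borel" by (simp add: borel_closed)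
  let ?near = "\<lambda>z. ennreal (norm z powr (- \<beta>)) * indicator (cball 0 ?R) z"
  have "heat t (\<lambda>z. ennreal (norm z powr (- \<beta>))) x \<le> heat t (\<lambda>z. ennreal (?R powr (- \<beta>)) + ?near z) x"
  proof (rule heat_mono)
    fix z :: 'a
    have "norm z powr (- \<beta>) \<le> ?R powr (- \<beta>)" if "?R < norm z" using that R \<beta> by (intro powr_mono2') auto
    then show "ennreal (norm z powr (- \<beta>)) \<le> ennreal (?R powr (- \<beta>)) + ?near z"
      by (cases "norm z \<le> ?R") (auto intro: ennreal_leI add_increasing)
  qed
  also have "\<dots> = ennreal (?R powr (- \<beta>)) + heat t ?near x" by (simp add: heat_add heat_const[OF t])
  also have "\<dots> \<le> ennreal (?R powr (- \<beta>))
      + ennreal (C0 * sphere_area TYPE('a) / (real DIM('a) - \<beta>) * 2 powr \<beta> * norm x powr (- \<beta>))"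
    using heat_neg_powr_near_0[OF t x \<beta>(2), of 0] alpha t by (intro add_left_mono) simp
  also have "\<dots> = ennreal (?R powr (- \<beta>)
      + C0 * sphere_area TYPE('a) / (real DIM('a) - \<beta>) * 2 powr \<beta> * norm x powr (- \<beta>))"
    using C0 \<beta> by (simp flip: ennreal_plus)
  also have "?R powr (- \<beta>) = 2 powr \<beta> * norm x powr (- \<beta>)" by (simp add: powr_divide powr_minus field_simps)
  finally show ?thesis by (simp add: neg_moment_const_def algebra_simps)
qed

definition moment_const :: "real \<Rightarrow> real" where
  "moment_const \<gamma> = 1 + C0 * sphere_area TYPE('a) / (\<alpha> - \<gamma>)"

lemma moment_const_pos: "\<gamma> < \<alpha> \<Longrightarrow> moment_const \<gamma> > 0"
  using C0 by (simp add: moment_const_def add_pos_nonneg)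

lemma nn_integral_p_powr_le:
  assumes t: "t > 0" and \<gamma>: "0 \<le> \<gamma>" "\<gamma> < \<alpha>"
  shows "(\<integral>\<^sup>+z. ennreal (p t z * norm z powr \<gamma>) \<partial>lborel) \<le> ennreal (moment_const \<gamma> * t powr (\<gamma> / \<alpha>))"
proof -
  let ?R = "t powr (1 / \<alpha>)"
  let ?far = "\<lambda>z::'a. ennreal (norm z powr (- (real DIM('a) + \<alpha> - \<gamma>))) * indicator {z. ?R \<le> norm z} z"
  have R: "?R > 0" using t by simp
  have "(\<integral>\<^sup>+z. ennreal (p t z * norm z powr \<gamma>) \<partial>lborel)
      \<le> (\<integral>\<^sup>+z. ennreal (t powr (\<gamma> / \<alpha>)) * ennreal (p t z) + ennreal (C0 * t) * ?far z \<partial>lborel)"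
  proof (rule nn_integral_mono)
    fix z :: 'a
    show "ennreal (p t z * norm z powr \<gamma>) \<le> ennreal (t powr (\<gamma> / \<alpha>)) * ennreal (p t z) + ennreal (C0 * t) * ?far z"
    proof (cases "norm z \<le> ?R")
      case True
      have "norm z powr \<gamma> \<le> ?R powr \<gamma>" using True \<gamma> by (intro powr_mono2) auto
      then have "p t z * norm z powr \<gamma> \<le> t powr (\<gamma> / \<alpha>) * p t z"
        by (simp add: powr_powr mult.commute mult_left_mono)
      then show ?thesis by (intro add_increasing2) (auto intro: ennreal_leI simp flip: ennreal_mult)
    next
      case False
      then have z: "z \<noteq> 0" using R by auto
      have "p t z * norm z powr \<gamma> \<le> C0 * (t powr (\<alpha> / \<alpha>) * norm z powr (- (real DIM('a) + \<alpha>))) * norm z powr \<gamma>"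
        using p_le_interpolated[OF t z, of \<alpha>] alpha by (intro mult_right_mono) auto
      also have "\<dots> = C0 * t * norm z powr (- (real DIM('a) + \<alpha> - \<gamma>))"
        using z t alpha by (simp add: powr_diff powr_minus powr_add field_simps)
      finally show ?thesis
        using False C0 t by (intro add_increasing) (auto intro: ennreal_leI simp flip: ennreal_mult)
    qed
  qed
  also have "\<dots> = ennreal (t powr (\<gamma> / \<alpha>))
      + ennreal (C0 * t) * ennreal (sphere_area TYPE('a) / (\<alpha> - \<gamma>) * ?R powr (\<gamma> - \<alpha>))"
    using nn_integral_norm_powr_outside[where 'a='a, of "real DIM('a) + \<alpha> - \<gamma>" ?R] R \<gamma>
    by (simp add: nn_integral_add nn_integral_cmult nn_integral_p[OF t])
  also have "\<dots> = ennreal (t powr (\<gamma> / \<alpha>) + C0 * sphere_area TYPE('a) / (\<alpha> - \<gamma>) * (t * ?R powr (\<gamma> - \<alpha>)))"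
    using C0 t \<gamma> by (simp add: mult_ac flip: ennreal_mult ennreal_plus)
  also have "t * ?R powr (\<gamma> - \<alpha>) = t powr (\<gamma> / \<alpha>)"
    using t alpha by (simp add: powr_powr diff_divide_distrib powr_diff)
  finally show ?thesis by (simp add: moment_const_def algebra_simps)
qed

text \<open>The second difference appears because \<open>p\<close> is even; it makes the estimate additive in \<open>|x|\<^sup>\<delta>\<close> even
  for \<open>\<delta> > 1\<close>.\<close>

lemma heat_powr_le:
  assumes t: "t > 0" and \<delta>: "0 < \<delta>" "\<delta> < \<alpha>"
  shows "heat t (\<lambda>z. ennreal (norm z powr \<delta>)) x \<le> ennreal (norm x powr \<delta> + moment_const \<delta> * t powr (\<delta> / \<alpha>))"
proof -
  let ?h = "\<lambda>z::'a. ennreal (norm z powr \<delta>)"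
  have shift: "heat t ?h x = (\<integral>\<^sup>+z. ennreal (p t z) * ?h (x + z) \<partial>lborel)" by (rule heat_shift) measurable
  also have "\<dots> = (\<integral>\<^sup>+z. ennreal (p t z) * ?h (x - z) \<partial>lborel)"
    using nn_integral_lborel_reflect[of "\<lambda>z. ennreal (p t z) * ?h (x + z)"] by (simp add: p_minus)
  finally have reflect: "heat t ?h x = (\<integral>\<^sup>+z. ennreal (p t z) * ?h (x - z) \<partial>lborel)" .
  have "2 * heat t ?h x = (\<integral>\<^sup>+z. ennreal (p t z) * ?h (x + z) \<partial>lborel) + (\<integral>\<^sup>+z. ennreal (p t z) * ?h (x - z) \<partial>lborel)"
    by (simp only: mult_2 flip: shift reflect)
  also have "\<dots> = (\<integral>\<^sup>+z. ennreal (p t z) * ennreal (norm (x + z) powr \<delta> + norm (x - z) powr \<delta>) \<partial>lborel)"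
    by (subst nn_integral_add[symmetric]) (auto simp: distrib_left)
  also have "\<dots> \<le> (\<integral>\<^sup>+z. ennreal (p t z) * ennreal (2 * (norm x powr \<delta> + norm z powr \<delta>)) \<partial>lborel)"
    using \<delta> alpha by (intro nn_integral_mono mult_left_mono ennreal_leI norm_powr_second_difference_le) auto
  also have "\<dots> = (\<integral>\<^sup>+z. 2 * (?h x * ennreal (p t z) + ennreal (p t z * norm z powr \<delta>)) \<partial>lborel)"
    by (rule nn_integral_cong) (simp add: ennreal_mult distrib_left mult_ac)
  also have "\<dots> = 2 * (?h x + (\<integral>\<^sup>+z. ennreal (p t z * norm z powr \<delta>) \<partial>lborel))"
    by (simp add: nn_integral_cmult nn_integral_add nn_integral_p[OF t])
  also have "\<dots> \<le> 2 * (?h x + ennreal (moment_const \<delta> * t powr (\<delta> / \<alpha>)))"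
    using nn_integral_p_powr_le[OF t _ \<delta>(2)] \<delta> by (intro mult_left_mono add_left_mono) auto
  finally have "heat t ?h x \<le> ?h x + ennreal (moment_const \<delta> * t powr (\<delta> / \<alpha>))"
    by (subst (asm) ennreal_mult_le_mult_iff) auto
  then show ?thesis using moment_const_pos[OF \<delta>(2)] by simp
qed

definition three_P_const :: real where
  "three_P_const = C0 ^ 4 * 2 powr (real DIM('a) / \<alpha> + real DIM('a) + \<alpha>)"

lemma three_P_const_pos: "three_P_const > 0"
  using C0 by (simp add: three_P_const_def)

lemma p_3P:
  assumes "s > 0" "t > 0"
  shows "p s x * p t y \<le> three_P_const * p (s + t) (x + y) * (p s x + p t y)"
proof -
  let ?k = "2 powr (real DIM('a) / \<alpha> + real DIM('a) + \<alpha>)"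
  have "p s x * p t y \<le> (C0 * profile s x) * (C0 * profile t y)"
    using p_upper[of s x] p_upper[of t y] assms C0 profile_nonneg[of s x] by (intro mult_mono) auto
  also have "\<dots> = C0\<^sup>2 * (profile s x * profile t y)" by (simp add: power2_eq_square)
  also have "\<dots> \<le> C0\<^sup>2 * (?k * profile (s + t) (x + y) * (profile s x + profile t y))"
    by (intro mult_left_mono stable_profile_3P) (use assms alpha in auto)
  also have "\<dots> \<le> C0\<^sup>2 * (?k * (C0 * p (s + t) (x + y)) * (C0 * p s x + C0 * p t y))"
    using assms C0 by (intro mult_left_mono mult_mono add_mono profile_le_p)
      (auto intro!: mult_nonneg_nonneg add_nonneg_nonneg profile_nonneg)
  also have "\<dots> = three_P_const * p (s + t) (x + y) * (p s x + p t y)"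
    by (simp add: three_P_const_def power2_eq_square power4_eq_xxxx algebra_simps)
  finally show ?thesis .
qed

lemma heat_mult_heat_le:
  assumes times: "s > 0" "t > 0" and [measurable]: "V \<in> borel_measurable borel" "f \<in> borel_measurable borel"
  shows "heat s (\<lambda>z. V z * heat t f z) x
    \<le> (\<integral>\<^sup>+y. ennreal three_P_const * (heat s V x + heat t V y) * (ennreal (p (s + t) (y - x)) * f y) \<partial>lborel)"
proof -
  have "heat s (\<lambda>z. V z * heat t f z) x
      = (\<integral>\<^sup>+z. \<integral>\<^sup>+y. ennreal (p s (z - x)) * (V z * (ennreal (p t (y - z)) * f y)) \<partial>lborel \<partial>lborel)"
    unfolding heat_def by (simp add: nn_integral_cmult)
  also have "\<dots> = (\<integral>\<^sup>+y. \<integral>\<^sup>+z. ennreal (p s (z - x)) * (V z * (ennreal (p t (y - z)) * f y)) \<partial>lborel \<partial>lborel)"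
    by (rule lborel_pair.Fubini'[symmetric]) measurable
  also have "\<dots> \<le> (\<integral>\<^sup>+y. \<integral>\<^sup>+z. ennreal three_P_const * (ennreal (p (s + t) (y - x)) * f y) *
      (ennreal (p s (z - x)) * V z + ennreal (p t (z - y)) * V z) \<partial>lborel \<partial>lborel)"
  proof (intro nn_integral_mono)
    fix y z :: 'a
    have "p s (z - x) * p t (y - z) \<le> three_P_const * p (s + t) (y - x) * (p s (z - x) + p t (z - y))"
      using p_3P[OF times, of "z - x" "y - z"] p_commute[of t y z] by simp
    then have "ennreal (p s (z - x) * p t (y - z))
        \<le> ennreal (three_P_const * p (s + t) (y - x) * (p s (z - x) + p t (z - y)))"
      by (rule ennreal_leI)
    then have "ennreal (p s (z - x)) * ennreal (p t (y - z)) * (V z * f y)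
        \<le> ennreal three_P_const * ennreal (p (s + t) (y - x)) * (ennreal (p s (z - x))
            + ennreal (p t (z - y))) * (V z * f y)"
      using three_P_const_pos by (intro mult_right_mono) (simp_all add: ennreal_mult)
    then show "ennreal (p s (z - x)) * (V z * (ennreal (p t (y - z)) * f y)) \<le> ennreal three_P_const *
        (ennreal (p (s + t) (y - x)) * f y) * (ennreal (p s (z - x)) * V z + ennreal (p t (z - y)) * V z)"
      by (simp add: distrib_left distrib_right mult_ac)
  qed
  also have "\<dots> = (\<integral>\<^sup>+y. ennreal three_P_const * (heat s V x + heat t V y) * (ennreal (p (s + t) (y - x)) * f y) \<partial>lborel)"
    unfolding heat_def by (simp add: nn_integral_cmult nn_integral_add mult_ac)
  finally show ?thesis .
qed

lemma p_le_sup: "t > 0 \<Longrightarrow> p t x \<le> C0 * t powr (- real DIM('a) / \<alpha>)"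
  using p_upper[of t x] mult_left_mono[OF stable_profile_le_sup[of \<alpha> t x], of C0] C0 by linarith

lemma p_L1_tendsto:
  assumes s: "\<And>n. s n > 0" "s0 > 0" "s \<longlonglongrightarrow> s0" and y: "y \<longlonglongrightarrow> y0"
  shows "(\<lambda>n. LINT w|lborel. \<bar>p (s n) (w - y n) - p s0 (w - y0)\<bar>) \<longlonglongrightarrow> 0"
proof -
  have mass: "(\<integral>\<^sup>+w. ennreal (p t (w - v)) \<partial>lborel) = 1" if "t > 0" for t v
    using heat_const[OF that, of 1 v] by (simp add: heat_def)
  have "(\<lambda>n. \<integral>\<^sup>+w. ennreal (norm (p (s n) (w - y n) - p s0 (w - y0))) \<partial>lborel) \<longlonglongrightarrow> 0"
  proof (rule Scheffe_lemma2)
    have "((\<lambda>n. (\<lambda>(t, x). p t x) (s n, w - y n)) \<longlongrightarrow> (\<lambda>(t, x). p t x) (s0, w - y0)) sequentially" for w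
      by (rule continuous_on_tendsto_compose[OF continuous_p]) (use s y in \<open>auto intro!: tendsto_intros\<close>)
    then show "AE w in lborel. (\<lambda>n. p (s n) (w - y n)) \<longlonglongrightarrow> p s0 (w - y0)" by simp
  qed (use s in \<open>simp_all add: integrable_p_translate mass\<close>)
  moreover have "(\<integral>\<^sup>+w. ennreal (norm (p (s n) (w - y n) - p s0 (w - y0))) \<partial>lborel)
      = ennreal (LINT w|lborel. \<bar>p (s n) (w - y n) - p s0 (w - y0)\<bar>)" for n
    using s integrable_p_translate by (subst nn_integral_eq_integral) auto
  ultimately show ?thesis by (simp add: ennreal_tendsto_0_iff)
qed

end

section \<open>The action of the stable semigroup on powers of the norm\<close>

lemma has_bochner_integral_nn_integral_indicator:
  assumes [measurable]: "A \<in> sets M" "f \<in> borel_measurable M"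
    and "\<And>x. x \<in> A \<Longrightarrow> 0 \<le> f x" "0 \<le> I" "(\<integral>\<^sup>+x\<in>A. ennreal (f x) \<partial>M) = ennreal I"
  shows "has_bochner_integral M (\<lambda>x. indicator A x * f x) I"
proof (rule has_bochner_integral_nn_integral)
  show "(\<integral>\<^sup>+x. ennreal (indicator A x * f x) \<partial>M) = ennreal I"
    using assms(5) by (simp add: nn_integral_set_ennreal mult.commute)
qed (use assms in \<open>auto simp: indicator_def\<close>)

lemma Gamma_one_minus_eq:
  fixes g :: real
  assumes "0 < g" "g < 1"
  shows "Gamma (1 - g) = - g * Gamma (- g)"
proof -
  have "- g \<notin> \<int>\<^sub>\<le>\<^sub>0"
  proof
    assume "- g \<in> \<int>\<^sub>\<le>\<^sub>0"
    then obtain n :: int where "- g = of_int n" by (auto elim!: nonpos_Ints_cases)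
    then have "real_of_int n < 0" "real_of_int n > - 1" using assms by linarith+
    then have "n < 0" "- 1 < n" by linarith+
    then show False by simp
  qed
  then show ?thesis using Gamma_plus1[of "- g"] assms by simp
qed

lemma Gamma_minus_neg:
  fixes g :: real
  assumes "0 < g" "g < 1"
  shows "Gamma (- g) < 0"
proof -
  have "0 < Gamma (1 - g)" using assms by simp
  then show ?thesis unfolding Gamma_one_minus_eq[OF assms] using assms by (simp add: mult_less_0_iff)
qed

lemma nn_integral_exp_Icc:
  fixes r v :: real
  assumes "r > 0" "v \<ge> 0"
  shows "(\<integral>\<^sup>+u\<in>{0..v}. ennreal (exp (- (u * r))) \<partial>lborel) = ennreal ((1 - exp (- (v * r))) / r)"
proof -
  have "((\<lambda>u. exp (- (u * r))) has_integral (- exp (- (v * r)) / r) - (- exp (- (0 * r)) / r)) {0..v}"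
    by (rule fundamental_theorem_of_calculus[OF assms(2)])
       (use assms in \<open>auto intro!: derivative_eq_intros simp flip: has_real_derivative_iff_has_vector_derivative\<close>)
  then have "((\<lambda>u. exp (- (u * r))) has_integral (1 - exp (- (v * r))) / r) {0..v}" by (simp add: diff_divide_distrib)
  then show ?thesis by (intro nn_integral_has_integral_lebesgue') auto
qed

lemma nn_integral_Icc_eq_Ioo:
  fixes f :: "real \<Rightarrow> ennreal"
  shows "(\<integral>\<^sup>+s\<in>{a..b}. f s \<partial>lborel) = (\<integral>\<^sup>+s\<in>{a<..<b}. f s \<partial>lborel)"
proof (rule nn_integral_cong_AE)
  have "AE s in lborel. s \<noteq> a" "AE s in lborel. s \<noteq> b" by (rule AE_lborel_singleton)+
  then show "AE s in lborel. f s * indicator {a..b} s = f s * indicator {a<..<b} s"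
    by eventually_elim (auto simp: indicator_def)
qed

lemma nn_integral_powr_mult_one_minus_exp:
  fixes g v :: real
  assumes g: "0 < g" "g < 1" and v: "v \<ge> 0"
  shows "(\<integral>\<^sup>+r\<in>{0<..}. ennreal (r powr (- g - 1) * (1 - exp (- (r * v)))) \<partial>lborel) = ennreal (- Gamma (- g) * v powr g)"
proof -
  let ?F = "\<lambda>u r. ennreal (r powr (- g)) * indicator {0<..} r * (ennreal (exp (- (u * r))) * indicator {0..v} u)"
  have "ennreal (r powr (- g - 1) * (1 - exp (- (r * v)))) * indicator {0<..} r = (\<integral>\<^sup>+u. ?F u r \<partial>lborel)" for r
  proof (cases "r > 0")
    case True
    have "r powr (- g - 1) * (1 - exp (- (r * v))) = r powr (- g) * ((1 - exp (- (v * r))) / r)"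
      using True by (simp add: powr_diff powr_minus field_simps)
    then show ?thesis using True v
      by (simp add: nn_integral_cmult nn_integral_exp_Icc ennreal_mult del: times_divide_eq_right)
  qed simp
  then have "(\<integral>\<^sup>+r\<in>{0<..}. ennreal (r powr (- g - 1) * (1 - exp (- (r * v)))) \<partial>lborel)
      = (\<integral>\<^sup>+r. \<integral>\<^sup>+u. ?F u r \<partial>lborel \<partial>lborel)"
    by simp
  also have "\<dots> = (\<integral>\<^sup>+u. \<integral>\<^sup>+r. ?F u r \<partial>lborel \<partial>lborel)"
    by (rule lborel_pair.Fubini'[symmetric]) measurable
  also have "\<dots> = (\<integral>\<^sup>+u. ennreal (Gamma (1 - g)) * (ennreal (u powr (g - 1)) * indicator {0..v} u) \<partial>lborel)"
  proof (rule nn_integral_cong_AE)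
    have "AE u in lborel. u \<noteq> (0::real)" by (rule AE_lborel_singleton)
    then show "AE u in lborel. (\<integral>\<^sup>+r. ?F u r \<partial>lborel)
        = ennreal (Gamma (1 - g)) * (ennreal (u powr (g - 1)) * indicator {0..v} u)"
    proof eventually_elim
      case (elim u)
      show ?case
      proof (cases "u \<in> {0..v}")
        case True
        then have "(\<integral>\<^sup>+r. ?F u r \<partial>lborel) = (\<integral>\<^sup>+r\<in>{0..}. ennreal (r powr ((1 - g) - 1) * exp (- (u * r))) \<partial>lborel)"
          by (intro nn_integral_cong) (auto simp: indicator_def ennreal_mult)
        then show ?thesis using True elim g nn_integral_Gamma_scaled[of "1 - g" u] by (simp add: ennreal_mult)
      qed simp
    qed
  qed
  also have "\<dots> = ennreal (Gamma (1 - g)) * ennreal (v powr g / g)"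
    using nn_integral_powr_Icc_0[of g v] g v by (simp add: nn_integral_cmult)
  also have "\<dots> = ennreal (- Gamma (- g) * v powr g)"
    using g Gamma_one_minus_eq[OF g] Gamma_minus_neg[OF g] by (subst ennreal_mult[symmetric]) (auto simp: mult_le_0_iff)
  finally show ?thesis .
qed

lemma nn_integral_inversion:
  fixes f :: "real \<Rightarrow> real"
  assumes f: "set_integrable lborel {0<..} f" and nonneg: "\<And>r. r > 0 \<Longrightarrow> 0 \<le> f r"
  shows "(\<integral>\<^sup>+r\<in>{0<..}. ennreal (f (1 / r) / r\<^sup>2) \<partial>lborel) = (\<integral>\<^sup>+r\<in>{0<..}. ennreal (f r) \<partial>lborel)"
proof -
  have abs_f: "f absolutely_integrable_on {0<..}" using f by (simp add: set_integrable_def integrable_completion)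
  have image: "(\<lambda>r. 1 / r) ` {0<..} = ({0<..} :: real set)"
  proof safe
    fix x :: real assume "0 < x"
    then show "x \<in> (\<lambda>r. 1 / r) ` {0<..}" by (intro image_eqI[of _ _ "1 / x"]) auto
  qed auto
  have inj: "inj_on (\<lambda>r. 1 / r :: real) {0<..}" by (auto simp: inj_on_def)
  have deriv: "((\<lambda>r. 1 / r) has_real_derivative - 1 / x\<^sup>2) (at x within {0<..})" if "x \<in> {0<..}" for x :: real
    using that by (auto intro!: derivative_eq_intros simp: power2_eq_square)
  have "(\<lambda>x. \<bar>- 1 / x\<^sup>2\<bar> * f (1 / x)) absolutely_integrable_on {0<..} \<and>
      integral {0<..} (\<lambda>x. \<bar>- 1 / x\<^sup>2\<bar> * f (1 / x)) = integral {0<..} f"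
    by (rule has_absolute_integral_change_of_variables_1'[OF _ deriv inj, THEN iffD2]) (use abs_f image in auto)
  then have "((\<lambda>x. \<bar>- 1 / x\<^sup>2\<bar> * f (1 / x)) has_integral integral {0<..} f) {0<..}"
    using set_lebesgue_integral_eq_integral(1) integrable_integral by metis
  then have "((\<lambda>x. f (1 / x) / x\<^sup>2) has_integral integral {0<..} f) {0<..}"
    by (rule has_integral_eq[rotated]) auto
  moreover have "(f has_integral integral {0<..} f) {0<..}"
    using set_lebesgue_integral_eq_integral(1)[OF abs_f] by (rule integrable_integral)
  ultimately show ?thesis
    using nonneg by (subst (1 2) nn_integral_has_integral_lebesgue') auto
qed

definition gauss_mixture_const :: "'a::euclidean_space itself \<Rightarrow> real \<Rightarrow> real" where
  "gauss_mixture_const _ b =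
     (4 * pi) powr (- real DIM('a) / 2) * Gamma (real DIM('a) / 2 - b) * 2 powr (real DIM('a) - 2 * b)"

lemma gauss_mixture_const_pos: "b < real DIM('a) / 2 \<Longrightarrow> 0 < gauss_mixture_const TYPE('a::euclidean_space) b"
  by (simp add: gauss_mixture_const_def)

lemma powr_mult_gauss_eq_inversion:
  fixes \<xi> :: "'a::euclidean_space" and b :: real
  assumes r: "r > 0"
  defines "w \<equiv> (norm \<xi>)\<^sup>2 / 4" and "m \<equiv> real DIM('a) / 2 - b"
  shows "r powr (b - 1) * gauss r \<xi> =
    (4 * pi) powr (- real DIM('a) / 2) * ((1 / r) powr (m - 1) * exp (- (w * (1 / r))) / r\<^sup>2)"
proof -
  have "r powr (b - 1) * r powr (- real DIM('a) / 2) * r powr 2 = r powr ((b - 1) + - real DIM('a) / 2 + 2)"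
    by (simp only: powr_add)
  also have "\<dots> = r powr (1 - m)" by (rule arg_cong[where f="\<lambda>e. r powr e"]) (simp add: m_def)
  also have "\<dots> = (1 / r) powr (m - 1)" using r by (simp add: powr_divide powr_minus_divide[symmetric])
  finally have "(1 / r) powr (m - 1) / r\<^sup>2 = r powr (b - 1) * r powr (- real DIM('a) / 2)"
    using r by (simp add: divide_eq_eq)
  moreover have "(4 * pi * r) powr (- real DIM('a) / 2)
      = (4 * pi) powr (- real DIM('a) / 2) * r powr (- real DIM('a) / 2)"
    using r by (simp add: powr_mult)
  moreover have "- (norm \<xi>)\<^sup>2 / (4 * r) = - (w * (1 / r))" using r by (simp add: w_def)
  ultimately show ?thesis
    unfolding gauss_def by (simp add: times_divide_eq_left[symmetric] del: times_divide_eq_left)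
qed

lemma nn_integral_gauss_powr:
  fixes \<xi> :: "'a::euclidean_space"
  assumes b: "b < real DIM('a) / 2" and \<xi>: "\<xi> \<noteq> 0"
  shows "(\<integral>\<^sup>+r\<in>{0<..}. ennreal (r powr (b - 1) * gauss r \<xi>) \<partial>lborel)
    = ennreal (gauss_mixture_const TYPE('a) b * norm \<xi> powr (2 * b - real DIM('a)))"
proof -
  define m where "m = real DIM('a) / 2 - b"
  define w where "w = (norm \<xi>)\<^sup>2 / 4"
  let ?f = "\<lambda>r. r powr (m - 1) * exp (- (w * r))" and ?c = "(4 * pi) powr (- real DIM('a) / 2)"
  have m: "m > 0" and w: "w > 0" using b \<xi> by (simp_all add: m_def w_def)
  have "(\<integral>\<^sup>+r\<in>{0<..}. ennreal (?f r) \<partial>lborel) = (\<integral>\<^sup>+r\<in>{0..}. ennreal (?f r) \<partial>lborel)"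
    by (rule nn_integral_cong) (auto simp: indicator_def)
  then have f: "(\<integral>\<^sup>+r\<in>{0<..}. ennreal (?f r) \<partial>lborel) = ennreal (Gamma m * w powr (- m))"
    using nn_integral_Gamma_scaled[OF m w] by simp
  have "set_integrable lborel {0<..} ?f"
    using has_bochner_integral_nn_integral_indicator[OF _ _ _ _ f] m
    by (simp add: set_integrable_def has_bochner_integral_iff)
  have "(\<integral>\<^sup>+r\<in>{0<..}. ennreal (r powr (b - 1) * gauss r \<xi>) \<partial>lborel)
      = (\<integral>\<^sup>+r. ennreal ?c * (ennreal (?f (1 / r) / r\<^sup>2) * indicator {0<..} r) \<partial>lborel)"
    by (rule nn_integral_cong)
       (auto simp: indicator_def powr_mult_gauss_eq_inversion m_def w_def simp flip: ennreal_mult)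
  also have "\<dots> = ennreal ?c * ennreal (Gamma m * w powr (- m))"
    using nn_integral_inversion[OF \<open>set_integrable lborel {0<..} ?f\<close>] f by (simp add: nn_integral_cmult)
  also have "w powr (- m) = 2 powr (real DIM('a) - 2 * b) * norm \<xi> powr (2 * b - real DIM('a))"
  proof -
    have "w powr (- m) = ((norm \<xi> / 2) powr 2) powr (- m)" using \<xi> by (simp add: w_def power_divide)
    also have "\<dots> = (norm \<xi> / 2) powr (2 * b - real DIM('a))" unfolding powr_powr by (simp add: m_def algebra_simps)
    also have "\<dots> = 2 powr (real DIM('a) - 2 * b) * norm \<xi> powr (2 * b - real DIM('a))"
      by (simp add: powr_divide powr_diff mult_ac)
    finally show ?thesis .
  qed
  finally show ?thesis using m by (simp add: gauss_mixture_const_def m_def mult_ac flip: ennreal_mult)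
qed

lemma has_bochner_integral_gauss_mixture:
  fixes k :: "'a::euclidean_space \<Rightarrow> real"
  assumes b: "b < real DIM('a) / 2" and [measurable]: "k \<in> borel_measurable borel"
    and integrable_k: "integrable lborel (\<lambda>\<xi>. k \<xi> * norm \<xi> powr (2 * b - real DIM('a)))"
  shows "has_bochner_integral lborel (\<lambda>r. indicator {0<..} r * (r powr (b - 1) * (LINT \<xi>|lborel. gauss r \<xi> * k \<xi>)))
    (gauss_mixture_const TYPE('a) b * (LINT \<xi>|lborel. k \<xi> * norm \<xi> powr (2 * b - real DIM('a))))"
proof -
  let ?c = "gauss_mixture_const TYPE('a) b" and ?e = "2 * b - real DIM('a)"
  let ?w = "\<lambda>(\<xi>::'a) r. indicator {0<..} r * (r powr (b - 1) * gauss r \<xi>)"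
  let ?F = "\<lambda>(\<xi>, r). k \<xi> * ?w \<xi> r"
  have mixture_pos: "?c > 0" using b by (rule gauss_mixture_const_pos)
  have nonzero: "AE \<xi> in lborel. \<xi> \<noteq> (0::'a)" by (rule AE_lborel_singleton)
  have weight: "has_bochner_integral lborel (?w \<xi>) (?c * norm \<xi> powr ?e)" if "\<xi> \<noteq> 0" for \<xi>
    using nn_integral_gauss_powr[OF b that] mixture_pos by (intro has_bochner_integral_nn_integral_indicator) auto
  have F: "integrable (lborel \<Otimes>\<^sub>M lborel) ?F"
  proof (rule lborel_pair.Fubini_integrable)
    have "AE \<xi> in lborel. ?c * \<bar>k \<xi> * norm \<xi> powr ?e\<bar> = (LINT r|lborel. norm (?F (\<xi>, r)))"
      using nonzero
    proof eventually_elim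
      case (elim \<xi>)
      have "(LINT r|lborel. norm (?F (\<xi>, r))) = (LINT r|lborel. \<bar>k \<xi>\<bar> * ?w \<xi> r)"
        by (rule Bochner_Integration.integral_cong) (auto simp: abs_mult indicator_def)
      then show ?case using has_bochner_integral_integral_eq[OF weight[OF elim]] by (simp add: abs_mult)
    qed
    then show "integrable lborel (\<lambda>\<xi>. LINT r|lborel. norm (?F (\<xi>, r)))"
      by (intro integrable_cong_AE_imp[OF integrable_mult_right[OF integrable_abs[OF integrable_k], of ?c]]) auto
    show "AE \<xi> in lborel. integrable lborel (\<lambda>r. ?F (\<xi>, r))"
      using nonzero by eventually_elim (use weight in \<open>auto simp: has_bochner_integral_iff\<close>)
  qed measurable
  have inner: "(LINT \<xi>|lborel. ?F (\<xi>, r)) = indicator {0<..} r * (r powr (b - 1) * (LINT \<xi>|lborel. gauss r \<xi> * k \<xi>))"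
    for r
    by (simp add: mult_ac flip: integral_mult_right_zero)
  have "(LINT \<xi>|lborel. LINT r|lborel. ?F (\<xi>, r)) = (LINT \<xi>|lborel. ?c * (k \<xi> * norm \<xi> powr ?e))"
    using nonzero by (intro integral_cong_AE)
      (auto elim!: eventually_mono simp: has_bochner_integral_integral_eq[OF weight])
  moreover have "integrable lborel (\<lambda>r. LINT \<xi>|lborel. ?F (\<xi>, r))" using lborel_pair.integrable_snd[OF F] by simp
  ultimately show ?thesis unfolding inner[symmetric] has_bochner_integral_iff
    using lborel_pair.Fubini_integral[OF F] by simp
qed

context stable_kernel
begin

definition gauss_heat :: "real \<Rightarrow> real \<Rightarrow> 'a \<Rightarrow> real" where
  "gauss_heat t r x = (LINT z|lborel. p t (z - x) * exp (- r * (norm z)\<^sup>2))"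

lemma measurable_gauss_heat [measurable]: "(\<lambda>(t, r). gauss_heat t r x) \<in> borel_measurable (borel \<Otimes>\<^sub>M borel)"
  unfolding gauss_heat_def by measurable

lemma integrable_p_gauss:
  assumes "t > 0" "r \<ge> 0"
  shows "integrable lborel (\<lambda>z. p t (z - x) * exp (- r * (norm z)\<^sup>2))"
  by (rule Bochner_Integration.integrable_bound[OF integrable_p_translate[OF assms(1), of x]])
     (use assms in \<open>auto simp: abs_mult intro!: mult_left_le\<close>)

lemma gauss_heat_nonneg [simp]: "0 \<le> gauss_heat t r x"
  by (simp add: gauss_heat_def)

lemma one_minus_gauss_heat:
  assumes "t > 0" "r \<ge> 0"
  shows "1 - gauss_heat t r x = (LINT z|lborel. p t (z - x) * (1 - exp (- r * (norm z)\<^sup>2)))"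
  using Bochner_Integration.integral_diff[OF integrable_p_translate integrable_p_gauss, of t t r x x] assms
  by (simp add: gauss_heat_def integral_p_translate right_diff_distrib)

lemma heat_exp_norm_sq:
  assumes "t > 0" "r \<ge> 0"
  shows "heat t (\<lambda>z. ennreal (exp (- r * (norm z)\<^sup>2))) x = ennreal (gauss_heat t r x)"
  unfolding gauss_heat_def using assms by (intro ennreal_integral_p[symmetric] integrable_p_gauss) auto

lemma heat_one_minus_exp_norm_sq:
  assumes "t > 0" "r \<ge> 0"
  shows "heat t (\<lambda>z. ennreal (1 - exp (- r * (norm z)\<^sup>2))) x = ennreal (1 - gauss_heat t r x)"
  unfolding one_minus_gauss_heat[OF assms]
  using Bochner_Integration.integrable_diff[OF integrable_p_translate integrable_p_gauss, of t t r x x] assms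
  by (intro ennreal_integral_p[symmetric]) (auto simp: right_diff_distrib)

lemma gauss_heat_le_1:
  assumes "t > 0" "r \<ge> 0"
  shows "gauss_heat t r x \<le> 1"
proof -
  have "0 \<le> (LINT z|lborel. p t (z - x) * (1 - exp (- r * (norm z)\<^sup>2)))"
    using assms by (intro integral_nonneg_AE) auto
  then show ?thesis unfolding one_minus_gauss_heat[OF assms, symmetric] by simp
qed

lemma gauss_heat_eq_fourier:
  assumes t: "t > 0" and r: "r > 0"
  shows "gauss_heat t r x = (LINT \<xi>|lborel. gauss r \<xi> * (cos (x \<bullet> \<xi>) * exp (- t * norm \<xi> powr \<alpha>)))"
proof -
  let ?F = "\<lambda>(z, \<xi>). complex_of_real (p t (z - x) * gauss r \<xi>) * cis (z \<bullet> \<xi>)"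
  have measurable_F [measurable]: "?F \<in> borel_measurable (lborel \<Otimes>\<^sub>M lborel)"
    unfolding cis_conv_exp by measurable
  have F: "integrable (lborel \<Otimes>\<^sub>M lborel) ?F"
  proof (rule lborel_pair.Fubini_integrable[OF measurable_F])
    show "integrable lborel (\<lambda>z. LINT \<xi>|lborel. norm (?F (z, \<xi>)))"
      using integrable_p_translate[OF t] integral_gauss[OF r, where 'a='a] by (simp add: norm_mult)
    show "AE z in lborel. integrable lborel (\<lambda>\<xi>. ?F (z, \<xi>))"
      by (simp add: mult.assoc integrable_gauss_cis[OF r])
  qed
  have inner_\<xi>: "(LINT \<xi>|lborel. ?F (z, \<xi>)) = of_real (p t (z - x) * exp (- r * (norm z)\<^sup>2))" for z
    using char_gauss[OF r, of z] by (simp add: mult.assoc)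
  have inner_z: "(LINT z|lborel. ?F (z, \<xi>)) = of_real (gauss r \<xi>) * cis (x \<bullet> \<xi>) * of_real (exp (- t * norm \<xi> powr \<alpha>))"
    for \<xi>
  proof -
    have "(LINT z|lborel. ?F (z, \<xi>)) = (LINT z|lborel. ?F (x + z, \<xi>))"
      by (rule integral_lborel_translate[symmetric]) measurable
    also have "\<dots> = (LINT z|lborel. of_real (gauss r \<xi>) * cis (x \<bullet> \<xi>) * (of_real (p t z) * cis (\<xi> \<bullet> z)))"
      by (simp add: inner_add_left inner_commute[of \<xi>] mult_ac flip: cis_mult)
    finally show ?thesis using char_p[OF t, of \<xi>] by simp
  qed
  have "integrable lborel (\<lambda>\<xi>. LINT z|lborel. ?F (z, \<xi>))" using lborel_pair.integrable_snd[OF F] by simp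
  then have integrable_\<xi>: "integrable lborel (\<lambda>\<xi>. complex_of_real (gauss r \<xi>) * cis (x \<bullet> \<xi>)
      * of_real (exp (- t * norm \<xi> powr \<alpha>)))"
    unfolding inner_z .
  have "complex_of_real (gauss_heat t r x) = (LINT z|lborel. LINT \<xi>|lborel. ?F (z, \<xi>))"
    unfolding inner_\<xi> gauss_heat_def integral_complex_of_real ..
  also have "\<dots> = (LINT \<xi>|lborel. LINT z|lborel. ?F (z, \<xi>))"
    using lborel_pair.Fubini_integral[OF F] by simp
  finally have "gauss_heat t r x = Re (LINT \<xi>|lborel. of_real (gauss r \<xi>) * cis (x \<bullet> \<xi>)
      * of_real (exp (- t * norm \<xi> powr \<alpha>)))"
    unfolding inner_z by (metis Re_complex_of_real)
  then show ?thesis unfolding integral_Re[OF integrable_\<xi>, symmetric] by (simp add: mult.assoc)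
qed

lemma integrable_gauss_mult:
  fixes k :: "'a \<Rightarrow> real"
  assumes r: "r > 0" and [measurable]: "k \<in> borel_measurable borel" and k: "\<And>\<xi>. \<bar>k \<xi>\<bar> \<le> B"
  shows "integrable lborel (\<lambda>\<xi>. gauss r \<xi> * k \<xi>)"
proof (rule Bochner_Integration.integrable_bound)
  show "integrable lborel (\<lambda>\<xi>::'a. B * gauss r \<xi>)" by (simp add: integrable_gauss[OF r])
  have "B \<ge> 0" using k[of 0] by linarith
  then show "AE \<xi> in lborel. norm (gauss r \<xi> * k \<xi>) \<le> norm (B * gauss r \<xi>)"
    using k by (intro AE_I2) (simp add: abs_mult mult.commute[of "gauss _ _"] mult_right_mono)
qed measurable

lemma exp_norm_sq_minus_gauss_heat:
  assumes t: "t > 0" and r: "r > 0"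
  shows "exp (- r * (norm x)\<^sup>2) - gauss_heat t r x
      = (LINT \<xi>|lborel. gauss r \<xi> * (cos (x \<bullet> \<xi>) * (1 - exp (- t * norm \<xi> powr \<alpha>))))"
proof -
  have cos_exp_le: "\<bar>cos (x \<bullet> \<xi>) * exp (- t * norm \<xi> powr \<alpha>)\<bar> \<le> 1" for \<xi>
    using mult_mono[of "\<bar>cos (x \<bullet> \<xi>)\<bar>" 1 "exp (- t * norm \<xi> powr \<alpha>)" 1] t by (simp add: abs_mult)
  have "exp (- r * (norm x)\<^sup>2) = Re (LINT \<xi>|lborel. complex_of_real (gauss r \<xi>) * cis (x \<bullet> \<xi>))"
    by (simp add: char_gauss[OF r])
  also have "\<dots> = (LINT \<xi>|lborel. gauss r \<xi> * cos (x \<bullet> \<xi>))"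
    by (simp add: integral_Re[OF integrable_gauss_cis[OF r], symmetric])
  finally have "exp (- r * (norm x)\<^sup>2) - gauss_heat t r x = (LINT \<xi>|lborel. gauss r \<xi> * cos (x \<bullet> \<xi>))
      - (LINT \<xi>|lborel. gauss r \<xi> * (cos (x \<bullet> \<xi>) * exp (- t * norm \<xi> powr \<alpha>)))"
    by (simp add: gauss_heat_eq_fourier[OF t r])
  also have "\<dots> = (LINT \<xi>|lborel. gauss r \<xi> * cos (x \<bullet> \<xi>) - gauss r \<xi> * (cos (x \<bullet> \<xi>) * exp (- t * norm \<xi> powr \<alpha>)))"
    by (intro Bochner_Integration.integral_diff[symmetric] integrable_gauss_mult[OF r, where B=1] cos_exp_le) auto
  finally show ?thesis by (simp add: right_diff_distrib)
qed

definition gauss_potential :: "real \<Rightarrow> real \<Rightarrow> 'a \<Rightarrow> real" where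
  "gauss_potential t r x = (LINT s|lborel. indicator {0..t} s * gauss_heat s r x)"

lemma gauss_potential_nonneg [simp]: "0 \<le> gauss_potential t r x"
  by (simp add: gauss_potential_def)

lemma integrable_gauss_heat:
  assumes "r \<ge> 0"
  shows "integrable lborel (\<lambda>s. indicator {0..t} s * gauss_heat s r x)"
proof (rule Bochner_Integration.integrable_bound)
  show "integrable lborel (indicator {0..t} :: real \<Rightarrow> real)"
    by (rule integrable_real_indicator) (auto simp: emeasure_lborel_Icc_eq)
  have "AE s in lborel. s \<noteq> (0::real)" by (rule AE_lborel_singleton)
  then show "AE s in lborel. norm (indicator {0..t} s * gauss_heat s r x) \<le> norm (indicator {0..t} s :: real)"
    by eventually_elim (use gauss_heat_le_1 assms in \<open>auto simp: indicator_def\<close>)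
qed measurable

lemma nn_integral_gauss_heat:
  "r \<ge> 0 \<Longrightarrow> (\<integral>\<^sup>+s\<in>{0..t}. ennreal (gauss_heat s r x) \<partial>lborel) = ennreal (gauss_potential t r x)"
  unfolding gauss_potential_def nn_integral_set_ennreal
  using integrable_gauss_heat by (subst nn_integral_eq_integral) (auto simp: mult.commute)

lemma integrable_gauss_cos_heat:
  assumes r: "r > 0" and t: "t \<ge> 0"
  shows "integrable (lborel \<Otimes>\<^sub>M lborel)
    (\<lambda>(\<xi>::'a, s). indicator {0..t} s * (gauss r \<xi> * (cos (x \<bullet> \<xi>) * exp (- s * norm \<xi> powr \<alpha>))))"
  (is "integrable _ ?F")
proof -
  let ?D = "\<lambda>(\<xi>::'a, s). gauss r \<xi> * indicator {0..t} s"
  have "integrable (lborel \<Otimes>\<^sub>M lborel) ?D"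
    by (rule lborel_pair.Fubini_integrable) (use t in \<open>auto simp: integrable_gauss[OF r]\<close>)
  moreover have "norm (?F y) \<le> norm (?D y)" for y
    using mult_mono[of "\<bar>cos (x \<bullet> fst y)\<bar>" 1 "exp (- snd y * norm (fst y) powr \<alpha>)" 1]
    by (auto simp: split_beta abs_mult indicator_def intro!: mult_left_le)
  ultimately show ?thesis
    by (intro Bochner_Integration.integrable_bound[where f="?D" and g="?F"] AE_I2) auto
qed

lemma gauss_potential_eq_fourier:
  assumes t: "t > 0" and r: "r > 0"
  shows "gauss_potential t r x
    = (LINT \<xi>|lborel. gauss r \<xi> * (cos (x \<bullet> \<xi>) * ((1 - exp (- t * norm \<xi> powr \<alpha>)) / norm \<xi> powr \<alpha>)))"
proof -
  let ?F = "\<lambda>(\<xi>::'a, s). indicator {0..t} s * (gauss r \<xi> * (cos (x \<bullet> \<xi>) * exp (- s * norm \<xi> powr \<alpha>)))"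
  have inner_s: "(LINT s|lborel. ?F (\<xi>, s))
      = gauss r \<xi> * (cos (x \<bullet> \<xi>) * ((1 - exp (- t * norm \<xi> powr \<alpha>)) / norm \<xi> powr \<alpha>))"
    if "\<xi> \<noteq> 0" for \<xi>
  proof -
    let ?v = "norm \<xi> powr \<alpha>"
    have "has_bochner_integral lborel (\<lambda>s. indicator {0..t} s * exp (- (s * ?v))) ((1 - exp (- (t * ?v))) / ?v)"
      using nn_integral_exp_Icc[of ?v t] that t by (intro has_bochner_integral_nn_integral_indicator) auto
    from has_bochner_integral_integral_eq[OF has_bochner_integral_mult_right[OF this, of "gauss r \<xi> * cos (x \<bullet> \<xi>)"]]
    show ?thesis by (simp add: mult_ac)
  qed
  have inner_\<xi>: "(LINT \<xi>|lborel. ?F (\<xi>, s)) = indicator {0..t} s * gauss_heat s r x" if "s \<noteq> 0" for s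
    using gauss_heat_eq_fourier[OF _ r, of s x] that by (cases "s \<in> {0..t}") auto
  have nonzero: "AE s in lborel. s \<noteq> (0::real)" "AE \<xi> in lborel. \<xi> \<noteq> (0::'a)" by (rule AE_lborel_singleton)+
  have "gauss_potential t r x = (LINT s|lborel. LINT \<xi>|lborel. ?F (\<xi>, s))"
    unfolding gauss_potential_def
  proof (rule integral_cong_AE)
    show "AE s in lborel. indicator {0..t} s * gauss_heat s r x = (LINT \<xi>|lborel. ?F (\<xi>, s))"
      using nonzero(1) by eventually_elim (rule inner_\<xi>[symmetric])
  qed measurable
  also have "\<dots> = (LINT \<xi>|lborel. LINT s|lborel. ?F (\<xi>, s))"
    using lborel_pair.Fubini_integral[OF integrable_gauss_cos_heat[OF r, of t x]] t by simp
  also have "\<dots> = (LINT \<xi>|lborel. gauss r \<xi> * (cos (x \<bullet> \<xi>) * ((1 - exp (- t * norm \<xi> powr \<alpha>)) / norm \<xi> powr \<alpha>)))"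
  proof (rule integral_cong_AE)
    show "AE \<xi> in lborel. (LINT s|lborel. ?F (\<xi>, s))
        = gauss r \<xi> * (cos (x \<bullet> \<xi>) * ((1 - exp (- t * norm \<xi> powr \<alpha>)) / norm \<xi> powr \<alpha>))"
      using nonzero(2) by eventually_elim (rule inner_s)
  qed measurable
  finally show ?thesis .
qed

definition char_defect :: "real \<Rightarrow> real \<Rightarrow> 'a \<Rightarrow> 'a \<Rightarrow> real" where
  "char_defect \<delta> t x \<xi> = cos (x \<bullet> \<xi>) * (1 - exp (- t * norm \<xi> powr \<alpha>)) * norm \<xi> powr (- \<delta> - real DIM('a))"

lemma integrable_char_defect:
  assumes t: "t > 0" and \<delta>: "0 < \<delta>" "\<delta> < \<alpha>"
  shows "integrable lborel (char_defect \<delta> t x)"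
proof (rule integrable_if_norm_powr_le[where b="real DIM('a) + \<delta> - \<alpha>" and c="real DIM('a) + \<delta>" and A="max 1 t"])
  have defect_le: "\<bar>char_defect \<delta> t x \<xi>\<bar> \<le> (1 - exp (- t * norm \<xi> powr \<alpha>)) * norm \<xi> powr (- \<delta> - real DIM('a))" for \<xi>
    using t by (auto simp: char_defect_def abs_mult intro!: mult_right_mono mult_left_le_one_le)
  fix \<xi> :: 'a
  show "\<bar>char_defect \<delta> t x \<xi>\<bar> \<le> max 1 t * norm \<xi> powr (- (real DIM('a) + \<delta> - \<alpha>))" if "\<xi> \<noteq> 0"
  proof -
    have "1 - exp (- t * norm \<xi> powr \<alpha>) \<le> max 1 t * norm \<xi> powr \<alpha>"
      using one_minus_exp_le[of "t * norm \<xi> powr \<alpha>"] mult_right_mono[of t "max 1 t" "norm \<xi> powr \<alpha>"] by simp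
    then have "\<bar>char_defect \<delta> t x \<xi>\<bar> \<le> max 1 t * norm \<xi> powr \<alpha> * norm \<xi> powr (- \<delta> - real DIM('a))"
      using defect_le[of \<xi>] by (meson mult_right_mono order_trans powr_ge_zero)
    also have "\<dots> = max 1 t * norm \<xi> powr (- (real DIM('a) + \<delta> - \<alpha>))"
      using that by (simp add: powr_add[symmetric] mult.assoc) (simp add: algebra_simps)
    finally show ?thesis .
  qed
  have "(1 - exp (- t * norm \<xi> powr \<alpha>)) * norm \<xi> powr (- \<delta> - real DIM('a))
      \<le> max 1 t * norm \<xi> powr (- (real DIM('a) + \<delta>))"
    using t by (intro mult_mono) (auto simp: algebra_simps intro: add_increasing2)
  then show "\<bar>char_defect \<delta> t x \<xi>\<bar> \<le> max 1 t * norm \<xi> powr (- (real DIM('a) + \<delta>))" using defect_le[of \<xi>] by linarith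
qed (use assms alpha in \<open>auto simp: char_defect_def[abs_def]\<close>)

text \<open>The generator acts on both sides of the next two identities through the same integral of \<open>char_defect\<close>,
  because \<open>(1 - e\<^bsup>-tv\<^esup>) / v\<close> with \<open>v = |\<xi>|\<^sup>\<alpha>\<close> is the integral of \<open>e\<^bsup>-sv\<^esup>\<close> over \<open>0 < s < t\<close>.\<close>

lemma norm_powr_eq_mixture:
  assumes "0 < \<delta>" "\<delta> < 2"
  shows "ennreal (- Gamma (- \<delta> / 2) * norm (z::'a) powr \<delta>)
    = (\<integral>\<^sup>+r\<in>{0<..}. ennreal (r powr (- \<delta> / 2 - 1) * (1 - exp (- r * (norm z)\<^sup>2))) \<partial>lborel)"
proof -
  have "((norm z)\<^sup>2) powr (\<delta> / 2) = norm z powr \<delta>"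
    by (cases "z = 0") (simp_all add: powr_powr flip: powr_numeral)
  then show ?thesis using nn_integral_powr_mult_one_minus_exp[of "\<delta> / 2" "(norm z)\<^sup>2"] assms by simp
qed

lemma has_bochner_integral_one_minus_gauss_heat:
  assumes t: "t > 0" and \<delta>: "0 < \<delta>" "\<delta> < \<alpha>"
  shows "has_bochner_integral lborel (\<lambda>r. indicator {0<..} r * (r powr (- \<delta> / 2 - 1) * (1 - gauss_heat t r x)))
    (- Gamma (- \<delta> / 2) * norm x powr \<delta> + gauss_mixture_const TYPE('a) (- \<delta> / 2) * (LINT \<xi>|lborel. char_defect \<delta> t x \<xi>))"
proof -
  let ?w = "\<lambda>r. r powr (- \<delta> / 2 - 1)" and ?k = "\<lambda>\<xi>. cos (x \<bullet> \<xi>) * (1 - exp (- t * norm \<xi> powr \<alpha>))"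
  have "Gamma (- \<delta> / 2) < 0" using Gamma_minus_neg[of "\<delta> / 2"] \<delta> alpha by simp
  then have "has_bochner_integral lborel (\<lambda>r. indicator {0<..} r
      * (?w r * (1 - exp (- r * (norm x)\<^sup>2)))) (- Gamma (- \<delta> / 2) * norm x powr \<delta>)"
    using norm_powr_eq_mixture[of \<delta> x] \<delta> alpha
    by (intro has_bochner_integral_nn_integral_indicator) (auto simp: mult_le_0_iff)
  moreover have "has_bochner_integral lborel (\<lambda>r. indicator {0<..} r * (?w r * (LINT \<xi>|lborel. gauss r \<xi> * ?k \<xi>)))
      (gauss_mixture_const TYPE('a) (- \<delta> / 2) * (LINT \<xi>|lborel. char_defect \<delta> t x \<xi>))"
    using has_bochner_integral_gauss_mixture[of "- \<delta> / 2" ?k] \<delta> dim_ge_1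
      integrable_char_defect[OF assms, of x] by (simp add: char_defect_def[abs_def])
  ultimately have "has_bochner_integral lborel (\<lambda>r. indicator {0<..} r * (?w r * (1 - exp (- r * (norm x)\<^sup>2)))
      + indicator {0<..} r * (?w r * (LINT \<xi>|lborel. gauss r \<xi> * ?k \<xi>)))
    (- Gamma (- \<delta> / 2) * norm x powr \<delta> + gauss_mixture_const TYPE('a) (- \<delta> / 2) * (LINT \<xi>|lborel. char_defect \<delta> t x \<xi>))"
    by (rule has_bochner_integral_add)
  moreover have "indicator {0<..} r * (?w r * (1 - exp (- r * (norm x)\<^sup>2)))
      + indicator {0<..} r * (?w r * (LINT \<xi>|lborel. gauss r \<xi> * ?k \<xi>))
      = indicator {0<..} r * (?w r * (1 - gauss_heat t r x))" for r
  proof (cases "r > 0")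
    case True
    show ?thesis unfolding exp_norm_sq_minus_gauss_heat[OF t True, symmetric] by (simp add: algebra_simps)
  qed simp
  ultimately show ?thesis by simp
qed

lemma heat_powr_eq_fourier:
  assumes t: "t > 0" and \<delta>: "0 < \<delta>" "\<delta> < \<alpha>"
  shows "ennreal (- Gamma (- \<delta> / 2)) * heat t (\<lambda>z. ennreal (norm z powr \<delta>)) x
      = ennreal (- Gamma (- \<delta> / 2) * norm x powr \<delta>
    + gauss_mixture_const TYPE('a) (- \<delta> / 2) * (LINT \<xi>|lborel. char_defect \<delta> t x \<xi>))"
proof -
  define G where "G = - Gamma (- \<delta> / 2)"
  let ?w = "\<lambda>r. r powr (- \<delta> / 2 - 1)" and ?J = "LINT \<xi>|lborel. char_defect \<delta> t x \<xi>"
  have G: "G > 0" using Gamma_minus_neg[of "\<delta> / 2"] \<delta> alpha by (simp add: G_def)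
  have mixture: "ennreal G * ennreal (norm z powr \<delta>)
      = (\<integral>\<^sup>+r\<in>{0<..}. ennreal (?w r * (1 - exp (- r * (norm z)\<^sup>2))) \<partial>lborel)" for z :: 'a
    using norm_powr_eq_mixture[of \<delta> z] G \<delta> alpha by (simp add: G_def flip: ennreal_mult)
  have "ennreal G * heat t (\<lambda>z. ennreal (norm z powr \<delta>)) x
      = (\<integral>\<^sup>+r. heat t (\<lambda>z. ennreal (?w r * (1 - exp (- r * (norm z)\<^sup>2))) * indicator {0<..} r) x \<partial>lborel)"
    by (simp add: heat_cmult[symmetric] mixture heat_nn_integral)
  also have "\<dots> = (\<integral>\<^sup>+r. ennreal (indicator {0<..} r * (?w r * (1 - gauss_heat t r x))) \<partial>lborel)"
  proof (rule nn_integral_cong)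
    fix r :: real
    show "heat t (\<lambda>z. ennreal (?w r * (1 - exp (- r * (norm z)\<^sup>2))) * indicator {0<..} r) x
        = ennreal (indicator {0<..} r * (?w r * (1 - gauss_heat t r x)))"
      using heat_one_minus_exp_norm_sq[OF t, of r x]
      by (cases "r > 0") (simp_all add: ennreal_mult' heat_cmult heat_const[OF t])
  qed
  also have "\<dots> = ennreal (G * norm x powr \<delta> + gauss_mixture_const TYPE('a) (- \<delta> / 2) * ?J)"
    using has_bochner_integral_one_minus_gauss_heat[OF assms, of x] gauss_heat_le_1[OF t, of _ x]
    by (subst nn_integral_eq_integral) (auto simp: has_bochner_integral_iff indicator_def G_def)
  finally show ?thesis by (simp add: G_def)
qed

lemma has_bochner_integral_gauss_potential:
  assumes t: "t > 0" and \<delta>: "0 < \<delta>" "\<delta> < \<alpha>"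
  shows "has_bochner_integral lborel (\<lambda>r. indicator {0<..} r * (r powr ((\<alpha> - \<delta>) / 2 - 1) * gauss_potential t r x))
    (gauss_mixture_const TYPE('a) ((\<alpha> - \<delta>) / 2) * (LINT \<xi>|lborel. char_defect \<delta> t x \<xi>))"
proof -
  let ?b = "(\<alpha> - \<delta>) / 2" and ?k = "\<lambda>\<xi>. cos (x \<bullet> \<xi>) * ((1 - exp (- t * norm \<xi> powr \<alpha>)) / norm \<xi> powr \<alpha>)"
  have k_eq: "?k \<xi> * norm \<xi> powr (2 * ?b - real DIM('a)) = char_defect \<delta> t x \<xi>" for \<xi>
  proof (cases "\<xi> = 0")
    case False
    have "norm \<xi> powr (2 * ?b - real DIM('a)) = norm \<xi> powr (- \<delta> - real DIM('a)) * norm \<xi> powr \<alpha>"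
      unfolding powr_add[symmetric] by (rule arg_cong[where f="\<lambda>e. norm \<xi> powr e"]) (simp add: field_simps)
    then show ?thesis using False by (simp add: char_defect_def)
  qed (simp add: char_defect_def)
  have "has_bochner_integral lborel (\<lambda>r. indicator {0<..} r * (r powr (?b - 1) * (LINT \<xi>|lborel. gauss r \<xi> * ?k \<xi>)))
      (gauss_mixture_const TYPE('a) ?b * (LINT \<xi>|lborel. char_defect \<delta> t x \<xi>))"
    using has_bochner_integral_gauss_mixture[of ?b ?k] integrable_char_defect[OF assms, of x] \<delta> alpha
    by (simp only: k_eq) auto
  then show ?thesis
    by (rule has_bochner_integral_cong[THEN iffD1, rotated -1]) (auto
        simp: indicator_def gauss_potential_eq_fourier[OF t])
qed

lemma integral_char_defect_nonneg:
  assumes "t > 0" "0 < \<delta>" "\<delta> < \<alpha>"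
  shows "0 \<le> (LINT \<xi>|lborel. char_defect \<delta> t x \<xi>)"
proof -
  have "0 \<le> gauss_mixture_const TYPE('a) ((\<alpha> - \<delta>) / 2) * (LINT \<xi>|lborel. char_defect \<delta> t x \<xi>)"
    using has_bochner_integral_integral_eq[OF has_bochner_integral_gauss_potential[OF assms, of x], symmetric]
    by (simp add: indicator_def)
  moreover have "0 < gauss_mixture_const TYPE('a) ((\<alpha> - \<delta>) / 2)" using assms alpha
    by (intro gauss_mixture_const_pos) simp
  ultimately show ?thesis by (simp add: zero_le_mult_iff)
qed

lemma heat_neg_powr_eq_mixture:
  assumes s: "s > 0" and b: "b > 0"
  shows "ennreal (Gamma b) * heat s (\<lambda>z. ennreal (norm z powr (- 2 * b))) x
    = (\<integral>\<^sup>+r. ennreal (r powr (b - 1)) * indicator {0..} r * ennreal (gauss_heat s r x) \<partial>lborel)"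
proof -
  let ?w = "\<lambda>r. ennreal (r powr (b - 1)) * indicator {0..} r"
  have "AE z in lborel. z \<noteq> (0::'a)" by (rule AE_lborel_singleton)
  then have mixture: "AE z in lborel. ennreal (Gamma b) * ennreal (norm z powr (- 2 * b))
      = (\<integral>\<^sup>+r. ?w r * ennreal (exp (- r * (norm (z::'a))\<^sup>2)) \<partial>lborel)"
  proof eventually_elim
    case (elim z)
    have "((norm z)\<^sup>2) powr (- b) = norm z powr (- 2 * b)" using elim by (simp add: powr_powr flip: powr_numeral)
    then have "ennreal (Gamma b) * ennreal (norm z powr (- 2 * b))
        = (\<integral>\<^sup>+r\<in>{0..}. ennreal (r powr (b - 1) * exp (- ((norm z)\<^sup>2 * r))) \<partial>lborel)"
      using nn_integral_Gamma_scaled[OF b, of "(norm z)\<^sup>2"] elim b by (simp add: ennreal_mult)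
    also have "\<dots> = (\<integral>\<^sup>+r. ?w r * ennreal (exp (- r * (norm z)\<^sup>2)) \<partial>lborel)"
      by (rule nn_integral_cong) (simp add: ennreal_mult mult_ac)
    finally show ?case .
  qed
  have "ennreal (Gamma b) * heat s (\<lambda>z. ennreal (norm z powr (- 2 * b))) x
      = heat s (\<lambda>z. ennreal (Gamma b) * ennreal (norm z powr (- 2 * b))) x" by (simp add: heat_cmult)
  also have "\<dots> = heat s (\<lambda>z. \<integral>\<^sup>+r. ?w r * ennreal (exp (- r * (norm z)\<^sup>2)) \<partial>lborel) x"
    by (rule heat_cong_AE[OF mixture])
  also have "\<dots> = (\<integral>\<^sup>+r. heat s (\<lambda>z. ?w r * ennreal (exp (- r * (norm z)\<^sup>2))) x \<partial>lborel)"
    by (rule heat_nn_integral) measurable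
  also have "\<dots> = (\<integral>\<^sup>+r. ?w r * ennreal (gauss_heat s r x) \<partial>lborel)"
    using heat_exp_norm_sq[OF s] by (intro nn_integral_cong) (auto simp: heat_cmult indicator_def heat_const[OF s])
  finally show ?thesis .
qed

lemma nn_integral_heat_neg_powr_eq_fourier:
  assumes t: "t > 0" and \<delta>: "0 < \<delta>" "\<delta> < \<alpha>"
  shows "ennreal (Gamma ((\<alpha> - \<delta>) / 2)) * (\<integral>\<^sup>+s\<in>{0..t}. heat s (\<lambda>z. ennreal (norm z powr (\<delta> - \<alpha>))) x \<partial>lborel)
    = ennreal (gauss_mixture_const TYPE('a) ((\<alpha> - \<delta>) / 2) * (LINT \<xi>|lborel. char_defect \<delta> t x \<xi>))"
proof -
  let ?b = "(\<alpha> - \<delta>) / 2"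
  let ?w = "\<lambda>r. ennreal (r powr (?b - 1)) * indicator {0..} r" and ?J = "LINT \<xi>|lborel. char_defect \<delta> t x \<xi>"
  have b: "?b > 0" "- 2 * ?b = \<delta> - \<alpha>" using \<delta> by auto
  have "AE s in lborel. s \<noteq> (0::real)" by (rule AE_lborel_singleton)
  then have "ennreal (Gamma ?b) * (\<integral>\<^sup>+s\<in>{0..t}. heat s (\<lambda>z. ennreal (norm z powr (\<delta> - \<alpha>))) x \<partial>lborel)
      = (\<integral>\<^sup>+s. \<integral>\<^sup>+r. ?w r * (ennreal (gauss_heat s r x) * indicator {0..t} s) \<partial>lborel \<partial>lborel)"
    using heat_neg_powr_eq_mixture[OF _ b(1)] unfolding b(2)
    by (subst nn_integral_cmult[symmetric], measurable, intro nn_integral_cong_AE)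
       (auto elim!: eventually_mono simp: indicator_def)
  also have "\<dots> = (\<integral>\<^sup>+r. \<integral>\<^sup>+s. ?w r * (ennreal (gauss_heat s r x) * indicator {0..t} s) \<partial>lborel \<partial>lborel)"
    by (rule lborel_pair.Fubini') measurable
  also have "\<dots> = (\<integral>\<^sup>+r. ennreal (indicator {0<..} r * (r powr (?b - 1) * gauss_potential t r x)) \<partial>lborel)"
  proof (rule nn_integral_cong)
    fix r :: real
    show "(\<integral>\<^sup>+s. ?w r * (ennreal (gauss_heat s r x) * indicator {0..t} s) \<partial>lborel)
        = ennreal (indicator {0<..} r * (r powr (?b - 1) * gauss_potential t r x))"
      by (cases "r = 0"; cases "r > 0") (simp_all add: nn_integral_cmult nn_integral_gauss_heat ennreal_mult)
  qed
  also have "\<dots> = ennreal (gauss_mixture_const TYPE('a) ?b * ?J)"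
    using has_bochner_integral_gauss_potential[OF assms, of x]
    by (subst nn_integral_eq_integral) (auto simp: has_bochner_integral_iff indicator_def)
  finally show ?thesis .
qed

lemma kappa_neg:
  assumes "0 < \<delta>" "\<delta> < \<alpha>"
  shows "kappa DIM('a) \<alpha> \<delta> < 0"
proof -
  have "Gamma (- \<delta> / 2) < 0" using Gamma_minus_neg[of "\<delta> / 2"] assms alpha by simp
  moreover have "Gamma ((real DIM('a) + \<delta> - \<alpha>) / 2) > 0" "Gamma ((real DIM('a) + \<delta>) / 2) > 0" "Gamma ((\<alpha> - \<delta>) / 2) > 0"
    using assms alpha by simp_all
  ultimately show ?thesis unfolding kappa_def by (intro divide_pos_neg mult_pos_pos mult_neg_pos) auto
qed

lemma gauss_mixture_const_eq_kappa:
  assumes "0 < \<delta>" "\<delta> < \<alpha>"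
  shows "gauss_mixture_const TYPE('a) (- \<delta> / 2) * Gamma ((\<alpha> - \<delta>) / 2)
    = - Gamma (- \<delta> / 2) * (- kappa DIM('a) \<alpha> \<delta>) * gauss_mixture_const TYPE('a) ((\<alpha> - \<delta>) / 2)"
proof -
  have "Gamma (- \<delta> / 2) < 0" using Gamma_minus_neg[of "\<delta> / 2"] assms alpha by simp
  moreover have "Gamma ((real DIM('a) + \<delta> - \<alpha>) / 2) > 0" using assms alpha by simp
  moreover have "gauss_mixture_const TYPE('a) (- \<delta> / 2)
      = (4 * pi) powr (- real DIM('a) / 2) * Gamma ((real DIM('a) + \<delta>) / 2) * 2 powr (real DIM('a) + \<delta>)"
    by (simp add: gauss_mixture_const_def add_divide_distrib)
  moreover have "gauss_mixture_const TYPE('a) ((\<alpha> - \<delta>) / 2)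
      = (4 * pi) powr (- real DIM('a) / 2) * Gamma ((real DIM('a) + \<delta> - \<alpha>) / 2) * (2 powr (real DIM('a)
          + \<delta>) / 2 powr \<alpha>)"
    by (simp add: gauss_mixture_const_def diff_divide_distrib add_divide_distrib algebra_simps flip: powr_diff)
  ultimately show ?thesis unfolding kappa_def by simp
qed

theorem heat_powr_eq:
  assumes t: "t > 0" and \<delta>: "0 < \<delta>" "\<delta> < \<alpha>"
  shows "heat t (\<lambda>z. ennreal (norm z powr \<delta>)) x = ennreal (norm x powr \<delta>)
    + ennreal (- kappa DIM('a) \<alpha> \<delta>) * (\<integral>\<^sup>+s\<in>{0<..<t}. heat s (\<lambda>z. ennreal (norm z powr (\<delta> - \<alpha>))) x \<partial>lborel)"
    (is "?P = _ + ennreal ?c * ?I")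
proof -
  define G where "G = - Gamma (- \<delta> / 2)"
  define H where "H = Gamma ((\<alpha> - \<delta>) / 2)"
  define c where "c = - kappa DIM('a) \<alpha> \<delta>"
  define A where "A = gauss_mixture_const TYPE('a) (- \<delta> / 2)"
  define B where "B = gauss_mixture_const TYPE('a) ((\<alpha> - \<delta>) / 2)"
  define J where "J = (LINT \<xi>|lborel. char_defect \<delta> t x \<xi>)"
  have pos: "G > 0" "H > 0" "c > 0" "B > 0"
    using Gamma_minus_neg[of "\<delta> / 2"] kappa_neg[OF \<delta>] \<delta> alpha
    by (auto simp: G_def H_def c_def B_def intro!: gauss_mixture_const_pos)
  have J: "J \<ge> 0" unfolding J_def by (rule integral_char_defect_nonneg[OF assms])
  have "ennreal H * (ennreal G * ?P) = ennreal H * ennreal (G * norm x powr \<delta> + A * J)"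
    unfolding G_def A_def J_def heat_powr_eq_fourier[OF assms] ..
  also have "\<dots> = ennreal (H * (G * norm x powr \<delta>) + A * H * J)"
    using pos by (simp add: algebra_simps flip: ennreal_mult')
  also have "A * H = G * c * B" unfolding A_def H_def G_def c_def B_def by (rule gauss_mixture_const_eq_kappa[OF \<delta>])
  also have "ennreal (H * (G * norm x powr \<delta>) + G * c * B * J)
      = ennreal H * (ennreal G * ennreal (norm x powr \<delta>)) + ennreal G * ennreal c * ennreal (B * J)"
    using pos J by (simp add: ennreal_mult mult.assoc)
  also have "ennreal (B * J) = ennreal H * ?I"
    unfolding B_def J_def H_def nn_integral_heat_neg_powr_eq_fourier[OF assms, symmetric] nn_integral_Icc_eq_Ioo ..
  also have "ennreal H * (ennreal G * ennreal (norm x powr \<delta>)) + ennreal G * ennreal c * (ennreal H * ?I)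
      = ennreal H * (ennreal G * (ennreal (norm x powr \<delta>) + ennreal c * ?I))"
    by (simp only: distrib_left mult_ac)
  finally show ?thesis using pos by (simp add: c_def ennreal_mult_cancel_left)
qed

end

section \<open>Path integrals of the stable process\<close>

definition next_grid :: "nat \<Rightarrow> real \<Rightarrow> real" where
  "next_grid n s = (real_of_int \<lfloor>s * real (Suc n)\<rfloor> + 1) / real (Suc n)"

lemma next_grid_at_right: "filterlim (\<lambda>n. next_grid n s) (at_right s) sequentially"
proof (rule tendsto_imp_filterlim_at_right)
  have greater: "s < next_grid n s" for n
    using floor_correct[of "s * real (Suc n)"] by (simp add: next_grid_def field_simps)
  then show "\<forall>\<^sub>F n in sequentially. s < next_grid n s" by simp
  have close: "next_grid n s \<le> s + 1 / real (Suc n)" for n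
  proof -
    have "next_grid n s \<le> (s * real (Suc n) + 1) / real (Suc n)"
      unfolding next_grid_def by (intro divide_right_mono add_right_mono of_int_floor_le) simp
    then show ?thesis by (simp add: add_divide_distrib del: of_nat_Suc)
  qed
  have "(\<lambda>n. s + 1 / real (Suc n)) \<longlonglongrightarrow> s + 0"
    using LIMSEQ_inverse_real_of_nat by (intro tendsto_intros) (simp add: inverse_eq_divide)
  then have upper: "(\<lambda>n. s + 1 / real (Suc n)) \<longlonglongrightarrow> s" by simp
  show "(\<lambda>n. next_grid n s) \<longlonglongrightarrow> s"
    by (rule tendsto_sandwich[OF _ _ tendsto_const upper])
      (use less_imp_le[OF greater] close in \<open>simp_all del: of_nat_Suc\<close>)
qed

lemma right_continuous_process_measurable:
  fixes X :: "real \<Rightarrow> 'b \<Rightarrow> 'a::{metric_space, second_countable_topology}"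
  assumes [measurable]: "\<And>t. X t \<in> borel_measurable M"
    and right_continuous: "\<And>\<omega> s. \<omega> \<in> space M \<Longrightarrow> continuous (at_right s) (\<lambda>r. X r \<omega>)"
  shows "(\<lambda>(s, \<omega>). X s \<omega>) \<in> borel_measurable (borel \<Otimes>\<^sub>M M)"
proof (rule borel_measurable_LIMSEQ_metric[where f="\<lambda>n (s, \<omega>). X (next_grid n s) \<omega>"])
  fix n
  have floor: "(\<lambda>y. \<lfloor>fst y * real (Suc n)\<rfloor>) \<in> borel \<Otimes>\<^sub>M M \<rightarrow>\<^sub>M count_space UNIV"
    by measurable
  have "(\<lambda>y. X ((real_of_int i + 1) / real (Suc n)) (snd y)) \<in> borel_measurable (borel \<Otimes>\<^sub>M M)" for i :: int
    by measurable
  from measurable_compose_countable[OF this floor]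
  show "(\<lambda>(s, \<omega>). X (next_grid n s) \<omega>) \<in> borel_measurable (borel \<Otimes>\<^sub>M M)"
    by (simp add: next_grid_def case_prod_beta)
next
  fix y assume "y \<in> space ((borel :: real measure) \<Otimes>\<^sub>M M)"
  then obtain s \<omega> where y: "y = (s, \<omega>)" "\<omega> \<in> space M" by (auto simp: space_pair_measure)
  then have "((\<lambda>r. X r \<omega>) \<longlongrightarrow> X s \<omega>) (at_right s)"
    using right_continuous[of \<omega> s] by (simp add: continuous_within)
  then show "(\<lambda>n. (case y of (s, \<omega>) \<Rightarrow> X (next_grid n s) \<omega>)) \<longlonglongrightarrow> (case y of (s, \<omega>) \<Rightarrow> X s \<omega>)"
    unfolding y prod.case using next_grid_at_right by (rule filterlim_compose)
qed

definition exp_neg :: "ennreal \<Rightarrow> real" where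
  "exp_neg I = (if I = \<infinity> then 0 else exp (- enn2real I))"

lemma exp_neg_nonneg [simp]: "0 \<le> exp_neg I"
  by (simp add: exp_neg_def)

lemma exp_neg_le_1 [simp]: "exp_neg I \<le> 1"
  by (simp add: exp_neg_def)

lemma measurable_exp_neg [measurable]: "exp_neg \<in> borel_measurable borel"
  unfolding exp_neg_def[abs_def] by measurable

lemma exp_neg_tangent:
  assumes a: "a \<ge> 0"
  shows "ennreal (exp (- a) * (1 + a)) \<le> ennreal (exp_neg I) + ennreal (exp (- a)) * I"
proof (cases I)
  case (real J)
  have "1 + a - J \<le> exp (a - J)" using exp_ge_add_one_self[of "a - J"] by linarith
  then have "exp (- a) * (1 + a - J) \<le> exp (- a) * exp (a - J)" by (intro mult_left_mono) auto
  also have "\<dots> = exp (- J)" by (simp flip: exp_add)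
  finally have "exp (- a) * (1 + a) \<le> exp (- J) + exp (- a) * J" by (simp add: algebra_simps)
  then show ?thesis using real a by (simp add: exp_neg_def flip: ennreal_mult ennreal_plus)
qed (simp add: ennreal_mult_top)

lemma one_le_exp_neg_add: "1 \<le> ennreal (exp_neg I) + I"
  using exp_neg_tangent[of 0 I] by simp

lemma add_exp_neg_le:
  assumes J: "J \<ge> 0" "ennreal J \<le> I"
  shows "ennreal J + ennreal (exp_neg I) \<le> 1 + ennreal (J\<^sup>2)"
proof -
  have "exp_neg I \<le> exp (- J)"
  proof (cases I)
    case (real K)
    then show ?thesis using J by (simp add: exp_neg_def)
  qed (simp add: exp_neg_def)
  also have "\<dots> \<le> 1 / (1 + J)"
    using exp_ge_add_one_self[of J] J by (simp add: exp_minus inverse_eq_divide divide_le_cancel frac_le)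
  also have "\<dots> \<le> 1 - J + J\<^sup>2"
  proof -
    have "1 \<le> (1 - J + J\<^sup>2) * (1 + J)" using J by (simp add: algebra_simps power2_eq_square)
    then show ?thesis using J by (simp add: pos_divide_le_eq)
  qed
  finally have "J + exp_neg I \<le> 1 + J\<^sup>2" by simp
  then show ?thesis using J by (simp add: ennreal_leI flip: ennreal_plus ennreal_1)
qed

locale stable_process = stable_kernel \<alpha> C0 p
  for \<alpha> C0 :: real and p :: "real \<Rightarrow> 'a::euclidean_space \<Rightarrow> real" +
  fixes M :: "'b measure" and X :: "real \<Rightarrow> 'b \<Rightarrow> 'a"
  assumes process: "is_stable_process M \<alpha> X"
begin

sublocale M: prob_space M
  using process by (simp add: is_stable_process_def)

lemma measurable_X [measurable]: "X t \<in> borel_measurable M"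
  using process by (simp add: is_stable_process_def)

lemma X_0: "\<omega> \<in> space M \<Longrightarrow> X 0 \<omega> = 0"
  using process by (simp add: is_stable_process_def)

lemma jointly_measurable_X [measurable]: "(\<lambda>(s, \<omega>). X s \<omega>) \<in> borel_measurable (borel \<Otimes>\<^sub>M M)"
  using process by (intro right_continuous_process_measurable) (auto simp: is_stable_process_def)

definition law :: "real \<Rightarrow> 'a measure" where
  "law t = density lborel (\<lambda>y. ennreal (p t y))"

lemma sets_law [measurable_cong, simp]: "sets (law t) = sets borel"
  by (simp add: law_def)

lemma nn_integral_law:
  "f \<in> borel_measurable borel \<Longrightarrow> (\<integral>\<^sup>+y. f y \<partial>law t) = (\<integral>\<^sup>+y. ennreal (p t y) * f y \<partial>lborel)"
  unfolding law_def by (subst nn_integral_density) auto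

lemma finite_measure_law: "t > 0 \<Longrightarrow> finite_measure (law t)"
  by (intro finite_measureI) (simp add: law_def emeasure_density nn_integral_p)

lemma distr_increment:
  assumes "0 \<le> s" "s < t"
  shows "distr M borel (\<lambda>\<omega>. X t \<omega> - X s \<omega>) = law (t - s)"
proof (rule finite_measure_eqI_char)
  have time: "t - s > 0" using assms by simp
  then show "finite_measure (law (t - s))" by (rule finite_measure_law)
  show "finite_measure (distr M borel (\<lambda>\<omega>. X t \<omega> - X s \<omega>))"
    by (intro prob_space.finite_measure M.prob_space_distr) measurable
  fix \<xi> :: 'a
  have "(LINT y|distr M borel (\<lambda>\<omega>. X t \<omega> - X s \<omega>). cis (\<xi> \<bullet> y)) = (LINT \<omega>|M. cis (\<xi> \<bullet> (X t \<omega> - X s \<omega>)))"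
    unfolding cis_conv_exp by (rule integral_distr) measurable
  also have "\<dots> = exp (- (t - s) * norm \<xi> powr \<alpha>)"
    using process assms by (simp add: is_stable_process_def)
  also have "\<dots> = (LINT y|lborel. complex_of_real (p (t - s) y) * cis (\<xi> \<bullet> y))" by (rule char_p[OF time, symmetric])
  also have "\<dots> = (LINT y|law (t - s). cis (\<xi> \<bullet> y))"
    unfolding cis_conv_exp law_def by (subst integral_density) (auto simp: scaleR_conv_of_real)
  finally show "(LINT y|distr M borel (\<lambda>\<omega>. X t \<omega> - X s \<omega>). cis (\<xi> \<bullet> y)) = (LINT y|law (t - s). cis (\<xi> \<bullet> y))" .
qed auto

lemma distr_X: "t > 0 \<Longrightarrow> distr M borel (X t) = law t"
  using distr_increment[of 0 t] distr_cong[of M M borel borel "\<lambda>\<omega>. X t \<omega> - X 0 \<omega>" "X t"] by (simp add: X_0)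

lemma nn_integral_X:
  assumes "t > 0" and [measurable]: "f \<in> borel_measurable borel"
  shows "(\<integral>\<^sup>+\<omega>. f (x + X t \<omega>) \<partial>M) = heat t f x"
proof -
  have "(\<integral>\<^sup>+\<omega>. f (x + X t \<omega>) \<partial>M) = (\<integral>\<^sup>+y. f (x + y) \<partial>distr M borel (X t))"
    by (subst nn_integral_distr) auto
  then show ?thesis by (simp add: distr_X[OF assms(1)] nn_integral_law heat_shift)
qed

lemma distr_X_increment:
  assumes "0 < s" "s < t"
  shows "distr M (borel \<Otimes>\<^sub>M borel) (\<lambda>\<omega>. (X s \<omega>, X t \<omega> - X s \<omega>)) = law s \<Otimes>\<^sub>M law (t - s)"
proof -
  define \<tau> :: "nat \<Rightarrow> real" where "\<tau> i = (if i = 0 then 0 else if i = 1 then s else t)" for i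
  let ?D = "\<lambda>i \<omega>. X (\<tau> (Suc i)) \<omega> - X (\<tau> i) \<omega>"
  have "0 \<le> \<tau> 0 \<longrightarrow> (\<forall>i<2. \<tau> i < \<tau> (Suc i)) \<longrightarrow> M.indep_vars (\<lambda>_. borel) ?D {..<2}"
    using process unfolding is_stable_process_def by blast
  moreover have "0 \<le> \<tau> 0" "\<forall>i<2. \<tau> i < \<tau> (Suc i)" using assms by (auto simp: \<tau>_def less_2_cases_iff)
  ultimately have "M.indep_vars (\<lambda>_. borel) ?D {..<2}" by blast
  from M.indep_var_restrict[OF this, of "{0}" "{1}"]
  have "M.indep_var (PiM {0} (\<lambda>_. borel)) (\<lambda>\<omega>. restrict (\<lambda>i. ?D i \<omega>) {0})
      (PiM {1} (\<lambda>_. borel)) (\<lambda>\<omega>. restrict (\<lambda>i. ?D i \<omega>) {1})"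
    by auto
  then have "M.indep_var borel ((\<lambda>f. f 0) \<circ> (\<lambda>\<omega>. restrict (\<lambda>i. ?D i \<omega>) {0}))
      borel ((\<lambda>f. f 1) \<circ> (\<lambda>\<omega>. restrict (\<lambda>i. ?D i \<omega>) {1}))"
    by (rule M.indep_var_compose) measurable
  then have "M.indep_var borel (\<lambda>\<omega>. X s \<omega> - X 0 \<omega>) borel (\<lambda>\<omega>. X t \<omega> - X s \<omega>)"
    by (simp add: comp_def \<tau>_def)
  then have "distr M borel (\<lambda>\<omega>. X s \<omega> - X 0 \<omega>) \<Otimes>\<^sub>M distr M borel (\<lambda>\<omega>. X t \<omega> - X s \<omega>)
      = distr M (borel \<Otimes>\<^sub>M borel) (\<lambda>\<omega>. (X s \<omega> - X 0 \<omega>, X t \<omega> - X s \<omega>))"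
    unfolding M.indep_var_distribution_eq by blast
  also have "\<dots> = distr M (borel \<Otimes>\<^sub>M borel) (\<lambda>\<omega>. (X s \<omega>, X t \<omega> - X s \<omega>))"
    by (rule distr_cong) (auto simp: X_0)
  finally show ?thesis using distr_increment[of 0 s] distr_increment[of s t] assms by simp
qed

lemma nn_integral_X_two_times:
  assumes times: "0 < s" "s < t" and [measurable]: "f \<in> borel_measurable borel" "g \<in> borel_measurable borel"
  shows "(\<integral>\<^sup>+\<omega>. f (x + X s \<omega>) * g (x + X t \<omega>) \<partial>M) = heat s (\<lambda>z. f z * heat (t - s) g z) x"
proof -
  interpret future: sigma_finite_measure "law (t - s)"
    using times by (intro finite_measure.sigma_finite_measure finite_measure_law) simp
  have "(\<integral>\<^sup>+\<omega>. f (x + X s \<omega>) * g (x + X t \<omega>) \<partial>M)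
      = (\<integral>\<^sup>+\<omega>. (\<lambda>(z, w). f (x + z) * g ((x + z) + w)) (X s \<omega>, X t \<omega> - X s \<omega>) \<partial>M)"
    by simp
  also have "\<dots> = (\<integral>\<^sup>+v. (\<lambda>(z, w). f (x + z) * g ((x + z) + w)) v \<partial>distr M (borel \<Otimes>\<^sub>M borel) (\<lambda>\<omega>. (X s \<omega>, X t \<omega> - X s \<omega>)))"
    by (rule nn_integral_distr[symmetric]) measurable
  also have "\<dots> = (\<integral>\<^sup>+z. \<integral>\<^sup>+w. f (x + z) * g ((x + z) + w) \<partial>law (t - s) \<partial>law s)"
    unfolding distr_X_increment[OF times] by (subst future.nn_integral_fst[symmetric]) auto
  also have "\<dots> = (\<integral>\<^sup>+z. f (x + z) * heat (t - s) g (x + z) \<partial>law s)"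
    by (simp add: nn_integral_cmult nn_integral_law heat_shift)
  also have "\<dots> = heat s (\<lambda>z. f z * heat (t - s) g z) x"
    by (simp add: nn_integral_law heat_shift)
  finally show ?thesis .
qed

definition path_integral :: "('a \<Rightarrow> ennreal) \<Rightarrow> real \<Rightarrow> 'a \<Rightarrow> 'b \<Rightarrow> ennreal" where
  "path_integral V t x \<omega> = (\<integral>\<^sup>+s\<in>{0..t}. V (x + X s \<omega>) \<partial>lborel)"

lemma measurable_path_integral [measurable]:
  assumes [measurable]: "V \<in> borel_measurable borel"
  shows "path_integral V t x \<in> borel_measurable M"
proof -
  have "(\<lambda>\<omega>. \<integral>\<^sup>+s. (\<lambda>(s, \<omega>). V (x + (\<lambda>(s, \<omega>). X s \<omega>) (s, \<omega>)) * indicator {0..t} s) (s, \<omega>) \<partial>lborel) \<in> borel_measurable M"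
    by measurable
  then show ?thesis by (simp add: path_integral_def[abs_def])
qed

lemma path_integral_mono: "(\<And>z. V z \<le> V' z) \<Longrightarrow> path_integral V t x \<omega> \<le> path_integral V' t x \<omega>"
  unfolding path_integral_def by (intro nn_integral_mono mult_right_mono) auto

lemma path_integral_le:
  assumes "t \<ge> 0" "\<And>z. V z \<le> b"
  shows "path_integral V t x \<omega> \<le> b * ennreal t"
proof -
  have "path_integral V t x \<omega> \<le> (\<integral>\<^sup>+s\<in>{0..t}. b \<partial>lborel)"
    unfolding path_integral_def by (intro nn_integral_mono mult_right_mono assms) auto
  then show ?thesis using assms(1) by (simp add: nn_integral_cmult_indicator)
qed

lemma nn_integral_path_integral:
  assumes [measurable]: "f \<in> borel_measurable borel" "V \<in> borel_measurable borel"
  shows "(\<integral>\<^sup>+\<omega>. f (x + X t \<omega>) * path_integral V t x \<omega> \<partial>M)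
    = (\<integral>\<^sup>+s\<in>{0<..<t}. heat s (\<lambda>z. V z * heat (t - s) f z) x \<partial>lborel)"
proof -
  interpret P: pair_sigma_finite M "lborel :: real measure" ..
  let ?F = "\<lambda>\<omega> s. f (x + X t \<omega>) * (V (x + X s \<omega>) * indicator {0..t} s)"
  have swapped_X [measurable]: "(\<lambda>(\<omega>, s). X s \<omega>) \<in> borel_measurable (M \<Otimes>\<^sub>M borel)"
    using measurable_pair_swap[OF jointly_measurable_X] by (simp add: case_prod_beta)
  have "(\<lambda>(\<omega>, s). f (x + X t \<omega>) * (V (x
      + (\<lambda>(\<omega>, s). X s \<omega>) (\<omega>, s)) * indicator {0..t} s)) \<in> borel_measurable (M \<Otimes>\<^sub>M lborel)"
    by measurable
  then have measurable_F: "(\<lambda>(\<omega>, s). ?F \<omega> s) \<in> borel_measurable (M \<Otimes>\<^sub>M lborel)" by simp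
  have path_measurable: "(\<lambda>s. X s \<omega>) \<in> borel_measurable borel" if "\<omega> \<in> space M" for \<omega>
    using measurable_Pair2[OF swapped_X that] by simp
  have "(\<integral>\<^sup>+\<omega>. f (x + X t \<omega>) * path_integral V t x \<omega> \<partial>M) = (\<integral>\<^sup>+\<omega>. \<integral>\<^sup>+s. ?F \<omega> s \<partial>lborel \<partial>M)"
    unfolding path_integral_def by (intro nn_integral_cong nn_integral_cmult[symmetric])
      (use path_measurable in measurable)
  also have "\<dots> = (\<integral>\<^sup>+s. \<integral>\<^sup>+\<omega>. ?F \<omega> s \<partial>M \<partial>lborel)"
    by (rule P.Fubini'[symmetric, OF measurable_F])
  also have "\<dots> = (\<integral>\<^sup>+s\<in>{0..t}. (\<integral>\<^sup>+\<omega>. V (x + X s \<omega>) * f (x + X t \<omega>) \<partial>M) \<partial>lborel)"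
    by (intro nn_integral_cong) (auto simp: indicator_def mult.commute)
  also have "\<dots> = (\<integral>\<^sup>+s\<in>{0<..<t}. (\<integral>\<^sup>+\<omega>. V (x + X s \<omega>) * f (x + X t \<omega>) \<partial>M) \<partial>lborel)"
    by (rule nn_integral_Icc_eq_Ioo)
  also have "\<dots> = (\<integral>\<^sup>+s\<in>{0<..<t}. heat s (\<lambda>z. V z * heat (t - s) f z) x \<partial>lborel)"
    by (intro set_nn_integral_cong refl) (simp add: nn_integral_X_two_times)
  finally show ?thesis .
qed

lemma nn_integral_path_integral_1:
  assumes [measurable]: "V \<in> borel_measurable borel"
  shows "(\<integral>\<^sup>+\<omega>. path_integral V t x \<omega> \<partial>M) = (\<integral>\<^sup>+s\<in>{0<..<t}. heat s V x \<partial>lborel)"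
proof -
  have "(\<integral>\<^sup>+\<omega>. path_integral V t x \<omega> \<partial>M) = (\<integral>\<^sup>+s\<in>{0<..<t}. heat s (\<lambda>z. V z * heat (t - s) (\<lambda>_. 1) z) x \<partial>lborel)"
    using nn_integral_path_integral[of "\<lambda>_. 1" V x t] by simp
  also have "\<dots> = (\<integral>\<^sup>+s\<in>{0<..<t}. heat s V x \<partial>lborel)"
    by (intro set_nn_integral_cong refl) (simp add: heat_const)
  finally show ?thesis .
qed

end

section \<open>The Feynman-Kac kernel\<close>

lemma (in sigma_finite_measure) AE_le_if_set_nn_integral_le:
  fixes f g :: "'a \<Rightarrow> real"
  assumes f: "integrable M f" "AE x in M. 0 \<le> f x" and g: "integrable M g" "AE x in M. 0 \<le> g x"
    and set_integral_le: "\<And>A. A \<in> sets M \<Longrightarrow> (\<integral>\<^sup>+x\<in>A. ennreal (f x) \<partial>M) \<le> (\<integral>\<^sup>+x\<in>A. ennreal (g x) \<partial>M)"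
  shows "AE x in M. f x \<le> g x"
proof -
  have "AE x in M. 0 \<le> g x - f x"
  proof (rule density_nonneg)
    show "integrable M (\<lambda>x. g x - f x)" using f(1) g(1) by simp
    fix A assume A: "A \<in> sets M"
    have set_integrable: "set_integrable M A f" "set_integrable M A g"
      unfolding set_integrable_def using A f(1) g(1)
      by (auto intro!: integrable_mult_indicator simp del: real_scaleR_def)
    have "0 \<le> (LINT x:A|M. g x)"
      unfolding set_lebesgue_integral_def using g(2) by (intro integral_nonneg_AE) (auto elim!: eventually_mono)
    moreover have "(\<integral>\<^sup>+x\<in>A. ennreal (h x) \<partial>M) = ennreal (LINT x:A|M. h x)"
      if "integrable M h" "AE x in M. 0 \<le> h x" for h :: "'a \<Rightarrow> real"
      by (rule nn_set_integral_eq_set_integral) (use that A in auto)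
    from this[OF f] this[OF g] have "ennreal (LINT x:A|M. f x) \<le> ennreal (LINT x:A|M. g x)" using set_integral_le[OF A] by simp
    ultimately show "0 \<le> (LINT x:A|M. g x - f x)" using set_integrable by (simp add: set_integral_diff)
  qed
  then show ?thesis by simp
qed

locale fk_kernel = stable_process \<alpha> C0 p M X
  for \<alpha> C0 :: real and p :: "real \<Rightarrow> 'a::euclidean_space \<Rightarrow> real" and M :: "'b measure" and X :: "real \<Rightarrow> 'b \<Rightarrow> 'a" +
  fixes \<delta> :: real and pt :: "real \<Rightarrow> 'a \<Rightarrow> 'a \<Rightarrow> real"
  assumes delta: "0 < \<delta>" "\<delta> < \<alpha>"
    and kernel: "is_FK_heat_kernel M (kappa DIM('a) \<alpha> \<delta>) \<alpha> X pt"
begin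

definition coupling :: real where
  "coupling = - kappa DIM('a) \<alpha> \<delta>"

lemma coupling_pos: "coupling > 0"
  using kappa_neg[OF delta] by (simp add: coupling_def)

definition potential :: "'a \<Rightarrow> ennreal" where
  "potential z = ennreal (coupling * norm z powr (- \<alpha>))"

lemma measurable_potential [measurable]: "potential \<in> borel_measurable borel"
  unfolding potential_def[abs_def] by measurable

definition weight :: "real \<Rightarrow> 'a \<Rightarrow> 'b \<Rightarrow> real" where
  "weight t x \<omega> = exp_neg (path_integral potential t x \<omega>)"

lemma measurable_weight [measurable]: "weight t x \<in> borel_measurable M"
  unfolding weight_def[abs_def] by measurable

lemma weight_nonneg [simp]: "0 \<le> weight t x \<omega>"
  by (simp add: weight_def)

lemma weight_le_1 [simp]: "weight t x \<omega> \<le> 1"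
  by (simp add: weight_def)

lemma FK_weight_eq: "FK_weight (kappa DIM('a) \<alpha> \<delta>) \<alpha> X t x \<omega> = weight t x \<omega>"
  by (simp add: FK_weight_def weight_def exp_neg_def path_integral_def potential_def coupling_def Let_def)

lemma pt_commute: "t > 0 \<Longrightarrow> pt t x y = pt t y x"
  and pt_0_left [simp]: "t > 0 \<Longrightarrow> pt t 0 y = 0"
  and pt_0_right [simp]: "t > 0 \<Longrightarrow> pt t x 0 = 0"
  and integrable_pt_mult_pt: "s > 0 \<Longrightarrow> t > 0 \<Longrightarrow> integrable lborel (\<lambda>z. pt s x z * pt t z y)"
  and pt_add: "s > 0 \<Longrightarrow> t > 0 \<Longrightarrow> pt (s + t) x y = (LINT z|lborel. pt s x z * pt t z y)"
  and integrable_pt_mult: "f \<in> C_infty_punctured \<Longrightarrow> t > 0 \<Longrightarrow> x \<noteq> 0 \<Longrightarrow> integrable lborel (\<lambda>y. pt t x y * f y)"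
  and integral_pt_mult: "f \<in> C_infty_punctured \<Longrightarrow> t > 0 \<Longrightarrow> x \<noteq> 0 \<Longrightarrow>
    (LINT y|lborel. pt t x y * f y) = (LINT \<omega>|M. f (x + X t \<omega>) * weight t x \<omega>)"
  using kernel unfolding is_FK_heat_kernel_def FK_weight_eq by blast+

text \<open>Multiplication by \<open>taper\<close> turns bounded continuous functions into members of \<^const>\<open>C_infty_punctured\<close>,
  the only test functions for which the kernel is known to represent the Feynman-Kac expectation.\<close>

definition taper :: "'a \<Rightarrow> real" where
  "taper y = norm y / (1 + (norm y)\<^sup>2)"

lemma taper_nonneg [simp]: "0 \<le> taper y"
  by (simp add: taper_def)

lemma taper_0 [simp]: "taper 0 = 0"
  by (simp add: taper_def)

lemma taper_pos: "y \<noteq> 0 \<Longrightarrow> 0 < taper y"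
  by (simp add: taper_def add_pos_nonneg)

lemma taper_le_inverse_norm: "taper y \<le> 1 / norm y"
  by (cases "y = 0") (simp_all add: taper_def divide_simps add_pos_nonneg power2_eq_square)

lemma taper_le_1: "taper y \<le> 1"
  using sum_squares_bound[of "norm y" 1] norm_ge_zero[of y]
  by (simp add: taper_def divide_le_eq add_pos_nonneg del: norm_ge_zero)

lemma continuous_taper: "continuous_on UNIV taper"
proof -
  have "1 + (norm y)\<^sup>2 \<noteq> 0" for y :: 'a using zero_le_power2[of "norm y"] by linarith
  then show ?thesis unfolding taper_def[abs_def] by (intro continuous_intros) auto
qed

lemma measurable_taper [measurable]: "taper \<in> borel_measurable borel"
  using continuous_taper by (rule borel_measurable_continuous_onI)

lemma taper_mult_in_C_infty_punctured:
  assumes f: "continuous_on UNIV f" "\<And>y. 0 \<le> f y" "\<And>y. f y \<le> 1"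
  shows "(\<lambda>y. taper y * f y) \<in> C_infty_punctured"
proof -
  have continuous: "continuous_on UNIV (\<lambda>y. taper y * f y)" using f(1) continuous_taper by (intro continuous_intros)
  then have "((\<lambda>y. taper y * f y) \<longlongrightarrow> 0) (at 0)"
    using continuous[unfolded continuous_on_def, rule_format, of 0] by simp
  moreover have "((\<lambda>y. taper y * f y) \<longlongrightarrow> 0) at_infinity"
  proof (rule Lim_null_comparison)
    have "norm (taper y * f y) \<le> 1 / norm y" for y
      using mult_mono[OF taper_le_inverse_norm[of y] f(3)[of y]] f(2)[of y] by (simp add: abs_mult)
    then show "\<forall>\<^sub>F y in at_infinity. norm (taper y * f y) \<le> 1 / norm y" by simp
    show "((\<lambda>y::'a. 1 / norm y) \<longlongrightarrow> 0) at_infinity"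
      by (rule tendsto_divide_0[OF tendsto_const filterlim_at_top_imp_at_infinity[OF filterlim_norm_at_top]])
  qed
  ultimately show ?thesis using continuous_on_subset[OF continuous] by (simp add: C_infty_punctured_def)
qed

lemma measurable_pt:
  assumes t: "t > 0"
  shows "pt t x \<in> borel_measurable borel"
proof (cases "x = 0")
  case True
  then have "pt t x = (\<lambda>_. 0)" using t by auto
  then show ?thesis by simp
next
  case False
  have "integrable lborel (\<lambda>y. pt t x y * (taper y * 1))"
    by (intro integrable_pt_mult[OF taper_mult_in_C_infty_punctured t False]) auto
  then have [measurable]: "(\<lambda>y. pt t x y * taper y) \<in> borel_measurable borel" by simp
  have "pt t x y = (pt t x y * taper y) / taper y" for y
    using taper_pos[of y] t by (cases "y = 0") auto
  then have "pt t x = (\<lambda>y. (pt t x y * taper y) / taper y)" ..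
  also have "\<dots> \<in> borel_measurable borel" by measurable
  finally show ?thesis .
qed

lemma tapered_kernel_eq:
  assumes t: "t > 0" and x: "x \<noteq> 0" and f: "continuous_on UNIV f" "\<And>y. 0 \<le> f y" "\<And>y. f y \<le> 1"
  shows "(LINT y|lborel. pt t x y * taper y * f y) = (LINT \<omega>|M. taper (x + X t \<omega>) * weight t x \<omega> * f (x + X t \<omega>))"
  using integral_pt_mult[OF taper_mult_in_C_infty_punctured[OF f] t x] by (simp add: mult_ac)

lemma integrable_tapered:
  assumes "t > 0" "x \<noteq> 0"
  shows "integrable lborel (\<lambda>y. pt t x y * taper y)" "integrable M (\<lambda>\<omega>. taper (x + X t \<omega>) * weight t x \<omega>)"
proof -
  show "integrable lborel (\<lambda>y. pt t x y * taper y)"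
    using integrable_pt_mult[OF taper_mult_in_C_infty_punctured[of "\<lambda>_. 1"] assms] by simp
  show "integrable M (\<lambda>\<omega>. taper (x + X t \<omega>) * weight t x \<omega>)"
    by (rule M.integrable_const_bound[where B=1]) (auto simp: abs_mult intro!: mult_le_one taper_le_1)
qed

lemma pt_AE_nonneg:
  assumes t: "t > 0"
  shows "AE y in lborel. 0 \<le> pt t x y"
proof (cases "x = 0")
  case False
  have "AE y in lborel. 0 \<le> pt t x y * taper y"
    by (rule weight_AE_nonneg[OF _ integrable_tapered[OF t False] _ tapered_kernel_eq[OF t False]])
       (auto intro: lborel.sigma_finite_measure_axioms)
  moreover have "AE y in lborel. y \<noteq> (0::'a)" by (rule AE_lborel_singleton)
  ultimately show ?thesis by eventually_elim
    (use taper_pos in \<open>auto simp: zero_le_mult_iff dest: less_le_not_le[THEN iffD1]\<close>)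
qed (use t in simp)

definition killed :: "real \<Rightarrow> ('a \<Rightarrow> ennreal) \<Rightarrow> 'a \<Rightarrow> ennreal" where
  "killed t f x = (\<integral>\<^sup>+y. ennreal (pt t x y) * f y \<partial>lborel)"

lemma killed_eq_expectation:
  assumes t: "t > 0" and x: "x \<noteq> 0" and [measurable]: "f \<in> borel_measurable borel"
  shows "killed t f x = (\<integral>\<^sup>+\<omega>. f (x + X t \<omega>) * ennreal (weight t x \<omega>) \<partial>M)"
proof -
  note [measurable] = measurable_pt[OF t]
  have untaper: "ennreal (taper y) * ennreal (1 / taper y) = 1" if "y \<noteq> 0" for y
    using taper_pos[OF that] by (simp flip: ennreal_mult)
  have nonzero: "AE y in lborel. y \<noteq> (0::'a)" "AE \<omega> in M. x + X t \<omega> \<noteq> 0"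
  proof -
    have "AE y in law t. x + y \<noteq> 0"
      unfolding law_def using AE_lborel_singleton[of "- x"]
      by (subst AE_density, measurable) (auto simp: add_eq_0_iff2 elim!: eventually_mono)
    then show "AE \<omega> in M. x + X t \<omega> \<noteq> 0" unfolding distr_X[OF t, symmetric] by (subst (asm) AE_distr_iff) auto
  qed (rule AE_lborel_singleton)
  have "AE y in lborel. ennreal (pt t x y) * f y = ennreal (pt t x y * taper y) * (ennreal (1 / taper y) * f y)"
    using nonzero(1) pt_AE_nonneg[OF t, of x]
    by eventually_elim (simp add: ennreal_mult mult.assoc[symmetric], simp add: mult.assoc untaper)
  then have "killed t f x = (\<integral>\<^sup>+y. ennreal (pt t x y * taper y) * (ennreal (1 / taper y) * f y) \<partial>lborel)"
    unfolding killed_def by (rule nn_integral_cong_AE)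
  also have "\<dots> = (\<integral>\<^sup>+\<omega>. ennreal (taper (x + X t \<omega>) * weight t x \<omega>) * (ennreal (1 / taper (x + X t \<omega>)) * f (x
      + X t \<omega>)) \<partial>M)"
    using pt_AE_nonneg[OF t, of x]
    by (intro nn_integral_weighted_eq[OF _ integrable_tapered[OF t x] _ tapered_kernel_eq[OF t x]]) (auto
        elim!: eventually_mono)
  also have "\<dots> = (\<integral>\<^sup>+\<omega>. f (x + X t \<omega>) * ennreal (weight t x \<omega>) \<partial>M)"
  proof (rule nn_integral_cong_AE)
    show "AE \<omega> in M. ennreal (taper (x + X t \<omega>) * weight t x \<omega>) * (ennreal (1 / taper (x + X t \<omega>)) * f (x + X t \<omega>))
        = f (x + X t \<omega>) * ennreal (weight t x \<omega>)"
      using nonzero(2)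
    proof eventually_elim
      case (elim \<omega>)
      have "ennreal (taper (x + X t \<omega>) * weight t x \<omega>) * (ennreal (1 / taper (x + X t \<omega>)) * f (x + X t \<omega>))
          = (ennreal (taper (x + X t \<omega>)) * ennreal (1 / taper (x + X t \<omega>))) * (f (x + X t \<omega>) * ennreal (weight t x \<omega>))"
        by (simp add: ennreal_mult mult_ac)
      then show ?case by (simp add: untaper[OF elim])
    qed
  qed
  finally show ?thesis .
qed

lemma killed_le_heat_if_nonzero:
  assumes "t > 0" "x \<noteq> 0" and [measurable]: "f \<in> borel_measurable borel"
  shows "killed t f x \<le> heat t f x"
proof -
  have "killed t f x \<le> (\<integral>\<^sup>+\<omega>. f (x + X t \<omega>) * 1 \<partial>M)"
    unfolding killed_eq_expectation[OF assms] by (intro nn_integral_mono mult_left_mono) (auto simp: ennreal_le_1)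
  then show ?thesis using nn_integral_X[OF assms(1,3), of x] by simp
qed

lemma integrable_pt:
  assumes t: "t > 0"
  shows "integrable lborel (pt t x)"
proof (cases "x = 0")
  case True
  then have "pt t x = (\<lambda>_. 0)" using t by auto
  then show ?thesis by simp
next
  case False
  have "killed t (\<lambda>_. 1) x \<le> 1" using killed_le_heat_if_nonzero[OF t False, of "\<lambda>_. 1"] by (simp add: heat_const[OF t])
  then have "(\<integral>\<^sup>+y. ennreal (pt t x y) \<partial>lborel) < \<infinity>" by (simp add: killed_def order_le_less_trans)
  then show ?thesis using pt_AE_nonneg[OF t, of x] measurable_pt[OF t] by (intro integrableI_nonneg) auto
qed

lemma pt_AE_le_p:
  assumes t: "t > 0"
  shows "AE y in lborel. pt t x y \<le> p t (y - x)"
proof (cases "x = 0")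
  case False
  show ?thesis
  proof (rule lborel.AE_le_if_set_nn_integral_le
      [OF integrable_pt[OF t] pt_AE_nonneg[OF t] integrable_p_translate[OF t]])
    fix A :: "'a set" assume "A \<in> sets lborel"
    then show "(\<integral>\<^sup>+y\<in>A. ennreal (pt t x y) \<partial>lborel) \<le> (\<integral>\<^sup>+y\<in>A. ennreal (p t (y - x)) \<partial>lborel)"
      using killed_le_heat_if_nonzero[OF t False, of "indicator A"] by (simp add: killed_def heat_def)
  qed simp
qed (use t in simp)

lemma pt_nonneg [simp]:
  assumes "t > 0"
  shows "0 \<le> pt t x y"
proof -
  have half: "t / 2 > 0" using assms by simp
  have "0 \<le> (LINT z|lborel. pt (t / 2) x z * pt (t / 2) z y)"
  proof (rule integral_nonneg_AE)
    show "AE z in lborel. 0 \<le> pt (t / 2) x z * pt (t / 2) z y"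
      using pt_AE_nonneg[OF half, of x] pt_AE_nonneg[OF half, of y]
      by eventually_elim (simp add: pt_commute[OF half, of _ y])
  qed
  then show ?thesis using pt_add[OF half half, of x y] by simp
qed

definition potential_const :: real where
  "potential_const = coupling * neg_moment_const \<alpha>"

lemma potential_const_pos: "potential_const > 0"
  using coupling_pos neg_moment_const_pos alpha by (simp add: potential_const_def)

lemma heat_potential_le:
  assumes "t > 0" "x \<noteq> 0"
  shows "heat t potential x \<le> ennreal (potential_const * norm x powr (- \<alpha>))"
proof -
  have "heat t potential x = ennreal coupling * heat t (\<lambda>z. ennreal (norm z powr (- \<alpha>))) x"
    using coupling_pos by (simp add: potential_def[abs_def] ennreal_mult heat_cmult)
  also have "\<dots> \<le> ennreal coupling * ennreal (neg_moment_const \<alpha> * norm x powr (- \<alpha>))"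
    using alpha assms by (intro mult_left_mono heat_neg_powr_le) auto
  finally show ?thesis using coupling_pos by (simp add: potential_const_def mult.assoc flip: ennreal_mult')
qed

lemma one_le_killed_add:
  assumes t: "t > 0" and x: "x \<noteq> 0"
  shows "1 \<le> killed t (\<lambda>_. 1) x + ennreal (potential_const * t * norm x powr (- \<alpha>))"
proof -
  have "1 = (\<integral>\<^sup>+\<omega>. 1 \<partial>M)" by (simp add: M.emeasure_space_1)
  also have "\<dots> \<le> (\<integral>\<^sup>+\<omega>. ennreal (weight t x \<omega>) + path_integral potential t x \<omega> \<partial>M)"
    unfolding weight_def by (intro nn_integral_mono one_le_exp_neg_add)
  also have "\<dots> = killed t (\<lambda>_. 1) x + (\<integral>\<^sup>+s\<in>{0<..<t}. heat s potential x \<partial>lborel)"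
    by (simp add: nn_integral_add killed_eq_expectation[OF t x] nn_integral_path_integral_1)
  also have "(\<integral>\<^sup>+s\<in>{0<..<t}. heat s potential x \<partial>lborel)
      \<le> (\<integral>\<^sup>+s\<in>{0<..<t}. ennreal (potential_const * norm x powr (- \<alpha>)) \<partial>lborel)"
    by (rule nn_integral_mono) (use heat_potential_le x in \<open>auto simp: indicator_def\<close>)
  also have "\<dots> = ennreal (potential_const * t * norm x powr (- \<alpha>))"
    using t potential_const_pos by (subst nn_integral_cmult_indicator) (auto simp: mult_ac simp flip: ennreal_mult)
  finally show ?thesis by (simp add: add_left_mono)
qed

lemma integral_abs_p_minus_pt_le:
  assumes t: "t > 0" and x: "x \<noteq> 0"
  shows "(LINT z|lborel. \<bar>p t (z - x) - pt t x z\<bar>) \<le> potential_const * t * norm x powr (- \<alpha>)"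
proof -
  have "(LINT z|lborel. \<bar>p t (z - x) - pt t x z\<bar>) = (LINT z|lborel. p t (z - x) - pt t x z)"
  proof (rule integral_cong_AE)
    show "AE z in lborel. \<bar>p t (z - x) - pt t x z\<bar> = p t (z - x) - pt t x z"
      using pt_AE_le_p[OF t, of x] by eventually_elim simp
  qed (use measurable_pt[OF t] in measurable)
  also have "\<dots> = 1 - (LINT z|lborel. pt t x z)"
    using integrable_p_translate[OF t] integrable_pt[OF t] by (simp add: integral_p_translate[OF t])
  finally have defect: "(LINT z|lborel. \<bar>p t (z - x) - pt t x z\<bar>) = 1 - (LINT z|lborel. pt t x z)" .
  have "killed t (\<lambda>_. 1) x = ennreal (LINT z|lborel. pt t x z)"
    unfolding killed_def using t by (simp add: nn_integral_eq_integral[OF integrable_pt[OF t]])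
  moreover have "0 \<le> (LINT z|lborel. pt t x z)" using t by simp
  ultimately have "ennreal 1 \<le> ennreal ((LINT z|lborel. pt t x z) + potential_const * t * norm x powr (- \<alpha>))"
    using one_le_killed_add[OF assms] potential_const_pos t by simp
  then have "1 \<le> (LINT z|lborel. pt t x z) + potential_const * t * norm x powr (- \<alpha>)"
    using \<open>0 \<le> (LINT z|lborel. pt t x z)\<close> potential_const_pos t by (subst (asm) ennreal_le_iff) auto
  then show ?thesis unfolding defect by simp
qed

end

section \<open>Continuity away from the axes and the killed semigroup\<close>

lemma AE_le_imp_le_on_open:
  fixes f g :: "'a::euclidean_space \<Rightarrow> real"
  assumes U: "open U" "continuous_on U f" "continuous_on U g"
    and AE_le: "AE y in lborel. y \<in> U \<longrightarrow> f y \<le> g y" and y: "y \<in> U"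
  shows "f y \<le> g y"
proof (rule ccontr)
  assume "\<not> f y \<le> g y"
  let ?N = "U \<inter> (\<lambda>y. f y - g y) -` {0<..}"
  have open_N: "open ?N" using U by (intro continuous_open_preimage continuous_intros) auto
  moreover have "y \<in> ?N" using \<open>\<not> f y \<le> g y\<close> y by simp
  ultimately obtain e where e: "e > 0" "ball y e \<subseteq> ?N" by (meson open_contains_ball_eq)
  have "AE y in lborel. y \<notin> ?N" using AE_le by eventually_elim auto
  then have "emeasure lborel ?N = 0" using open_N by (subst (asm) AE_iff_measurable[of ?N]) auto
  then have "emeasure lborel (ball y e) = 0" using e(2) open_N emeasure_mono[of "ball y e" ?N lborel] by simp
  then show False using e(1) unit_ball_vol_pos[of "real DIM('a)"] by (simp add: emeasure_ball)
qed

context fk_kernel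
begin

lemma pt_modulus:
  assumes \<tau>: "\<tau> > 0" and times: "s > 0" "s' > 0" and points: "y \<noteq> 0" "y' \<noteq> 0"
  shows "\<bar>pt (\<tau> + s) x y - pt (\<tau> + s') x y'\<bar> \<le> C0 * \<tau> powr (- real DIM('a) / \<alpha>) *
    (potential_const * s * norm y powr (- \<alpha>) + potential_const * s' * norm y' powr (- \<alpha>)
        + (LINT w|lborel. \<bar>p s (w - y) - p s' (w - y')\<bar>))"
proof -
  let ?B = "C0 * \<tau> powr (- real DIM('a) / \<alpha>)"
  let ?defect = "\<lambda>s y w. \<bar>p s (w - y) - pt s y w\<bar>" and ?shift = "\<lambda>w. \<bar>p s (w - y) - p s' (w - y')\<bar>"
  have integrable_bound: "integrable lborel (?defect s y)" "integrable lborel (?defect s' y')"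
    "integrable lborel ?shift"
    using integrable_p_translate integrable_pt times by auto
  have integrable_pt_pt: "integrable lborel (\<lambda>w. pt \<tau> x w * pt s w y)" "integrable lborel (\<lambda>w. pt \<tau> x w * pt s' w y')"
    using integrable_pt_mult_pt \<tau> times by auto
  have "pt (\<tau> + s) x y - pt (\<tau> + s') x y' = (LINT w|lborel. pt \<tau> x w * pt s w y - pt \<tau> x w * pt s' w y')"
    using integrable_pt_pt by (simp add: pt_add \<tau> times)
  also have "\<dots> = (LINT w|lborel. pt \<tau> x w * (pt s y w - pt s' y' w))"
    using times by (simp add: right_diff_distrib pt_commute[of _ _ y] pt_commute[of _ _ y'])
  finally have "\<bar>pt (\<tau> + s) x y - pt (\<tau> + s') x y'\<bar> \<le> (LINT w|lborel. \<bar>pt \<tau> x w * (pt s y w - pt s' y' w)\<bar>)"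
    using integral_abs_bound by simp
  also have "\<dots> \<le> (LINT w|lborel. ?B * (?defect s y w + ?defect s' y' w + ?shift w))"
  proof (rule integral_mono_AE')
    show "AE w in lborel. \<bar>pt \<tau> x w * (pt s y w - pt s' y' w)\<bar> \<le> ?B * (?defect s y w + ?defect s' y' w + ?shift w)"
      using pt_AE_le_p[OF \<tau>, of x]
    proof eventually_elim
      case (elim w)
      then have "pt \<tau> x w \<le> ?B" using p_le_sup[OF \<tau>, of "w - x"] by linarith
      then have "\<bar>pt \<tau> x w * (pt s y w - pt s' y' w)\<bar> \<le> ?B * \<bar>pt s y w - pt s' y' w\<bar>"
        using \<tau> by (simp add: abs_mult mult_right_mono)
      also have "\<dots> \<le> ?B * (?defect s y w + ?defect s' y' w + ?shift w)"
        using C0 by (intro mult_left_mono) auto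
      finally show ?case .
    qed
  qed (use integrable_bound C0 in auto)
  also have "\<dots> = ?B * ((LINT w|lborel. ?defect s y w) + (LINT w|lborel. ?defect s' y' w) + (LINT w|lborel. ?shift w))"
    using integrable_bound by simp
  also have "\<dots> \<le> ?B * (potential_const * s * norm y powr (- \<alpha>) + potential_const * s' * norm y' powr (- \<alpha>)
      + (LINT w|lborel. ?shift w))"
    using integral_abs_p_minus_pt_le times points C0 by (intro mult_left_mono add_mono) auto
  finally show ?thesis .
qed

lemma uniform_limit_pt:
  assumes T: "\<And>n. T n > 0" "t > 0" "T \<longlonglongrightarrow> t" and Y: "\<And>n. Y n \<noteq> 0" "y \<noteq> 0" "Y \<longlonglongrightarrow> y"
  shows "uniform_limit UNIV (\<lambda>n x. pt (T n) x (Y n)) (\<lambda>x. pt t x y) sequentially"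
proof (rule uniform_limitI)
  fix e :: real assume e: "e > 0"
  define B where "B = C0 * (t / 2) powr (- real DIM('a) / \<alpha>)"
  define Q where "Q = 2 * B * potential_const * norm y powr (- \<alpha>)"
  define s where "s = min (t / 2) (e / (2 * Q))"
  define \<tau> where "\<tau> = t - s"
  define S where "S n = max (T n - \<tau>) (s / 2)" for n
  define D where "D n = (LINT w|lborel. \<bar>p (S n) (w - Y n) - p s (w - y)\<bar>)" for n
  let ?sum = "\<lambda>n. potential_const * S n * norm (Y n) powr (- \<alpha>) + potential_const * s * norm y powr (- \<alpha>) + D n"
  have B: "B > 0" and Q: "Q > 0" using C0 potential_const_pos T Y by (simp_all add: B_def Q_def)
  have s: "s > 0" "s \<le> t / 2" "s * Q < e"
    using T e Q mult_right_mono[of s "e / (2 * Q)" Q] by (auto simp: s_def)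
  have \<tau>: "t / 2 \<le> \<tau>" "\<tau> > 0" "\<tau> + s = t" using s T by (auto simp: \<tau>_def)
  have S_pos: "S n > 0" for n using s by (simp add: S_def less_max_iff_disj)
  have "(\<lambda>n. max (T n - \<tau>) (s / 2)) \<longlonglongrightarrow> max (t - \<tau>) (s / 2)" by (intro tendsto_intros T)
  then have S: "S \<longlonglongrightarrow> s" using s by (simp add: S_def[abs_def] \<tau>_def max_def)
  have D: "D \<longlonglongrightarrow> 0" unfolding D_def by (rule p_L1_tendsto[OF S_pos s(1) S Y(3)])
  have "(\<lambda>n. B * ?sum n) \<longlonglongrightarrow> B * (potential_const * s * norm y powr (- \<alpha>) + potential_const * s * norm y powr (- \<alpha>) + 0)"
    using Y by (intro tendsto_intros S D) auto
  then have "(\<lambda>n. B * ?sum n) \<longlonglongrightarrow> s * Q" by (simp add: Q_def algebra_simps)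
  then have "\<forall>\<^sub>F n in sequentially. B * ?sum n < e" by (rule order_tendstoD) (rule s(3))
  moreover have "\<forall>\<^sub>F n in sequentially. \<tau> + s / 2 < T n"
    by (rule order_tendstoD(1)[OF T(3)]) (use s \<tau> in linarith)
  ultimately show "\<forall>\<^sub>F n in sequentially. \<forall>x\<in>UNIV. dist (pt (T n) x (Y n)) (pt t x y) < e"
  proof eventually_elim
    case (elim n)
    have T_eq: "T n = \<tau> + S n" using elim by (simp add: S_def max_def)
    have "0 \<le> ?sum n" using potential_const_pos S_pos[of n] s by (simp add: D_def)
    moreover have "C0 * \<tau> powr (- real DIM('a) / \<alpha>) \<le> B"
      unfolding B_def using \<tau> T C0 alpha by (intro mult_left_mono powr_mono2') auto
    ultimately have "dist (pt (T n) x (Y n)) (pt t x y) \<le> B * ?sum n" for x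
      using pt_modulus[OF \<tau>(2) S_pos[of n] s(1) Y(1)[of n] Y(2), of x]
        mult_right_mono[of "C0 * \<tau> powr (- real DIM('a) / \<alpha>)" B "?sum n"]
      unfolding D_def dist_real_def T_eq \<tau>(3) by linarith
    then show ?case using elim(1) by (auto intro: le_less_trans)
  qed
qed

lemma continuous_pt_off_axes:
  "continuous_on ({0<..} \<times> (UNIV - {0}) \<times> (UNIV - {0})) (\<lambda>(t, x, y). pt t x y)"
  unfolding continuous_on_sequentially
proof (intro allI impI ballI, elim conjE)
  fix U :: "nat \<Rightarrow> real \<times> 'a \<times> 'a" and u
  assume u: "u \<in> {0<..} \<times> (UNIV - {0}) \<times> (UNIV - {0})"
    and U: "\<forall>n. U n \<in> {0<..} \<times> (UNIV - {0}) \<times> (UNIV - {0})" and U_limit: "U \<longlonglongrightarrow> u"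
  obtain t x y where u_eq: "u = (t, x, y)" by (cases u)
  define T X Y where "T n = fst (U n)" and "X n = fst (snd (U n))" and "Y n = snd (snd (U n))" for n
  have U_eq: "U n = (T n, X n, Y n)" for n by (simp add: T_def X_def Y_def)
  have nonzero: "T n > 0" "X n \<noteq> 0" "Y n \<noteq> 0" "t > 0" "x \<noteq> 0" "y \<noteq> 0" for n using U u by (auto simp: U_eq u_eq)
  have limits: "T \<longlonglongrightarrow> t" "X \<longlonglongrightarrow> x" "Y \<longlonglongrightarrow> y"
    using tendsto_fst[OF U_limit] tendsto_fst[OF tendsto_snd[OF U_limit]] tendsto_snd[OF tendsto_snd[OF U_limit]]
    by (simp_all add: T_def[abs_def] X_def[abs_def] Y_def[abs_def] u_eq)
  have "uniform_limit UNIV (\<lambda>n x. pt (T n) x (Y n)) (\<lambda>x. pt t x y) sequentially"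
    by (rule uniform_limit_pt) (use nonzero limits in auto)
  then have "(\<lambda>n. pt (T n) (X n) (Y n) - pt t (X n) y) \<longlonglongrightarrow> 0"
    by (auto simp: uniform_limit_iff tendsto_iff dist_real_def elim!: eventually_mono)
  moreover have "uniform_limit UNIV (\<lambda>n z. pt t z (X n)) (\<lambda>z. pt t z x) sequentially"
    by (rule uniform_limit_pt) (use nonzero limits in auto)
  then have "(\<lambda>n. pt t y (X n)) \<longlonglongrightarrow> pt t y x" by (rule tendsto_uniform_limitI) simp
  then have "(\<lambda>n. pt t (X n) y) \<longlonglongrightarrow> pt t x y" using nonzero(4) by (simp add: pt_commute[of t y])
  ultimately have "(\<lambda>n. pt (T n) (X n) (Y n) - pt t (X n) y + pt t (X n) y) \<longlonglongrightarrow> 0 + pt t x y" by (rule tendsto_add)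
  then show "((\<lambda>(t, x, y). pt t x y) \<circ> U) \<longlonglongrightarrow> (\<lambda>(t, x, y). pt t x y) u"
    by (simp add: comp_def U_eq u_eq)
qed

lemma continuous_pt_left:
  assumes "t > 0" "x \<noteq> 0"
  shows "continuous_on (UNIV - {0}) (pt t x)"
proof -
  have "continuous_on (UNIV - {0}) (\<lambda>y. (\<lambda>(t, x, y). pt t x y) (t, x, y))"
    by (rule continuous_on_compose2[OF continuous_pt_off_axes]) (use assms in \<open>auto intro!: continuous_intros\<close>)
  then show ?thesis by simp
qed

lemma continuous_p_translate:
  assumes "t > 0"
  shows "continuous_on U (\<lambda>y. p t (y - x))"
proof -
  have "continuous_on U (\<lambda>y. (\<lambda>(t, x). p t x) (t, y - x))"
    by (rule continuous_on_compose2[OF continuous_p]) (use assms in \<open>auto intro!: continuous_intros\<close>)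
  then show ?thesis by simp
qed

lemma jointly_measurable_pt:
  assumes t: "t > 0"
  shows "(\<lambda>(x, y). pt t x y) \<in> borel_measurable (borel \<Otimes>\<^sub>M borel)"
proof -
  let ?S = "(UNIV - {0::'a}) \<times> (UNIV - {0::'a})"
  have "continuous_on ?S (\<lambda>u. (\<lambda>(t, x, y). pt t x y) (t, u))"
    by (rule continuous_on_compose2[OF continuous_pt_off_axes]) (use t in \<open>auto intro!: continuous_intros\<close>)
  then have "(\<lambda>u. indicator ?S u *\<^sub>R (case u of (x, y) \<Rightarrow> pt t x y)) \<in> borel_measurable borel"
    by (intro borel_measurable_continuous_on_indicator borel_open open_Times) (auto simp: case_prod_beta)
  then show ?thesis unfolding borel_prod[symmetric]
    by (rule measurable_cong[THEN iffD1, rotated]) (use t in \<open>auto simp: indicator_def\<close>)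
qed

lemma pt_le_p:
  assumes t: "t > 0"
  shows "pt t x y \<le> p t (y - x)"
proof (cases "x = 0 \<or> y = 0")
  case False
  then show ?thesis
    using pt_AE_le_p[OF t, of x] t
    by (intro AE_le_imp_le_on_open[where U="UNIV - {0}" and f="pt t x"] continuous_pt_left continuous_p_translate) auto
qed (use t in auto)

lemma killed_le_heat: "t > 0 \<Longrightarrow> killed t f x \<le> heat t f x"
  unfolding killed_def heat_def by (intro nn_integral_mono mult_right_mono ennreal_leI pt_le_p) auto

lemma killed_mono_AE: "AE y in lborel. f y \<le> g y \<Longrightarrow> killed t f x \<le> killed t g x"
  unfolding killed_def by (intro nn_integral_mono_AE) (auto elim!: eventually_mono intro!: mult_left_mono)

lemma killed_add:
  "t > 0 \<Longrightarrow> f \<in> borel_measurable borel \<Longrightarrow> g \<in> borel_measurable borel \<Longrightarrow> killed t (\<lambda>y. f y + g y) x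
      = killed t f x + killed t g x"
  unfolding killed_def using measurable_pt[of t x] by (simp add: distrib_left nn_integral_add)

lemma killed_cmult: "t > 0 \<Longrightarrow> f \<in> borel_measurable borel \<Longrightarrow> killed t (\<lambda>y. c * f y) x = c * killed t f x"
  unfolding killed_def using measurable_pt[of t x] by (simp add: mult.left_commute nn_integral_cmult)

lemma ennreal_pt_add:
  assumes "s > 0" "t > 0"
  shows "ennreal (pt (s + t) x y) = (\<integral>\<^sup>+z. ennreal (pt s x z) * ennreal (pt t z y) \<partial>lborel)"
proof -
  have "ennreal (pt (s + t) x y) = (\<integral>\<^sup>+z. ennreal (pt s x z * pt t z y) \<partial>lborel)"
    unfolding pt_add[OF assms] using assms by (intro nn_integral_eq_integral[symmetric] integrable_pt_mult_pt) auto
  then show ?thesis using assms by (simp add: ennreal_mult)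
qed

lemma killed_killed:
  assumes times: "s > 0" "t > 0" and [measurable]: "f \<in> borel_measurable borel"
  shows "killed s (killed t f) x = killed (s + t) f x"
proof -
  note [measurable] = measurable_pt[OF times(1)] jointly_measurable_pt[OF times(2)]
  have "killed s (killed t f) x = (\<integral>\<^sup>+z. \<integral>\<^sup>+y. ennreal (pt s x z) * (ennreal (pt t z y) * f y) \<partial>lborel \<partial>lborel)"
    unfolding killed_def by (simp add: nn_integral_cmult)
  also have "\<dots> = (\<integral>\<^sup>+y. \<integral>\<^sup>+z. ennreal (pt s x z) * (ennreal (pt t z y) * f y) \<partial>lborel \<partial>lborel)"
    by (rule lborel_pair.Fubini'[symmetric]) measurable
  also have "\<dots> = killed (s + t) f x"
    unfolding killed_def ennreal_pt_add[OF times] by (simp add: nn_integral_multc flip: mult.assoc)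
  finally show ?thesis .
qed

section \<open>The lower bound away from the origin\<close>

definition bridge_const :: real where
  "bridge_const = three_P_const * potential_const"

lemma bridge_const_pos: "bridge_const > 0"
  using three_P_const_pos potential_const_pos by (simp add: bridge_const_def)

lemma heat_potential_heat_le:
  assumes s: "0 < s" "s < t" and x: "x \<noteq> 0" and [measurable]: "f \<in> borel_measurable borel"
  shows "heat s (\<lambda>z. potential z * heat (t - s) f z) x
    \<le> heat t (\<lambda>y. ennreal (bridge_const * (norm x powr (- \<alpha>) + norm y powr (- \<alpha>))) * f y) x"
proof -
  let ?sum = "\<lambda>y. bridge_const * (norm x powr (- \<alpha>) + norm y powr (- \<alpha>))"
  have times: "s > 0" "t - s > 0" using s by auto
  have "heat s (\<lambda>z. potential z * heat (t - s) f z) x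
      \<le> (\<integral>\<^sup>+y. ennreal three_P_const * (heat s potential x
          + heat (t - s) potential y) * (ennreal (p (s + (t - s)) (y - x)) * f y) \<partial>lborel)"
    by (rule heat_mult_heat_le[OF times]) measurable
  also have "\<dots> \<le> (\<integral>\<^sup>+y. ennreal (?sum y) * (ennreal (p t (y - x)) * f y) \<partial>lborel)"
  proof (rule nn_integral_mono_AE)
    have "AE y in lborel. y \<noteq> (0::'a)" by (rule AE_lborel_singleton)
    then show "AE y in lborel. ennreal three_P_const * (heat s potential x
        + heat (t - s) potential y) * (ennreal (p (s + (t - s)) (y - x)) * f y)
        \<le> ennreal (?sum y) * (ennreal (p t (y - x)) * f y)"
    proof eventually_elim
      case (elim y)
      have "ennreal three_P_const * (heat s potential x + heat (t - s) potential y)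
          \<le> ennreal three_P_const * (ennreal (potential_const * norm x powr (- \<alpha>))
              + ennreal (potential_const * norm y powr (- \<alpha>)))"
        using elim x times by (intro mult_left_mono add_mono heat_potential_le) auto
      also have "\<dots> = ennreal (?sum y)"
        using three_P_const_pos potential_const_pos
        by (simp add: bridge_const_def distrib_left mult.assoc flip: ennreal_plus ennreal_mult)
      finally show ?case by (simp add: mult_right_mono)
    qed
  qed
  finally show ?thesis by (simp add: heat_def mult.left_commute)
qed

lemma nn_integral_path_integral_potential_le:
  assumes t: "t > 0" and x: "x \<noteq> 0" and [measurable]: "f \<in> borel_measurable borel"
  shows "(\<integral>\<^sup>+\<omega>. f (x + X t \<omega>) * path_integral potential t x \<omega> \<partial>M)
    \<le> heat t (\<lambda>y. ennreal (bridge_const * t * (norm x powr (- \<alpha>) + norm y powr (- \<alpha>))) * f y) x"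
proof -
  let ?sum = "\<lambda>y. bridge_const * (norm x powr (- \<alpha>) + norm y powr (- \<alpha>))"
  have inner: "heat s (\<lambda>z. potential z * heat (t - s) f z) x \<le> heat t (\<lambda>y. ennreal (?sum y) * f y) x" if "s \<in> {0<..<t}"
    for s
    using that x by (intro heat_potential_heat_le) auto
  have "(\<integral>\<^sup>+\<omega>. f (x + X t \<omega>) * path_integral potential t x \<omega> \<partial>M)
      \<le> (\<integral>\<^sup>+s\<in>{0<..<t}. heat t (\<lambda>y. ennreal (?sum y) * f y) x \<partial>lborel)"
    by (subst nn_integral_path_integral) (auto intro!: nn_integral_mono simp: inner indicator_def)
  also have "\<dots> = ennreal t * heat t (\<lambda>y. ennreal (?sum y) * f y) x"
    using t by (subst nn_integral_cmult_indicator) (auto simp: mult.commute)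
  also have "\<dots> = heat t (\<lambda>y. ennreal (bridge_const * t * (norm x powr (- \<alpha>) + norm y powr (- \<alpha>))) * f y) x"
  proof -
    have "ennreal t * ennreal (?sum y) = ennreal (bridge_const * t * (norm x powr (- \<alpha>) + norm y powr (- \<alpha>)))"
      for y :: 'a
      using t by (simp add: mult_ac flip: ennreal_mult')
    then show ?thesis by (simp add: heat_cmult[symmetric] flip: mult.assoc)
  qed
  finally show ?thesis .
qed

lemma nn_integral_path_integral_away_le:
  assumes t: "t > 0" and R: "R > 0" "R \<le> norm x" and A [measurable]: "A \<in> sets borel" "A \<subseteq> {y. R \<le> norm y}"
  defines "a \<equiv> 2 * bridge_const * t * R powr (- \<alpha>)"
  shows "(\<integral>\<^sup>+\<omega>. indicator A (x + X t \<omega>) * path_integral potential t x \<omega> \<partial>M) \<le> ennreal a * heat t (indicator A) x"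
proof -
  have x: "x \<noteq> 0" using R by auto
  have "(\<integral>\<^sup>+\<omega>. indicator A (x + X t \<omega>) * path_integral potential t x \<omega> \<partial>M)
      \<le> heat t (\<lambda>y. ennreal (bridge_const * t * (norm x powr (- \<alpha>) + norm y powr (- \<alpha>))) * indicator A y) x"
    by (rule nn_integral_path_integral_potential_le[OF t x]) measurable
  also have "\<dots> \<le> heat t (\<lambda>y. ennreal a * indicator A y) x"
  proof (rule heat_mono)
    fix y
    have "norm x powr (- \<alpha>) \<le> R powr (- \<alpha>)" "y \<in> A \<Longrightarrow> norm y powr (- \<alpha>) \<le> R powr (- \<alpha>)"
      using R A(2) alpha by (auto intro!: powr_mono2')
    then have "bridge_const * t * (norm x powr (- \<alpha>) + norm y powr (- \<alpha>)) \<le> a" if "y \<in> A"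
      using that bridge_const_pos t
        mult_left_mono[of "norm x powr (- \<alpha>) + norm y powr (- \<alpha>)" "2 * R powr (- \<alpha>)" "bridge_const * t"]
      by (simp add: a_def)
    then show "ennreal (bridge_const * t * (norm x powr (- \<alpha>) + norm y powr (- \<alpha>))) * indicator A y
        \<le> ennreal a * indicator A y"
      by (auto simp: indicator_def intro: ennreal_leI)
  qed
  finally show ?thesis by (simp add: heat_cmult)
qed

lemma killed_indicator_ge:
  assumes t: "t > 0" and R: "R > 0" "R \<le> norm x" and A [measurable]: "A \<in> sets borel" "A \<subseteq> {y. R \<le> norm y}"
  shows "ennreal (exp (- (2 * bridge_const * t * R powr (- \<alpha>)))) * heat t (indicator A) x \<le> killed t (indicator A) x"
proof -
  define a where "a = 2 * bridge_const * t * R powr (- \<alpha>)"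
  let ?F = "heat t (indicator A) x"
  have x: "x \<noteq> 0" using R by auto
  have a: "a \<ge> 0" using bridge_const_pos t by (simp add: a_def)
  have "?F \<le> heat t (\<lambda>_. 1) x" by (rule heat_mono) (simp add: indicator_def)
  then have "?F \<le> 1" by (simp add: heat_const[OF t])
  then have finite: "ennreal (exp (- a) * a) * ?F \<noteq> \<infinity>" by (auto simp: ennreal_mult_eq_top_iff top_unique)
  have path: "(\<integral>\<^sup>+\<omega>. indicator A (x + X t \<omega>) * path_integral potential t x \<omega> \<partial>M) \<le> ennreal a * ?F"
    unfolding a_def by (rule nn_integral_path_integral_away_le[OF t R A])
  have "ennreal (exp (- a)) * ?F + ennreal (exp (- a) * a) * ?F = ennreal (exp (- a) * (1 + a)) * ?F"
    using a by (simp add: distrib_left distrib_right)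
  also have "\<dots> = (\<integral>\<^sup>+\<omega>. ennreal (exp (- a) * (1 + a)) * indicator A (x + X t \<omega>) \<partial>M)"
    by (simp add: nn_integral_cmult nn_integral_X[OF t])
  also have "\<dots> \<le> (\<integral>\<^sup>+\<omega>. (ennreal (weight t x \<omega>) + ennreal (exp (- a)) * path_integral potential t x \<omega>) * indicator A (x
      + X t \<omega>) \<partial>M)"
    unfolding weight_def by (intro nn_integral_mono mult_right_mono exp_neg_tangent a) simp
  also have "\<dots> = killed t (indicator A) x
      + ennreal (exp (- a)) * (\<integral>\<^sup>+\<omega>. indicator A (x + X t \<omega>) * path_integral potential t x \<omega> \<partial>M)"
    by (simp add: killed_eq_expectation[OF t x] distrib_right nn_integral_add nn_integral_cmult
        mult.assoc mult.commute[of "indicator _ _"])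
  also have "\<dots> \<le> killed t (indicator A) x + ennreal (exp (- a)) * (ennreal a * ?F)"
    by (intro add_left_mono mult_left_mono path) simp
  finally show ?thesis
    unfolding a_def[symmetric] using finite a
    by (simp add: ennreal_mult mult.assoc add.commute[of _ "_ * (_ * _)"] ennreal_add_left_cancel_le)
qed

definition away_const :: "real \<Rightarrow> real" where
  "away_const r = exp (- (2 * bridge_const * (r / 2) powr (- \<alpha>)))"

lemma away_const_pos: "away_const r > 0"
  by (simp add: away_const_def)

theorem pt_ge_away:
  assumes r: "r > 0" and t: "t > 0" and x: "r * t powr (1 / \<alpha>) \<le> norm x" and y: "r * t powr (1 / \<alpha>) \<le> norm y"
  shows "away_const r * p t (y - x) \<le> pt t x y"
proof -
  define R where "R = r * t powr (1 / \<alpha>) / 2"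
  let ?U = "{y::'a. R < norm y}" and ?f = "\<lambda>y. away_const r * p t (y - x) * indicator {y::'a. R < norm y} y"
  have "0 < r * t powr (1 / \<alpha>)" using r t by simp
  then have R: "R > 0" "R \<le> norm x" "y \<in> ?U" using x y by (auto simp: R_def)
  have open_U: "open ?U" by (intro open_Collect_less continuous_intros)
  have "t * R powr (- \<alpha>) = (r / 2) powr (- \<alpha>)"
    using r t alpha by (simp add: R_def powr_mult powr_powr powr_divide powr_minus_divide)
  then have const: "exp (- (2 * bridge_const * t * R powr (- \<alpha>))) = away_const r"
    by (simp add: away_const_def mult.assoc)
  have integrable_f: "integrable lborel ?f"
    using integrable_p_translate[OF t] open_U by (intro integrable_real_mult_indicator) auto
  have "AE y in lborel. ?f y \<le> pt t x y"
  proof (rule lborel.AE_le_if_set_nn_integral_le[OF integrable_f _ integrable_pt[OF t]])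
    fix A :: "'a set" assume "A \<in> sets lborel"
    then have A: "A \<inter> ?U \<in> sets borel" using open_U by auto
    have "(\<integral>\<^sup>+y\<in>A. ennreal (?f y) \<partial>lborel)
        = (\<integral>\<^sup>+y. ennreal (away_const r) * (ennreal (p t (y - x)) * indicator (A \<inter> ?U) y) \<partial>lborel)"
      using away_const_pos[of r] by (intro nn_integral_cong) (simp add: indicator_def ennreal_mult)
    also have "\<dots> = ennreal (away_const r) * heat t (indicator (A \<inter> ?U)) x"
      using A unfolding heat_def by (subst nn_integral_cmult) auto
    also have "\<dots> \<le> killed t (indicator (A \<inter> ?U)) x"
      unfolding const[symmetric] using A by (intro killed_indicator_ge[OF t R(1,2)]) auto
    also have "\<dots> \<le> killed t (indicator A) x" unfolding killed_def by (intro nn_integral_mono) (simp add: indicator_def)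
    finally show "(\<integral>\<^sup>+y\<in>A. ennreal (?f y) \<partial>lborel) \<le> (\<integral>\<^sup>+y\<in>A. ennreal (pt t x y) \<partial>lborel)" by (simp add: killed_def)
  qed (use t away_const_pos[of r] in auto)
  then have AE_ge: "AE y in lborel. y \<in> ?U \<longrightarrow> away_const r * p t (y - x) \<le> pt t x y" by eventually_elim auto
  have "x \<noteq> 0" using R by auto
  then have "continuous_on ?U (pt t x)"
    by (rule continuous_on_subset[OF continuous_pt_left[OF t]]) (use R in auto)
  then show ?thesis
    using t R by (intro AE_le_imp_le_on_open[OF open_U _ _ AE_ge] continuous_intros continuous_p_translate)
qed

end

section \<open>The invariant function\<close>

context fk_kernel
begin

abbreviation norm_powr :: "'a \<Rightarrow> ennreal" where
  "norm_powr z \<equiv> ennreal (norm z powr \<delta>)"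

definition moment :: real where
  "moment = moment_const \<delta>"

lemma moment_pos: "moment > 0"
  using moment_const_pos delta by (simp add: moment_def)

lemma heat_norm_powr_le: "t > 0 \<Longrightarrow> heat t norm_powr x \<le> ennreal (norm x powr \<delta> + moment * t powr (\<delta> / \<alpha>))"
  unfolding moment_def using delta by (intro heat_powr_le)

lemma heat_norm_powr_finite: "t > 0 \<Longrightarrow> heat t norm_powr x < \<infinity>"
  using le_less_trans[OF heat_norm_powr_le ennreal_less_top] by simp

lemma potential_mult_norm_powr: "potential z * norm_powr z = ennreal (coupling * norm z powr (- (\<alpha> - \<delta>)))"
  using coupling_pos by (cases "z = 0") (simp_all add: potential_def mult.assoc flip: ennreal_mult powr_add)

lemma heat_norm_powr_eq:
  assumes "t > 0"
  shows "heat t norm_powr x = norm_powr x + (\<integral>\<^sup>+s\<in>{0<..<t}. heat s (\<lambda>z. potential z * norm_powr z) x \<partial>lborel)"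
proof -
  have "heat s (\<lambda>z. potential z * norm_powr z) x = ennreal coupling * heat s (\<lambda>z. ennreal (norm z powr (\<delta> - \<alpha>))) x"
    for s
    using coupling_pos by (simp add: potential_mult_norm_powr ennreal_mult heat_cmult)
  then show ?thesis
    using heat_powr_eq[OF assms delta, of x] by (simp add: coupling_def nn_integral_cmult mult.assoc)
qed

lemma nn_integral_add_const_Ioo:
  fixes f :: "real \<Rightarrow> ennreal"
  assumes "t > 0" and [measurable]: "f \<in> borel_measurable borel"
  shows "(\<integral>\<^sup>+s\<in>{0<..<t}. (f s + b) \<partial>lborel) = (\<integral>\<^sup>+s\<in>{0<..<t}. f s \<partial>lborel) + b * ennreal t"
  using assms(1) by (simp add: distrib_right nn_integral_add nn_integral_cmult_indicator)

abbreviation increment :: "real \<Rightarrow> 'a \<Rightarrow> real" where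
  "increment t x \<equiv> t powr (1 + \<delta> / \<alpha>) * norm x powr (- \<alpha>)"

lemma heat_potential_heat_norm_powr_le:
  assumes s: "0 < s" "s < t" and x: "x \<noteq> 0"
  shows "heat s (\<lambda>z. potential z * heat (t - s) norm_powr z) x
    \<le> heat s (\<lambda>z. potential z * norm_powr z) x
        + ennreal (moment * t powr (\<delta> / \<alpha>) * (potential_const * norm x powr (- \<alpha>)))"
proof -
  let ?m = "moment * t powr (\<delta> / \<alpha>)" and ?Vh = "\<lambda>z. potential z * norm_powr z"
  have "(t - s) powr (\<delta> / \<alpha>) \<le> t powr (\<delta> / \<alpha>)" using s delta by (intro powr_mono2) auto
  then have "heat (t - s) norm_powr z \<le> ennreal (norm z powr \<delta> + ?m)" for z
    using s moment_pos by (intro order_trans[OF heat_norm_powr_le] ennreal_leI add_left_mono mult_left_mono) auto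
  then have "potential z * heat (t - s) norm_powr z \<le> potential z * (norm_powr z + ennreal ?m)" for z
    using moment_pos by (intro mult_left_mono) simp_all
  then have "heat s (\<lambda>z. potential z * heat (t - s) norm_powr z) x \<le> heat s (\<lambda>z. ?Vh z + ennreal ?m * potential z) x"
    by (intro heat_mono) (simp add: distrib_left mult.commute)
  also have "\<dots> = heat s ?Vh x + ennreal ?m * heat s potential x" by (simp add: heat_add heat_cmult)
  also have "\<dots> \<le> heat s ?Vh x + ennreal ?m * ennreal (potential_const * norm x powr (- \<alpha>))"
    using s x by (intro add_left_mono mult_left_mono heat_potential_le) auto
  finally show ?thesis using moment_pos by (simp add: ennreal_mult')
qed

lemma norm_powr_le_killed_add:
  assumes t: "t > 0" and x: "x \<noteq> 0"
  shows "norm_powr x \<le> killed t norm_powr x + ennreal (moment * potential_const * increment t x)"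
proof -
  let ?m = "moment * t powr (\<delta> / \<alpha>)" and ?Vh = "\<lambda>z. potential z * norm_powr z"
  let ?I = "\<integral>\<^sup>+s\<in>{0<..<t}. heat s ?Vh x \<partial>lborel"
  have inner: "heat s (\<lambda>z. potential z * heat (t - s) norm_powr z) x
      \<le> heat s ?Vh x + ennreal (?m * (potential_const * norm x powr (- \<alpha>)))" if "s \<in> {0<..<t}" for s
    using that x by (intro heat_potential_heat_norm_powr_le) auto
  have "norm_powr x + ?I = (\<integral>\<^sup>+\<omega>. norm_powr (x + X t \<omega>) * 1 \<partial>M)"
    using heat_norm_powr_eq[OF t, of x] nn_integral_X[OF t, of norm_powr x] by simp
  also have "\<dots> \<le> (\<integral>\<^sup>+\<omega>. norm_powr (x + X t \<omega>) * (ennreal (weight t x \<omega>) + path_integral potential t x \<omega>) \<partial>M)"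
    unfolding weight_def by (intro nn_integral_mono mult_left_mono one_le_exp_neg_add) simp
  also have "\<dots> = killed t norm_powr x + (\<integral>\<^sup>+s\<in>{0<..<t}. heat s (\<lambda>z. potential z * heat (t - s) norm_powr z) x \<partial>lborel)"
    by (simp add: distrib_left nn_integral_add killed_eq_expectation[OF t x]
        nn_integral_path_integral[of norm_powr potential])
  also have "\<dots> \<le> killed t norm_powr x
      + (\<integral>\<^sup>+s\<in>{0<..<t}. (heat s ?Vh x + ennreal (?m * (potential_const * norm x powr (- \<alpha>)))) \<partial>lborel)"
    by (intro add_left_mono nn_integral_mono) (use inner in \<open>auto simp: indicator_def\<close>)
  also have "\<dots> = ?I + (killed t norm_powr x + ennreal (?m * (potential_const * norm x powr (- \<alpha>))) * ennreal t)"
    by (simp add: nn_integral_add_const_Ioo[OF t] add_ac)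
  also have "ennreal (?m * (potential_const * norm x powr (- \<alpha>))) * ennreal t
      = ennreal (moment * potential_const * increment t x)"
    using t moment_pos potential_const_pos by (simp add: powr_add mult_ac flip: ennreal_mult)
  finally have "?I + norm_powr x \<le> ?I + (killed t norm_powr x + ennreal (moment * potential_const * increment t x))"
    by (simp only: add.commute)
  moreover have "?I \<noteq> \<infinity>" using heat_norm_powr_eq[OF t, of x] heat_norm_powr_finite[OF t, of x] by auto
  ultimately show ?thesis by (simp add: ennreal_add_left_cancel_le)
qed

definition near_const :: real where
  "near_const = coupling * (C0 * sphere_area TYPE('a) / (real DIM('a) - (\<alpha> - \<delta>)) * 2 powr \<alpha>)"

lemma near_const_nonneg: "near_const \<ge> 0"
  using coupling_pos C0 alpha delta by (simp add: near_const_def)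

lemma nn_integral_heat_near_le:
  assumes t: "t > 0" and x: "x \<noteq> 0"
  shows "(\<integral>\<^sup>+s\<in>{0<..<t}. heat s (\<lambda>z. potential z * norm_powr z * indicator (cball 0 (norm x / 2)) z) x \<partial>lborel)
    \<le> ennreal (near_const * increment t x)"
proof -
  let ?b = "ennreal (near_const * (t powr (\<delta> / \<alpha>) * norm x powr (- \<alpha>)))"
  have inner: "heat s (\<lambda>z. potential z * norm_powr z * indicator (cball 0 (norm x / 2)) z) x \<le> ?b" if s: "s \<in> {0<..<t}"
    for s
  proof -
    have [measurable]: "cball (0::'a) (norm x / 2) \<in> sets borel" by (simp add: borel_closed)
    let ?N = "C0 * sphere_area TYPE('a) / (real DIM('a) - (\<alpha> - \<delta>)) * 2 powr \<alpha>"
    have "heat s (\<lambda>z. potential z * norm_powr z * indicator (cball 0 (norm x / 2)) z) x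
        = ennreal coupling * heat s (\<lambda>z. ennreal (norm z powr (- (\<alpha> - \<delta>))) * indicator (cball 0 (norm x / 2)) z) x"
      using coupling_pos by (simp add: potential_mult_norm_powr ennreal_mult mult.assoc heat_cmult)
    also have "\<dots> \<le> ennreal coupling * ennreal (?N * s powr (\<delta> / \<alpha>) * norm x powr (- \<alpha>))"
      using heat_neg_powr_near_0[of s x "\<alpha> - \<delta>" \<delta>] s x alpha delta by (intro mult_left_mono) auto
    also have "\<dots> = ennreal (near_const * (s powr (\<delta> / \<alpha>) * norm x powr (- \<alpha>)))"
      using coupling_pos by (simp add: near_const_def mult.assoc flip: ennreal_mult')
    also have "\<dots> \<le> ?b"
      using s near_const_nonneg delta alpha by (intro ennreal_leI mult_left_mono mult_right_mono powr_mono2) auto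
    finally show ?thesis .
  qed
  have "(\<integral>\<^sup>+s\<in>{0<..<t}. heat s (\<lambda>z. potential z * norm_powr z * indicator (cball 0 (norm x / 2)) z) x \<partial>lborel)
      \<le> (\<integral>\<^sup>+s\<in>{0<..<t}. ?b \<partial>lborel)"
    by (rule nn_integral_mono) (use inner in \<open>auto simp: indicator_def\<close>)
  also have "\<dots> = ?b * ennreal t" using t by (subst nn_integral_cmult_indicator) auto
  also have "\<dots> = ennreal (near_const * increment t x)"
    using t near_const_nonneg by (simp add: powr_add mult_ac flip: ennreal_mult)
  finally show ?thesis .
qed

lemma path_integral_add_weight_le:
  assumes t: "t > 0" and V_le: "\<And>z. V z \<le> potential z" "\<And>z. V z \<le> ennreal b" and b: "b \<ge> 0"
  shows "path_integral V t x \<omega> + ennreal (weight t x \<omega>) \<le> 1 + ennreal ((b * t)\<^sup>2)"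
proof -
  have "path_integral V t x \<omega> \<le> ennreal (b * t)"
    using path_integral_le[of t V, OF _ V_le(2)] t b by (simp add: ennreal_mult)
  then obtain J where J: "path_integral V t x \<omega> = ennreal J" "0 \<le> J" "J \<le> b * t"
    using b t by (cases "path_integral V t x \<omega>") (auto simp: top_unique)
  have "path_integral V t x \<omega> \<le> path_integral potential t x \<omega>" by (rule path_integral_mono) (rule V_le(1))
  then have "ennreal J + ennreal (weight t x \<omega>) \<le> 1 + ennreal (J\<^sup>2)"
    unfolding weight_def using J by (intro add_exp_neg_le) auto
  also have "\<dots> \<le> 1 + ennreal ((b * t)\<^sup>2)" using J by (intro add_left_mono ennreal_leI power_mono)
  finally show ?thesis using J by simp
qed

lemma killed_add_nn_integral_far_le:
  assumes t: "t > 0" and x: "x \<noteq> 0"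
  defines "b \<equiv> coupling * (norm x / 2) powr (- \<alpha>) * t"
  shows "killed t norm_powr x + (\<integral>\<^sup>+s\<in>{0<..<t}. heat s (\<lambda>z. potential z * indicator (- cball 0 (norm x / 2)) z
      * norm_powr z) x \<partial>lborel)
    \<le> (1 + ennreal (b\<^sup>2)) * heat t norm_powr x"
proof -
  have [measurable]: "- cball (0::'a) (norm x / 2) \<in> sets borel" by (simp add: borel_open)
  let ?V = "\<lambda>z. potential z * indicator (- cball 0 (norm x / 2)) z"
  have [measurable]: "?V \<in> borel_measurable borel" by measurable
  have V_le: "?V z \<le> ennreal (coupling * (norm x / 2) powr (- \<alpha>))" for z
    using coupling_pos alpha x by (auto simp: potential_def indicator_def
        intro!: ennreal_leI mult_left_mono powr_mono2')
  have path: "path_integral ?V t x \<omega> + ennreal (weight t x \<omega>) \<le> 1 + ennreal (b\<^sup>2)" for \<omega>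
    unfolding b_def using coupling_pos by (intro path_integral_add_weight_le[OF t _ V_le]) (auto simp: indicator_def)
  have "(\<integral>\<^sup>+s\<in>{0<..<t}. heat s (\<lambda>z. ?V z * norm_powr z) x \<partial>lborel)
      \<le> (\<integral>\<^sup>+s\<in>{0<..<t}. heat s (\<lambda>z. ?V z * heat (t - s) norm_powr z) x \<partial>lborel)"
  proof (rule nn_integral_mono)
    fix s :: real
    have "norm_powr z \<le> heat (t - s) norm_powr z" if "s \<in> {0<..<t}" for z
      using heat_norm_powr_eq[of "t - s" z] that by simp
    then show "heat s (\<lambda>z. ?V z * norm_powr z) x * indicator {0<..<t} s
        \<le> heat s (\<lambda>z. ?V z * heat (t - s) norm_powr z) x * indicator {0<..<t} s"
      by (auto simp: indicator_def intro!: heat_mono mult_left_mono)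
  qed
  then have "killed t norm_powr x + (\<integral>\<^sup>+s\<in>{0<..<t}. heat s (\<lambda>z. ?V z * norm_powr z) x \<partial>lborel)
      \<le> (\<integral>\<^sup>+\<omega>. norm_powr (x + X t \<omega>) * (path_integral ?V t x \<omega> + ennreal (weight t x \<omega>)) \<partial>M)"
    by (simp add: distrib_left nn_integral_add killed_eq_expectation[OF t x] nn_integral_path_integral[of norm_powr ?V]
        add.commute[of "killed t _ x"] add_right_mono)
  also have "\<dots> \<le> (\<integral>\<^sup>+\<omega>. norm_powr (x + X t \<omega>) * (1 + ennreal (b\<^sup>2)) \<partial>M)"
    by (intro nn_integral_mono mult_left_mono path) simp
  also have "\<dots> = (1 + ennreal (b\<^sup>2)) * heat t norm_powr x"
    by (subst nn_integral_multc) (simp_all add: nn_integral_X[OF t, of norm_powr] mult.commute)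
  finally show ?thesis .
qed

lemma killed_norm_powr_le_near:
  assumes t: "t > 0" and x: "x \<noteq> 0"
  defines "b \<equiv> coupling * (norm x / 2) powr (- \<alpha>) * t"
  shows "killed t norm_powr x \<le> norm_powr x + ennreal (near_const * increment t x) + ennreal (b\<^sup>2) * heat t norm_powr x"
proof -
  have [measurable]: "cball (0::'a) (norm x / 2) \<in> sets borel" "- cball (0::'a) (norm x / 2) \<in> sets borel"
    by (simp_all add: borel_closed borel_open)
  let ?Vh = "\<lambda>z. potential z * norm_powr z"
  let ?near = "\<integral>\<^sup>+s\<in>{0<..<t}. heat s (\<lambda>z. ?Vh z * indicator (cball 0 (norm x / 2)) z) x \<partial>lborel"
  let ?far = "\<integral>\<^sup>+s\<in>{0<..<t}. heat s (\<lambda>z. potential z * indicator (- cball 0 (norm x / 2)) z * norm_powr z) x \<partial>lborel"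
  have "heat s ?Vh x = heat s (\<lambda>z. potential z * indicator (- cball 0 (norm x / 2)) z * norm_powr z) x
      + heat s (\<lambda>z. ?Vh z * indicator (cball 0 (norm x / 2)) z) x" for s
    by (subst heat_add[symmetric]) (auto intro!: arg_cong[where f="\<lambda>f. heat s f x"] simp: indicator_def)
  then have decomposition: "(\<integral>\<^sup>+s\<in>{0<..<t}. heat s ?Vh x \<partial>lborel) = ?far + ?near"
    by (simp add: distrib_right nn_integral_add)
  have "?far + killed t norm_powr x \<le> heat t norm_powr x + ennreal (b\<^sup>2) * heat t norm_powr x"
    using killed_add_nn_integral_far_le[OF t x] by (simp add: b_def distrib_right add.commute)
  also have "\<dots> = ?far + (norm_powr x + ?near + ennreal (b\<^sup>2) * heat t norm_powr x)"
    by (subst heat_norm_powr_eq[OF t]) (simp add: decomposition add_ac)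
  also have "\<dots> \<le> ?far + (norm_powr x + ennreal (near_const * increment t x) + ennreal (b\<^sup>2) * heat t norm_powr x)"
    by (intro add_left_mono add_right_mono nn_integral_heat_near_le t x)
  finally have "?far + killed t norm_powr x
      \<le> ?far + (norm_powr x + ennreal (near_const * increment t x) + ennreal (b\<^sup>2) * heat t norm_powr x)" .
  moreover have "?far \<le> heat t norm_powr x"
    by (subst heat_norm_powr_eq[OF t]) (simp add: decomposition add_increasing)
  then have "?far \<noteq> \<infinity>" using heat_norm_powr_finite[OF t, of x] by auto
  ultimately show ?thesis by (simp add: ennreal_add_left_cancel_le)
qed

definition drift_const :: real where
  "drift_const = moment * (1 + potential_const) + near_const + (coupling * 2 powr \<alpha>)\<^sup>2 * (1 + moment)"

lemma drift_const_nonneg: "drift_const \<ge> 0"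
  using moment_pos potential_const_pos near_const_nonneg by (simp add: drift_const_def)

lemma squared_far_drift_le:
  assumes t: "t > 0" and x: "x \<noteq> 0" and short: "t * norm x powr (- \<alpha>) \<le> 1"
  shows "ennreal ((coupling * (norm x / 2) powr (- \<alpha>) * t)\<^sup>2) * heat t norm_powr x
    \<le> ennreal ((coupling * 2 powr \<alpha>)\<^sup>2 * ((1 + moment) * increment t x))"
proof -
  define u where "u = t * norm x powr (- \<alpha>)"
  let ?k = "(coupling * 2 powr \<alpha>)\<^sup>2" and ?e = "\<delta> / \<alpha>"
  have u: "0 < u" "u \<le> 1" and increment_eq: "increment t x = u * t powr ?e"
    using t x short by (simp_all add: u_def powr_add)
  have "u * norm x powr \<delta> \<le> u powr ?e * norm x powr \<delta>"
    using u delta alpha powr_mono'[of ?e 1 u] by (intro mult_right_mono) auto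
  also have "u powr ?e = t powr ?e * norm x powr (- \<delta>)" using t alpha by (simp add: u_def powr_mult powr_powr)
  also have "t powr ?e * norm x powr (- \<delta>) * norm x powr \<delta> = t powr ?e" using x by (simp add: powr_minus)
  finally have "u * (u * norm x powr \<delta>) + u * (u * (moment * t powr ?e)) \<le> u * t powr ?e + u * (moment * t powr ?e)"
    using u moment_pos by (intro add_mono mult_left_mono mult_left_le_one_le) auto
  then have "?k * (u\<^sup>2 * (norm x powr \<delta> + moment * t powr ?e)) \<le> ?k * ((1 + moment) * increment t x)"
    unfolding increment_eq by (intro mult_left_mono zero_le_power2) (simp add: power2_eq_square algebra_simps)
  moreover have far: "coupling * (norm x / 2) powr (- \<alpha>) * t = coupling * 2 powr \<alpha> * u"
    by (simp add: u_def powr_divide powr_minus field_simps)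
  ultimately have "(coupling * (norm x / 2) powr (- \<alpha>) * t)\<^sup>2 * (norm x powr \<delta> + moment * t powr ?e)
      \<le> ?k * ((1 + moment) * increment t x)"
    unfolding far by (simp add: power_mult_distrib mult.assoc)
  then show ?thesis
    by (intro order_trans[OF mult_left_mono[OF heat_norm_powr_le[OF t]]]) (auto intro: ennreal_leI simp
        flip: ennreal_mult')
qed

lemma killed_norm_powr_le_add:
  assumes t: "t > 0" and x: "x \<noteq> 0"
  shows "killed t norm_powr x \<le> norm_powr x + ennreal (drift_const * increment t x)"
proof (cases "t * norm x powr (- \<alpha>) \<le> 1")
  case False
  have "moment * t powr (\<delta> / \<alpha>) * 1 \<le> moment * t powr (\<delta> / \<alpha>) * (t * norm x powr (- \<alpha>))"
    using False moment_pos by (intro mult_left_mono) auto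
  also have "\<dots> = moment * increment t x" using t by (simp add: powr_add)
  also have "\<dots> \<le> drift_const * increment t x"
    using moment_pos potential_const_pos near_const_nonneg
    by (intro mult_right_mono) (auto simp: drift_const_def algebra_simps)
  finally have "heat t norm_powr x \<le> ennreal (norm x powr \<delta> + drift_const * increment t x)"
    by (intro order_trans[OF heat_norm_powr_le[OF t]] ennreal_leI) simp
  then show ?thesis using order_trans[OF killed_le_heat[OF t]] drift_const_nonneg by simp
next
  case True
  let ?k = "(coupling * 2 powr \<alpha>)\<^sup>2"
  have "killed t norm_powr x \<le> norm_powr x + ennreal (near_const * increment t x)
      + ennreal (?k * ((1 + moment) * increment t x))"
    by (rule order_trans[OF killed_norm_powr_le_near[OF t x] add_left_mono[OF squared_far_drift_le[OF t x True]]])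
  also have "\<dots> = norm_powr x + ennreal ((near_const + ?k * (1 + moment)) * increment t x)"
    using near_const_nonneg moment_pos by (simp add: distrib_right add.assoc mult.assoc flip: ennreal_plus)
  also have "\<dots> \<le> norm_powr x + ennreal (drift_const * increment t x)"
    using moment_pos potential_const_pos
    by (intro add_left_mono ennreal_leI mult_right_mono) (auto simp: drift_const_def)
  finally show ?thesis .
qed

lemma norm_powr_le_killed_add_drift:
  assumes "t > 0" "x \<noteq> 0"
  shows "norm_powr x \<le> killed t norm_powr x + ennreal (drift_const * increment t x)"
proof -
  have "moment * potential_const \<le> drift_const"
    using moment_pos near_const_nonneg by (simp add: drift_const_def algebra_simps)
  then have "ennreal (moment * potential_const * increment t x) \<le> ennreal (drift_const * increment t x)"
    by (intro ennreal_leI mult_right_mono) auto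
  then show ?thesis by (rule order_trans[OF norm_powr_le_killed_add[OF assms] add_left_mono])
qed

text \<open>The error of one step of length \<open>\<tau>\<close> is of order \<open>\<tau>\<^bsup>1+\<delta>/\<alpha>\<^esup>\<close>, hence summing over the \<open>t / \<tau>\<close> steps up to time \<open>t\<close>
  leaves an error that vanishes with \<open>\<tau>\<close>.\<close>

lemma killed_norm_powr_step:
  assumes times: "s > 0" "\<tau> > 0" and x: "x \<noteq> 0"
  defines "err \<equiv> ennreal (drift_const * neg_moment_const \<alpha> * increment \<tau> x)"
  shows "killed (s + \<tau>) norm_powr x \<le> killed s norm_powr x + err"
    and "killed s norm_powr x \<le> killed (s + \<tau>) norm_powr x + err"
proof -
  let ?c = "drift_const * \<tau> powr (1 + \<delta> / \<alpha>)" and ?neg = "\<lambda>z. ennreal (norm z powr (- \<alpha>))"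
  have nonzero: "AE z in lborel. z \<noteq> (0::'a)" by (rule AE_lborel_singleton)
  have drift_eq: "ennreal (drift_const * increment \<tau> z) = ennreal ?c * ?neg z" for z :: 'a
    using drift_const_nonneg by (simp add: mult.assoc flip: ennreal_mult)
  have [measurable]: "killed \<tau> norm_powr \<in> borel_measurable borel"
    unfolding killed_def using jointly_measurable_pt[OF times(2)] by measurable
  have "killed s ?neg x \<le> ennreal (neg_moment_const \<alpha> * norm x powr (- \<alpha>))"
    using alpha by (intro order_trans[OF killed_le_heat] heat_neg_powr_le times x) auto
  then have "killed s (\<lambda>z. ennreal ?c * ?neg z) x \<le> ennreal ?c * ennreal (neg_moment_const \<alpha> * norm x powr (- \<alpha>))"
    by (simp add: killed_cmult[OF times(1)] mult_left_mono)
  also have "\<dots> = err" using drift_const_nonneg neg_moment_const_pos[of \<alpha>] alpha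
    by (simp add: err_def mult_ac flip: ennreal_mult)
  finally have error: "killed s (\<lambda>z. ennreal ?c * ?neg z) x \<le> err" .
  have semigroup: "killed (s + \<tau>) norm_powr x = killed s (killed \<tau> norm_powr) x"
    by (rule killed_killed[OF times, symmetric]) measurable
  have "AE z in lborel. killed \<tau> norm_powr z \<le> norm_powr z + ennreal ?c * ?neg z"
    using nonzero
    by eventually_elim (simp only: drift_eq[symmetric] killed_norm_powr_le_add[OF times(2)] not_False_eq_True)
  then have "killed (s + \<tau>) norm_powr x \<le> killed s (\<lambda>z. norm_powr z + ennreal ?c * ?neg z) x"
    unfolding semigroup by (rule killed_mono_AE)
  also have "\<dots> \<le> killed s norm_powr x + err" by (simp add: killed_add[OF times(1)] add_left_mono error)
  finally show "killed (s + \<tau>) norm_powr x \<le> killed s norm_powr x + err" .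
  have "AE z in lborel. norm_powr z \<le> killed \<tau> norm_powr z + ennreal ?c * ?neg z"
    using nonzero
    by eventually_elim (simp only: drift_eq[symmetric] norm_powr_le_killed_add_drift[OF times(2)] not_False_eq_True)
  then have "killed s norm_powr x \<le> killed s (\<lambda>z. killed \<tau> norm_powr z + ennreal ?c * ?neg z) x"
    by (rule killed_mono_AE)
  also have "\<dots> = killed (s + \<tau>) norm_powr x + killed s (\<lambda>z. ennreal ?c * ?neg z) x"
    by (simp add: killed_add[OF times(1)] semigroup)
  also have "\<dots> \<le> killed (s + \<tau>) norm_powr x + err" by (intro add_left_mono error)
  finally show "killed s norm_powr x \<le> killed (s + \<tau>) norm_powr x + err" .
qed

lemma killed_norm_powr_steps:
  assumes \<tau>: "\<tau> > 0" and x: "x \<noteq> 0"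
  defines "e \<equiv> drift_const * (1 + neg_moment_const \<alpha>) * increment \<tau> x"
  shows "killed (real (Suc n) * \<tau>) norm_powr x \<le> norm_powr x + ennreal (real (Suc n) * e) \<and>
    norm_powr x \<le> killed (real (Suc n) * \<tau>) norm_powr x + ennreal (real (Suc n) * e)"
proof -
  have "0 \<le> drift_const" "0 \<le> neg_moment_const \<alpha>" using drift_const_nonneg neg_moment_const_pos[of \<alpha>] alpha by auto
  then have e: "0 \<le> e" "drift_const * increment \<tau> x \<le> e" "drift_const * neg_moment_const \<alpha> * increment \<tau> x \<le> e"
    unfolding e_def by (auto intro!: mult_right_mono simp: distrib_left)
  show ?thesis
  proof (induction n)
    case 0
    have "ennreal (drift_const * increment \<tau> x) \<le> ennreal e" using e by (intro ennreal_leI)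
    then show ?case
      using order_trans[OF killed_norm_powr_le_add[OF \<tau> x] add_left_mono]
        order_trans[OF norm_powr_le_killed_add_drift[OF \<tau> x] add_left_mono] by simp
  next
    case (Suc n)
    let ?t = "real (Suc n) * \<tau>" and ?err = "ennreal (real (Suc n) * e)"
    have t: "?t > 0" using \<tau> by (simp del: of_nat_Suc)
    have t_add: "real (Suc (Suc n)) * \<tau> = ?t + \<tau>" by (simp add: distrib_right)
    have err_add: "ennreal (real (Suc (Suc n)) * e) = ?err + ennreal e"
      using e by (simp add: distrib_right flip: ennreal_plus)
    have step_err: "ennreal (drift_const * neg_moment_const \<alpha> * increment \<tau> x) \<le> ennreal e" using e
      by (intro ennreal_leI)
    have "killed (?t + \<tau>) norm_powr x \<le> killed ?t norm_powr x + ennreal e"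
      by (rule order_trans[OF killed_norm_powr_step(1)[OF t \<tau> x] add_left_mono[OF step_err]])
    also have "\<dots> \<le> norm_powr x + ?err + ennreal e" using Suc.IH by (intro add_right_mono) simp
    finally have upper: "killed (?t + \<tau>) norm_powr x \<le> norm_powr x + ?err + ennreal e" .
    have "norm_powr x \<le> killed ?t norm_powr x + ?err" using Suc.IH by simp
    also have "\<dots> \<le> killed (?t + \<tau>) norm_powr x + ennreal e + ?err"
      by (intro add_right_mono order_trans[OF killed_norm_powr_step(2)[OF t \<tau> x] add_left_mono[OF step_err]])
    finally show ?case using upper unfolding t_add err_add by (simp add: add_ac)
  qed
qed

theorem killed_norm_powr:
  assumes t: "t > 0"
  shows "killed t norm_powr x = norm_powr x"
proof (cases "x = 0")
  case True
  then show ?thesis using t by (simp add: killed_def)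
next
  case x: False
  define c where "c = drift_const * (1 + neg_moment_const \<alpha>) * increment t x"
  let ?err = "\<lambda>n. ennreal (c * real (Suc n) powr (- \<delta> / \<alpha>))"
  have "N * (drift_const * (1 + neg_moment_const \<alpha>) * increment (t / N) x) = c * N powr (- \<delta> / \<alpha>)" if "N > 0" for N
    using t that by (simp add: c_def powr_divide powr_add[of N] powr_minus_divide mult_ac)
  then have step_err: "real (Suc n) * (drift_const * (1 + neg_moment_const \<alpha>) * increment (t / real (Suc n)) x)
      = c * real (Suc n) powr (- \<delta> / \<alpha>)" for n
    by simp
  have bounds: "killed t norm_powr x \<le> norm_powr x + ?err n" "norm_powr x \<le> killed t norm_powr x + ?err n" for n
    using killed_norm_powr_steps[of "t / real (Suc n)" x n] t x unfolding step_err by (simp_all del: of_nat_Suc)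
  have "(\<lambda>n. c * real (Suc n) powr (- \<delta> / \<alpha>)) \<longlonglongrightarrow> c * 0"
    using delta alpha
    by (intro tendsto_intros tendsto_neg_powr filterlim_compose[OF filterlim_real_sequentially filterlim_Suc]) auto
  then have err: "?err \<longlonglongrightarrow> 0" using tendsto_ennrealI by fastforce
  have "killed t norm_powr x \<le> norm_powr x + 0"
    by (rule tendsto_lowerbound[OF tendsto_add[OF tendsto_const err]]) (use bounds(1) in auto)
  moreover have "norm_powr x \<le> killed t norm_powr x + 0"
    by (rule tendsto_lowerbound[OF tendsto_add[OF tendsto_const err]]) (use bounds(2) in auto)
  ultimately show ?thesis by simp
qed

end

section \<open>The sharp upper bound\<close>

context stable_kernel
begin

abbreviation scale :: "real \<Rightarrow> real" where
  "scale t \<equiv> t powr (1 / \<alpha>)"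

lemma tail_at_scale:
  assumes "t > 0" "k > 0"
  shows "t / (k * scale t) powr (real DIM('a) + \<alpha>) = k powr (- (real DIM('a) + \<alpha>)) * t powr (- real DIM('a) / \<alpha>)"
proof -
  have "scale t powr (real DIM('a) + \<alpha>) = t powr (real DIM('a) / \<alpha>) * t"
    using assms alpha by (simp add: powr_powr powr_add add_divide_distrib)
  then have "(k * scale t) powr (real DIM('a) + \<alpha>) = k powr (real DIM('a) + \<alpha>) * (t powr (real DIM('a) / \<alpha>) * t)"
    using assms by (simp only: powr_mult)
  then have "t / (k * scale t) powr (real DIM('a) + \<alpha>)
      = (1 / k powr (real DIM('a) + \<alpha>)) * (1 / t powr (real DIM('a) / \<alpha>))"
    using assms by simp
  then show ?thesis by (simp only: powr_minus_divide minus_divide_left[symmetric])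
qed

lemma profile_ge_near:
  assumes t: "t > 0" and k: "k \<ge> 1" and w: "norm w \<le> k * scale t"
  shows "t powr (- real DIM('a) / \<alpha>) \<le> k powr (real DIM('a) + \<alpha>) * profile t w"
proof -
  let ?e = "real DIM('a) + \<alpha>" and ?u = "t powr (- real DIM('a) / \<alpha>)"
  have e: "?e > 0" using alpha by linarith
  have "k powr (- ?e) * ?u \<le> profile t w"
  proof (rule stable_profile_geI)
    have "k powr (- ?e) \<le> 1 powr (- ?e)" using k e by (intro powr_mono2') auto
    then show "k powr (- ?e) * ?u \<le> ?u" by (simp add: mult_left_le_one_le)
    assume "w \<noteq> 0"
    then have "t / (k * scale t) powr ?e \<le> t / norm w powr ?e"
      using t w e by (intro frac_le powr_mono2) auto
    then show "k powr (- ?e) * ?u \<le> t / norm w powr ?e" using tail_at_scale[OF t, of k] k by simp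
  qed
  then have "k powr ?e * (k powr (- ?e) * ?u) \<le> k powr ?e * profile t w" by (intro mult_left_mono) auto
  moreover have "k powr ?e * k powr (- ?e) = 1" using k unfolding powr_add[symmetric] by simp
  ultimately show ?thesis by (simp only: mult.assoc[symmetric] mult_1)
qed

lemma profile_ge_tail:
  assumes t: "t > 0" and w: "scale t \<le> norm w"
  shows "t / norm w powr (real DIM('a) + \<alpha>) \<le> profile t w"
proof (rule stable_profile_geI)
  let ?e = "real DIM('a) + \<alpha>"
  have "scale t > 0" using t by simp
  then have "t / norm w powr ?e \<le> t / (1 * scale t) powr ?e"
    using t w alpha by (intro frac_le powr_mono2) auto
  then show "t / norm w powr ?e \<le> t powr (- real DIM('a) / \<alpha>)" using tail_at_scale[OF t, of 1] by simp
qed simp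

lemma profile_le_shift:
  assumes t: "t > 0" and k: "k \<ge> 0" and v: "norm v \<le> norm w + k * scale t"
  shows "profile t w \<le> (k + 1) powr (real DIM('a) + \<alpha>) * profile t v"
proof (cases "norm w \<le> scale t")
  case True
  then have "norm v \<le> (k + 1) * scale t" using v by (simp add: algebra_simps)
  then show ?thesis using profile_ge_near[OF t, of "k + 1" v] stable_profile_le_sup[of \<alpha> t w] k by linarith
next
  case False
  have "k * scale t \<le> k * norm w" using False k by (intro mult_left_mono) auto
  then have "norm v \<le> (k + 1) * norm w" using v by (simp add: algebra_simps)
  then show ?thesis using stable_profile_compare[of \<alpha> t t 1 "k + 1" v w] alpha t k by simp
qed

end

context fk_kernel
begin

definition boundary_decay :: "real \<Rightarrow> 'a \<Rightarrow> real" where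
  "boundary_decay t x = (min 1 (norm x / scale t)) powr \<delta>"

lemma boundary_decay_nonneg [simp]: "0 \<le> boundary_decay t x"
  by (simp add: boundary_decay_def)

lemma boundary_decay_le_1: "t > 0 \<Longrightarrow> boundary_decay t x \<le> 1"
  using delta by (auto simp: boundary_decay_def intro!: powr_le1)

lemma boundary_decay_eq_power:
  assumes "t > 0" "norm x \<le> scale t"
  shows "boundary_decay t x = norm x powr \<delta> * t powr (- \<delta> / \<alpha>)"
proof -
  have "norm x / scale t \<le> 1" using assms by (simp add: divide_le_eq_1)
  then show ?thesis using assms by (simp add: boundary_decay_def powr_divide powr_powr powr_minus_divide)
qed

lemma boundary_decay_eq_1:
  assumes "t > 0" "scale t \<le> norm x"
  shows "boundary_decay t x = 1"
proof -
  have "1 \<le> norm x / scale t" using assms by (simp add: le_divide_eq_1)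
  then show ?thesis by (simp add: boundary_decay_def)
qed

lemma boundary_decay_le_power:
  assumes "t > 0"
  shows "boundary_decay t x \<le> norm x powr \<delta> * t powr (- \<delta> / \<alpha>)"
proof -
  have "boundary_decay t x \<le> (norm x / scale t) powr \<delta>"
    using delta assms by (auto simp: boundary_decay_def intro!: powr_mono2)
  then show ?thesis using assms by (simp add: powr_divide powr_powr powr_minus_divide)
qed

lemma boundary_decay_antimono:
  assumes s: "0 < s" "s \<le> t"
  shows "boundary_decay t x \<le> boundary_decay s x"
proof -
  have "scale s \<le> scale t" using s alpha by (intro powr_mono2) auto
  then have "norm x / scale t \<le> norm x / scale s" using s by (intro divide_left_mono) auto
  then show ?thesis unfolding boundary_decay_def using delta s by (intro powr_mono2) auto
qed

lemma boundary_decay_divide_le: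
  assumes "t > 0" "k \<ge> 1"
  shows "boundary_decay (t / k) x \<le> k powr (\<delta> / \<alpha>) * boundary_decay t x"
proof -
  have k: "scale k \<ge> 1" using assms alpha by (intro ge_one_powr_ge_zero) auto
  have "norm x / scale (t / k) = scale k * (norm x / scale t)" using assms by (simp add: powr_divide)
  then have "min 1 (norm x / scale (t / k)) \<le> scale k * min 1 (norm x / scale t)"
    using k by (auto simp: min_def)
  then have "boundary_decay (t / k) x \<le> (scale k * min 1 (norm x / scale t)) powr \<delta>"
    unfolding boundary_decay_def using delta assms by (intro powr_mono2) auto
  also have "\<dots> = k powr (\<delta> / \<alpha>) * boundary_decay t x" using assms by (simp add: boundary_decay_def powr_mult powr_powr)
  finally show ?thesis .
qed

lemma has_bochner_integral_pt_norm_powr: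
  assumes t: "t > 0"
  shows "has_bochner_integral lborel (\<lambda>z. pt t x z * norm z powr \<delta>) (norm x powr \<delta>)"
proof (rule has_bochner_integral_nn_integral)
  show "(\<integral>\<^sup>+z. ennreal (pt t x z * norm z powr \<delta>) \<partial>lborel) = ennreal (norm x powr \<delta>)"
    using killed_norm_powr[OF t, of x] t by (simp add: killed_def ennreal_mult)
qed (use t measurable_pt[OF t, of x] in auto)

lemma pt_le_sup: "t > 0 \<Longrightarrow> pt t x y \<le> C0 * t powr (- real DIM('a) / \<alpha>)"
  using order_trans[OF pt_le_p p_le_sup] .

lemma pt_le_profile: "t > 0 \<Longrightarrow> pt t x y \<le> C0 * profile t (x - y)"
  using order_trans[OF pt_le_p p_upper] by (simp add: stable_profile_minus_commute)

definition survival :: "real \<Rightarrow> 'a \<Rightarrow> real" where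
  "survival t x = (LINT z|lborel. pt t x z)"

lemma survival_nonneg [simp]: "t > 0 \<Longrightarrow> 0 \<le> survival t x"
  by (simp add: survival_def)

lemma survival_le_1:
  assumes "t > 0"
  shows "survival t x \<le> 1"
  unfolding survival_def integral_p_translate[OF assms, of x, symmetric]
  using assms by (intro integral_mono integrable_pt integrable_p_translate pt_le_p)

lemma pt_le_survival:
  assumes s: "s > 0" and t: "t > 0"
  shows "pt (s + t) x y \<le> C0 * t powr (- real DIM('a) / \<alpha>) * survival s x"
proof -
  have "pt (s + t) x y \<le> (LINT z|lborel. C0 * t powr (- real DIM('a) / \<alpha>) * pt s x z)"
    unfolding pt_add[OF s t]
  proof (rule integral_mono[OF integrable_pt_mult_pt[OF s t]])
    show "pt s x z * pt t z y \<le> C0 * t powr (- real DIM('a) / \<alpha>) * pt s x z" for z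
      using mult_left_mono[OF pt_le_sup[OF t] pt_nonneg[OF s]] by (simp add: mult.commute)
  qed (use integrable_pt[OF s] in simp)
  then show ?thesis by (simp add: survival_def)
qed

lemma measure_cball_eq_powr: "R > 0 \<Longrightarrow> measure lborel (cball (0::'a) R)
    = unit_ball_vol (real DIM('a)) * R powr real DIM('a)"
  by (simp add: content_cball powr_realpow)

lemma integrable_indicator_cball: "integrable lborel (indicator (cball (0::'a) R) :: 'a \<Rightarrow> real)"
  by (intro integrable_real_indicator emeasure_lborel_cball_finite) (simp add: borel_closed)

definition recursion_const :: real where
  "recursion_const = C0 * unit_ball_vol (real DIM('a)) * 2 powr (real DIM('a) / \<alpha>)"

lemma recursion_const_pos: "recursion_const > 0"
  using C0 by (simp add: recursion_const_def)

text \<open>Mass outside the ball of radius \<open>\<epsilon> t\<^bsup>1/\<alpha>\<^esup>\<close> is controlled by invariance of \<open>|z|\<^sup>\<delta>\<close>, mass inside by the mass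
  at time \<open>t/2\<close>.\<close>

lemma survival_le_recursion:
  assumes t: "t > 0" and \<epsilon>: "\<epsilon> > 0"
  shows "survival t x \<le> \<epsilon> powr (- \<delta>) * (norm x powr \<delta> * t powr (- \<delta> / \<alpha>))
    + recursion_const * \<epsilon> powr (real DIM('a)) * survival (t / 2) x"
proof -
  let ?d = "real DIM('a)"
  define R where "R = \<epsilon> * scale t"
  define B where "B = C0 * (t / 2) powr (- ?d / \<alpha>) * survival (t / 2) x"
  have R: "R > 0" and half: "t / 2 > 0" using t \<epsilon> by (simp_all add: R_def)
  have B: "0 \<le> B" "pt t x y \<le> B" for y
    using C0 half pt_le_survival[OF half half, of x y] by (simp_all add: B_def)
  have moment: "integrable lborel (\<lambda>z. pt t x z * norm z powr \<delta>)" "(LINT z|lborel. pt t x z * norm z powr \<delta>)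
      = norm x powr \<delta>"
    using has_bochner_integral_pt_norm_powr[OF t, of x] by (auto simp: has_bochner_integral_iff)
  have "survival t x \<le> (LINT z|lborel. R powr (- \<delta>) * (pt t x z * norm z powr \<delta>) + B * indicator (cball 0 R) z)"
    unfolding survival_def
  proof (rule integral_mono[OF integrable_pt[OF t]])
    fix z
    show "pt t x z \<le> R powr (- \<delta>) * (pt t x z * norm z powr \<delta>) + B * indicator (cball 0 R) z"
    proof (cases "norm z \<le> R")
      case True
      then show ?thesis using B(2)[of z] t by (simp add: add_increasing)
    next
      case False
      have "1 = R powr (- \<delta>) * R powr \<delta>" using R by (simp add: powr_minus)
      also have "\<dots> \<le> R powr (- \<delta>) * norm z powr \<delta>" using False R delta by (intro mult_left_mono powr_mono2) auto
      finally have "pt t x z * 1 \<le> pt t x z * (R powr (- \<delta>) * norm z powr \<delta>)" using t by (intro mult_left_mono) auto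
      then show ?thesis using False by (simp add: mult_ac)
    qed
  qed (use moment integrable_indicator_cball[of R] in simp)
  also have "\<dots> = R powr (- \<delta>) * norm x powr \<delta> + B * (unit_ball_vol ?d * R powr ?d)"
    using moment integrable_indicator_cball[of R] by (simp add: measure_cball_eq_powr[OF R])
  also have "R powr ?d = \<epsilon> powr ?d * t powr (?d / \<alpha>)" using t \<epsilon> by (simp add: R_def powr_mult powr_powr)
  also have "B * (unit_ball_vol ?d * (\<epsilon> powr ?d * t powr (?d / \<alpha>))) = recursion_const * \<epsilon> powr ?d * survival (t / 2) x"
    using t by (simp add: B_def recursion_const_def powr_divide powr_minus)
  also have "R powr (- \<delta>) = \<epsilon> powr (- \<delta>) * t powr (- \<delta> / \<alpha>)" using t \<epsilon> by (simp add: R_def powr_mult powr_powr)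
  finally show ?thesis by (simp add: mult_ac)
qed

definition contraction :: real where
  "contraction = (1 / (2 * 2 powr (\<delta> / \<alpha>) * recursion_const)) powr (1 / real DIM('a))"

lemma contraction_pos: "contraction > 0"
  using recursion_const_pos by (simp add: contraction_def)

lemma recursion_const_contraction: "recursion_const * contraction powr (real DIM('a)) = 1 / (2 * 2 powr (\<delta> / \<alpha>))"
  using recursion_const_pos dim_ge_1 by (simp add: contraction_def powr_powr)

lemma survival_le_iterate:
  "t > 0 \<Longrightarrow> survival t x \<le> 2 * contraction powr (- \<delta>) * (norm x powr \<delta> * t powr (- \<delta> / \<alpha>)) + (1 / 2) ^ n"
proof (induction n arbitrary: t)
  case 0
  then show ?case using survival_le_1[OF 0, of x] by (simp add: add_increasing)
next
  case (Suc n)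
  let ?A = "contraction powr (- \<delta>)" and ?a = "norm x powr \<delta> * t powr (- \<delta> / \<alpha>)" and ?k = "2 powr (\<delta> / \<alpha>)"
  have k: "1 \<le> ?k" using delta alpha by (intro ge_one_powr_ge_zero) auto
  have "(t / 2) powr (- \<delta> / \<alpha>) = ?k * t powr (- \<delta> / \<alpha>)"
    using Suc.prems by (simp add: powr_divide powr_minus field_simps)
  then have "survival (t / 2) x \<le> 2 * ?A * (?k * ?a) + (1 / 2) ^ n"
    using Suc.IH[of "t / 2"] Suc.prems by (simp add: mult_ac)
  then have "1 / (2 * ?k) * survival (t / 2) x \<le> 1 / (2 * ?k) * (2 * ?A * (?k * ?a) + (1 / 2) ^ n)"
    by (intro mult_left_mono) auto
  also have "\<dots> = ?A * ?a + (1 / ?k) * ((1 / 2) ^ n / 2)" by (simp add: algebra_simps add_divide_distrib)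
  also have "\<dots> \<le> ?A * ?a + 1 * ((1 / 2) ^ n / 2)" using k
    by (intro add_left_mono mult_right_mono) (auto simp: divide_le_eq_1)
  finally have "1 / (2 * ?k) * survival (t / 2) x \<le> ?A * ?a + (1 / 2) ^ Suc n" by simp
  then show ?case
    using survival_le_recursion[OF Suc.prems contraction_pos, of x] unfolding recursion_const_contraction by linarith
qed

definition survival_const :: real where
  "survival_const = max 1 (2 * contraction powr (- \<delta>))"

lemma survival_const_ge_1: "1 \<le> survival_const"
  by (simp add: survival_const_def)

lemma survival_le_power:
  assumes t: "t > 0"
  shows "survival t x \<le> survival_const * (norm x powr \<delta> * t powr (- \<delta> / \<alpha>))"
proof -
  let ?b = "2 * contraction powr (- \<delta>) * (norm x powr \<delta> * t powr (- \<delta> / \<alpha>))"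
  have "(\<lambda>n. ?b + (1 / 2) ^ n) \<longlonglongrightarrow> ?b + 0" by (intro tendsto_intros LIMSEQ_power_zero) auto
  then have "survival t x \<le> ?b + 0"
    by (rule tendsto_lowerbound) (use survival_le_iterate[OF t] in auto)
  also have "\<dots> \<le> survival_const * (norm x powr \<delta> * t powr (- \<delta> / \<alpha>))"
    unfolding survival_const_def add_0_right by (intro mult_right_mono) auto
  finally show ?thesis .
qed

theorem survival_le:
  assumes t: "t > 0"
  shows "survival t x \<le> survival_const * boundary_decay t x"
proof (cases "norm x \<le> scale t")
  case True
  then show ?thesis using survival_le_power[OF t, of x] by (simp add: boundary_decay_eq_power[OF t])
next
  case False
  then show ?thesis using survival_le_1[OF t, of x] survival_const_ge_1 boundary_decay_eq_1[OF t, of x] by simp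
qed

definition near_upper_const :: real where
  "near_upper_const = C0 * 3 powr (real DIM('a) / \<alpha>) * (survival_const * 3 powr (\<delta> / \<alpha>))\<^sup>2"

lemma near_upper_const_pos: "near_upper_const > 0"
  using C0 survival_const_ge_1 by (simp add: near_upper_const_def)

lemma pt_upper_near:
  assumes t: "t > 0"
  shows "pt t x y \<le> near_upper_const * t powr (- real DIM('a) / \<alpha>) * (boundary_decay t x * boundary_decay t y)"
proof -
  let ?d = "real DIM('a)" and ?s = "t / 3" and ?D = "survival_const * 3 powr (\<delta> / \<alpha>)"
  let ?K = "C0 * ?s powr (- ?d / \<alpha>)"
  have s: "?s > 0" "?s + ?s > 0" using t by auto
  have survival_third: "survival ?s z \<le> ?D * boundary_decay t z" for z
  proof -
    have "survival ?s z \<le> survival_const * boundary_decay ?s z" by (rule survival_le[OF s(1)])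
    also have "\<dots> \<le> survival_const * (3 powr (\<delta> / \<alpha>) * boundary_decay t z)"
      using survival_const_ge_1 by (intro mult_left_mono boundary_decay_divide_le[OF t]) auto
    finally show ?thesis by (simp add: mult.assoc)
  qed
  have "pt t x y = (LINT z|lborel. pt ?s x z * pt (?s + ?s) z y)" using pt_add[OF s, of x y] by (simp add: field_simps)
  also have "\<dots> \<le> (LINT z|lborel. pt ?s x z * (?K * survival ?s y))"
  proof (rule integral_mono[OF integrable_pt_mult_pt[OF s]])
    have "pt (?s + ?s) z y \<le> ?K * survival ?s y" for z
      using pt_le_survival[OF s(1) s(1), of y z] unfolding pt_commute[OF s(2), of y z] .
    then show "pt ?s x z * pt (?s + ?s) z y \<le> pt ?s x z * (?K * survival ?s y)" for z
      using s by (intro mult_left_mono) auto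
  qed (use integrable_pt[OF s(1)] in simp)
  also have "\<dots> = ?K * (survival ?s x * survival ?s y)" by (simp add: survival_def)
  also have "\<dots> \<le> ?K * ((?D * boundary_decay t x) * (?D * boundary_decay t y))"
    using s C0 survival_const_ge_1 by (intro mult_left_mono mult_mono survival_third) auto
  also have "?s powr (- ?d / \<alpha>) = 3 powr (?d / \<alpha>) * t powr (- ?d / \<alpha>)" using t
    by (simp add: powr_divide powr_minus field_simps)
  finally show ?thesis by (simp add: near_upper_const_def power2_eq_square mult_ac)
qed

lemma pt_le_if_far_le:
  assumes t: "t > 0" and \<rho>: "\<rho> < norm y" and P: "P \<ge> 0" "\<And>z. \<rho> \<le> norm z \<Longrightarrow> pt t x z \<le> P"
  shows "pt (t + t) x y \<le> C0 * (t / (norm y - \<rho>) powr (real DIM('a) + \<alpha>)) * survival t x + P"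
proof -
  let ?e = "real DIM('a) + \<alpha>" and ?Q = "C0 * (t / (norm y - \<rho>) powr (real DIM('a) + \<alpha>))"
  have Q: "?Q \<ge> 0" using C0 t by simp
  have pointwise: "pt t x z * pt t z y \<le> ?Q * pt t x z + P * pt t y z" for z
  proof (cases "\<rho> \<le> norm z")
    case True
    then have "pt t x z * pt t z y \<le> P * pt t z y" using P t by (intro mult_right_mono) auto
    then show ?thesis using mult_nonneg_nonneg[OF Q pt_nonneg[OF t, of x z]] pt_commute[OF t, of z y] by simp
  next
    case False
    have gap: "norm y - \<rho> \<le> norm (z - y)" using False norm_triangle_ineq2[of y z] by (simp add: norm_minus_commute)
    then have "z - y \<noteq> 0" using \<rho> by auto
    have "pt t z y \<le> C0 * profile t (z - y)" by (rule pt_le_profile[OF t])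
    also have "\<dots> \<le> C0 * (t / norm (z - y) powr ?e)"
      using C0 stable_profile_le_tail[OF \<open>z - y \<noteq> 0\<close>] by (intro mult_left_mono) auto
    also have "\<dots> \<le> ?Q" using C0 t gap \<rho> alpha by (intro mult_left_mono frac_le powr_mono2) auto
    finally have "pt t x z * pt t z y \<le> pt t x z * ?Q" using t by (intro mult_left_mono) auto
    then show ?thesis using mult_nonneg_nonneg[OF P(1) pt_nonneg[OF t, of y z]] by (simp add: mult.commute)
  qed
  have "pt (t + t) x y \<le> (LINT z|lborel. ?Q * pt t x z + P * pt t y z)"
    unfolding pt_add[OF t t] using integrable_pt[OF t] by (intro integral_mono integrable_pt_mult_pt t pointwise) simp
  also have "\<dots> = ?Q * survival t x + P * survival t y" using integrable_pt[OF t] by (simp add: survival_def)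
  also have "\<dots> \<le> ?Q * survival t x + P * 1" using P survival_le_1[OF t, of y] by (intro add_left_mono mult_left_mono)
  finally show ?thesis by simp
qed

abbreviation gain :: real where
  "gain \<equiv> 1 - \<delta> / \<alpha>"

lemma gain_pos: "gain > 0"
  using delta by (simp add: divide_less_eq_1)

definition margin :: real where
  "margin = 2 powr (- gain / (2 * (real DIM('a) + \<alpha>)))"

lemma margin_bounds: "0 < margin" "margin < 1"
  using gain_pos alpha by (auto simp: margin_def intro!: powr_less_one divide_neg_pos add_pos_pos)

lemma margin_powr: "margin powr (- (real DIM('a) + \<alpha>)) = 2 powr (gain / 2)"
proof -
  have "- g / (2 * e) * (- e) = g / 2" if "e > 0" for g e :: real using that by simp
  from this[of "real DIM('a) + \<alpha>" gain] show ?thesis using alpha by (simp only: margin_def powr_powr)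
qed

definition far_const :: real where
  "far_const = C0 * survival_const * (1 - margin) powr (- (real DIM('a)
      + \<alpha>)) * 2 powr (- gain) / (1 - 2 powr (- gain / 2))"

lemma gain_factor_less_1: "2 powr (- gain / 2) < 1"
  using gain_pos by (intro powr_less_one) auto

lemma far_const_pos: "far_const > 0"
  using C0 survival_const_ge_1 margin_bounds gain_factor_less_1 by (simp add: far_const_def)

lemma far_const_recursion:
  "C0 * survival_const * (1 - margin) powr (- (real DIM('a) + \<alpha>)) * 2 powr (- gain) + far_const * 2 powr (- gain / 2)
      = far_const"
proof -
  have "D + D / (1 - b) * b = D / (1 - b)" if "b < 1" for D b :: real using that by (simp add: field_simps)
  from this[OF gain_factor_less_1] show ?thesis by (simp only: far_const_def)
qed

text \<open>The mass that \<open>pt (t/2) x\<close> puts inside the ball of radius \<open>\<rho> + margin * a\<close> is at distance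
  \<open>(1 - margin) * a\<close> from \<open>y\<close>; what lies outside is treated at time \<open>t/2\<close> with the smaller distance \<open>margin * a\<close>. Since
  \<open>\<delta> < \<alpha>\<close>, a margin close to \<open>1\<close> makes the iteration contract.\<close>

lemma pt_upper_far_step:
  assumes t: "t > 0" and a: "a > 0" and y: "\<rho> + a \<le> norm y" and rest: "rest \<ge> 0"
    and outside: "\<And>z. \<rho> + margin * a \<le> norm z \<Longrightarrow>
      pt (t / 2) x z \<le> far_const * (norm x powr \<delta> * (t / 2) powr gain) * (margin * a) powr (- (real DIM('a) + \<alpha>))
          + rest"
  shows "pt t x y \<le> far_const * (norm x powr \<delta> * t powr gain) * a powr (- (real DIM('a) + \<alpha>)) + rest"
proof -
  let ?e = "real DIM('a) + \<alpha>" and ?s = "t / 2" and ?h = "norm x powr \<delta>"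
  define g where "g = gain"
  have s: "?s > 0" "?s + ?s = t" using t by auto
  have half: "?s powr g = 2 powr (- g) * t powr g" using t by (simp add: powr_divide powr_minus field_simps)
  let ?P = "far_const * (?h * ?s powr g) * (margin * a) powr (- ?e) + rest"
  have P: "?P \<ge> 0" using far_const_pos rest by simp
  have "a = (\<rho> + a) - (\<rho> + margin * a) + margin * a" by simp
  then have distance: "(1 - margin) * a \<le> norm y - (\<rho> + margin * a)" using y by (simp add: algebra_simps)
  have positive: "(1 - margin) * a > 0" using margin_bounds a by simp
  have "pt t x y \<le> C0 * (?s / (norm y - (\<rho> + margin * a)) powr ?e) * survival ?s x + ?P"
    using pt_le_if_far_le[OF s(1) _ P, of "\<rho> + margin * a" y x] outside distance positive by (simp add: s(2) g_def)
  also have "\<dots> \<le> C0 * (?s / ((1 - margin) * a) powr ?e) * (survival_const * (?h * ?s powr (- \<delta> / \<alpha>))) + ?P"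
    using C0 s distance positive alpha survival_const_ge_1
    by (intro add_right_mono mult_mono mult_left_mono frac_le powr_mono2 survival_le_power) (auto intro: powr_mono2)
  also have "C0 * (?s / ((1 - margin) * a) powr ?e) * (survival_const * (?h * ?s powr (- \<delta> / \<alpha>)))
      = C0 * survival_const * ?h * (1 / ((1 - margin) * a) powr ?e) * (?s * ?s powr (- \<delta> / \<alpha>))" by (simp add: mult_ac)
  also have "1 / ((1 - margin) * a) powr ?e = (1 - margin) powr (- ?e) * a powr (- ?e)"
    using margin_bounds a by (simp add: powr_mult powr_minus_divide del: minus_add_distrib)
  also have "?s * ?s powr (- \<delta> / \<alpha>) = 2 powr (- g) * t powr g"
    unfolding half[symmetric] using s by (simp add: g_def powr_diff powr_minus field_simps)
  also have "(margin * a) powr (- ?e) = 2 powr (g / 2) * a powr (- ?e)"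
    using margin_bounds a by (simp only: powr_mult margin_powr g_def)
  also have "C0 * survival_const * ?h * ((1 - margin) powr (- ?e) * a powr (- ?e)) * (2 powr (- g) * t powr g)
      + (far_const * (?h * ?s powr g) * (2 powr (g / 2) * a powr (- ?e)) + rest)
    = (C0 * survival_const * (1 - margin) powr (- ?e) * 2 powr (- g) + far_const * (2 powr (- g) * 2 powr (g / 2)))
        * (?h * t powr g) * a powr (- ?e) + rest"
    unfolding half by (simp add: algebra_simps)
  also have "2 powr (- g) * 2 powr (g / 2) = 2 powr (- g / 2)" unfolding powr_add[symmetric] by simp
  finally show ?thesis unfolding g_def far_const_recursion .
qed

lemma pt_upper_far_iterate:
  assumes \<rho>: "\<rho> > 0" "2 * norm x \<le> \<rho>"
  shows "t > 0 \<Longrightarrow> a > 0 \<Longrightarrow> \<rho> + a \<le> norm y \<Longrightarrow>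
    pt t x y \<le> far_const * (norm x powr \<delta> * t powr gain) * a powr (- (real DIM('a) + \<alpha>))
      + C0 * (t / 2 ^ n) * (\<rho> / 2) powr (- (real DIM('a) + \<alpha>))"
proof (induction n arbitrary: t a y)
  case 0
  let ?e = "real DIM('a) + \<alpha>"
  have gap: "\<rho> / 2 \<le> norm (x - y)" using \<rho> 0 norm_triangle_ineq2[of y x] by (simp add: norm_minus_commute)
  then have "x - y \<noteq> 0" using \<rho> by auto
  have "pt t x y \<le> C0 * profile t (x - y)" by (rule pt_le_profile[OF 0(1)])
  also have "\<dots> \<le> C0 * (t / norm (x - y) powr ?e)"
    using C0 stable_profile_le_tail[OF \<open>x - y \<noteq> 0\<close>] by (intro mult_left_mono) auto
  also have "\<dots> \<le> C0 * (t / (\<rho> / 2) powr ?e)"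
    using C0 0 \<rho> gap alpha by (intro mult_left_mono frac_le powr_mono2) auto
  also have "\<dots> = C0 * (t / 2 ^ 0) * (\<rho> / 2) powr (- ?e)" by (simp add: powr_minus_divide del: minus_add_distrib)
  finally show ?case using far_const_pos by (simp add: add_increasing)
next
  case (Suc n)
  show ?case
  proof (rule pt_upper_far_step[OF Suc.prems])
    show "0 \<le> C0 * (t / 2 ^ Suc n) * (\<rho> / 2) powr (- (real DIM('a) + \<alpha>))" using C0 Suc.prems by simp
    fix z :: 'a assume z: "\<rho> + margin * a \<le> norm z"
    have "t / 2 > 0" "margin * a > 0" using Suc.prems margin_bounds by simp_all
    from Suc.IH[OF this z]
    show "pt (t / 2) x z \<le> far_const * (norm x powr \<delta> * (t / 2) powr gain) * (margin * a) powr (- (real DIM('a) + \<alpha>))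
        + C0 * (t / 2 ^ Suc n) * (\<rho> / 2) powr (- (real DIM('a) + \<alpha>))" by simp
  qed
qed

lemma pt_upper_far:
  assumes t: "t > 0" and y: "4 * norm x \<le> norm y" "y \<noteq> 0"
  shows "pt t x y \<le> far_const * 2 powr (real DIM('a)
      + \<alpha>) * (norm x powr \<delta> * t powr (- \<delta> / \<alpha>)) * (t / norm y powr (real DIM('a) + \<alpha>))"
proof -
  let ?e = "real DIM('a) + \<alpha>" and ?R = "norm y / 2"
  let ?b = "far_const * (norm x powr \<delta> * t powr gain) * ?R powr (- ?e)"
  have R: "?R > 0" using y by simp
  have iterate: "pt t x y \<le> ?b + C0 * (t * (1 / 2) ^ n) * (?R / 2) powr (- ?e)" for n
    using pt_upper_far_iterate[OF R _ t R, of x y n] y by (simp add: power_one_over)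
  have "(\<lambda>n. ?b + C0 * (t * (1 / 2) ^ n) * (?R / 2) powr (- ?e)) \<longlonglongrightarrow> ?b + C0 * (t * 0) * (?R / 2) powr (- ?e)"
    by (intro tendsto_intros LIMSEQ_power_zero) auto
  then have "pt t x y \<le> ?b + C0 * (t * 0) * (?R / 2) powr (- ?e)"
    by (rule tendsto_lowerbound) (use iterate in auto)
  also have "\<dots> = ?b" by simp
  also have "t powr gain = t powr (- \<delta> / \<alpha>) * t" using t by (simp add: powr_diff powr_minus field_simps)
  also have "?R powr (- ?e) = 2 powr ?e / norm y powr ?e" by (simp only: powr_minus_divide powr_divide) simp
  finally show ?thesis by (simp only: mult_ac times_divide_eq_left times_divide_eq_right)
qed

definition sharp_profile :: "real \<Rightarrow> 'a \<Rightarrow> 'a \<Rightarrow> real" where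
  "sharp_profile t x y = boundary_decay t x * boundary_decay t y * profile t (x - y)"

lemma sharp_profile_nonneg: "t > 0 \<Longrightarrow> 0 \<le> sharp_profile t x y"
  by (simp add: sharp_profile_def profile_nonneg)

lemma sharp_profile_commute: "sharp_profile t x y = sharp_profile t y x"
  by (simp add: sharp_profile_def stable_profile_minus_commute[of \<alpha> t x])

lemma pt_upper_far_near_origin:
  assumes t: "t > 0" and x: "norm x \<le> scale t" and xy: "8 * scale t < norm (x - y)"
  shows "pt t x y \<le> far_const * 4 powr (real DIM('a) + \<alpha>) * sharp_profile t x y"
proof -
  let ?e = "real DIM('a) + \<alpha>"
  have scale: "scale t > 0" using t by simp
  have y: "7 * scale t < norm y" using x xy norm_triangle_ineq4[of x y] by linarith
  then have ordered: "4 * norm x \<le> norm y" "scale t \<le> norm y" using x scale by linarith+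
  have nonzero: "y \<noteq> 0" "x - y \<noteq> 0" using y scale xy by auto
  have "norm (x - y) \<le> 2 * norm y" using x y scale norm_triangle_ineq4[of x y] by linarith
  then have "2 powr ?e * (t / (2 * norm y) powr ?e) \<le> 2 powr ?e * (t / norm (x - y) powr ?e)"
    using t nonzero alpha by (intro mult_left_mono frac_le powr_mono2) auto
  also have "\<dots> \<le> 2 powr ?e * profile t (x - y)"
  proof (intro mult_left_mono profile_ge_tail[OF t])
    show "scale t \<le> norm (x - y)" using xy scale by linarith
  qed simp
  finally have tail: "t / norm y powr ?e \<le> 2 powr ?e * profile t (x - y)" by (simp add: powr_mult)
  have "pt t x y \<le> far_const * 2 powr ?e * (norm x powr \<delta> * t powr (- \<delta> / \<alpha>)) * (t / norm y powr ?e)"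
    by (rule pt_upper_far[OF t ordered(1) nonzero(1)])
  also have "\<dots> = far_const * 2 powr ?e * boundary_decay t x * (t / norm y powr ?e)"
    by (simp add: boundary_decay_eq_power[OF t x])
  also have "\<dots> \<le> far_const * 2 powr ?e * boundary_decay t x * (2 powr ?e * profile t (x - y))"
    using far_const_pos by (intro mult_left_mono tail) auto
  also have "\<dots> = far_const * (2 powr ?e * 2 powr ?e) * sharp_profile t x y"
    by (simp add: sharp_profile_def boundary_decay_eq_1[OF t ordered(2)] mult_ac)
  also have "2 powr ?e * 2 powr ?e = (4::real) powr ?e" by (simp flip: powr_mult)
  finally show ?thesis .
qed

definition upper_const :: real where
  "upper_const = near_upper_const * 8 powr (real DIM('a) + \<alpha>) + far_const * 4 powr (real DIM('a) + \<alpha>) + C0"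

lemma upper_const_ge:
  "near_upper_const * 8 powr (real DIM('a) + \<alpha>) \<le> upper_const" "far_const * 4 powr (real DIM('a) + \<alpha>) \<le> upper_const" "C0
      \<le> upper_const"
  using near_upper_const_pos far_const_pos C0 by (simp_all add: upper_const_def)

theorem pt_upper:
  assumes t: "t > 0"
  shows "pt t x y \<le> upper_const * sharp_profile t x y"
proof -
  have far: "pt t x y \<le> upper_const * sharp_profile t x y" if "norm x \<le> scale t" "8 * scale t < norm (x - y)" for x y
    using order_trans[OF pt_upper_far_near_origin[OF t that]]
      mult_right_mono[OF upper_const_ge(2) sharp_profile_nonneg[OF t]] .
  consider (near) "norm (x - y) \<le> 8 * scale t"
    | (x_near_origin) "8 * scale t < norm (x - y)" "norm x \<le> scale t"
    | (y_near_origin) "8 * scale t < norm (x - y)" "norm y \<le> scale t"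
    | (away) "scale t \<le> norm x" "scale t \<le> norm y" by linarith
  then show ?thesis
  proof cases
    case near
    let ?H = "boundary_decay t x * boundary_decay t y"
    have "near_upper_const * ?H * t powr (- real DIM('a) / \<alpha>)
        \<le> near_upper_const * ?H * (8 powr (real DIM('a) + \<alpha>) * profile t (x - y))"
      using near_upper_const_pos by (intro mult_left_mono profile_ge_near[OF t _ near]) auto
    then have "pt t x y \<le> near_upper_const * 8 powr (real DIM('a) + \<alpha>) * sharp_profile t x y"
      using pt_upper_near[OF t, of x y] by (simp add: sharp_profile_def mult_ac)
    then show ?thesis using mult_right_mono[OF upper_const_ge(1) sharp_profile_nonneg[OF t, of x y]] by linarith
  next
    case x_near_origin
    then show ?thesis by (intro far)
  next
    case y_near_origin
    then show ?thesis using far[of y x]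
      by (simp add: pt_commute[OF t, of x y] sharp_profile_commute[of t x y] norm_minus_commute)
  next
    case away
    have "pt t x y \<le> C0 * sharp_profile t x y"
      using pt_le_profile[OF t, of x y] boundary_decay_eq_1[OF t] away by (simp add: sharp_profile_def)
    then show ?thesis using mult_right_mono[OF upper_const_ge(3) sharp_profile_nonneg[OF t, of x y]] by linarith
  qed
qed

end

section \<open>The sharp lower bound\<close>

context fk_kernel
begin

lemma boundary_decay_scale:
  assumes "t > 0" "norm x \<le> scale t"
  shows "boundary_decay t x * t powr (\<delta> / \<alpha>) = norm x powr \<delta>"
  using assms by (simp add: boundary_decay_eq_power powr_minus)

lemma killed_mono: "(\<And>z. f z \<le> g z) \<Longrightarrow> killed t f x \<le> killed t g x"
  by (intro killed_mono_AE) simp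

definition inner_radius :: real where
  "inner_radius = (1 / (4 * upper_const * unit_ball_vol (real DIM('a)))) powr (1 / (real DIM('a) + \<delta>))"

definition outer_radius :: real where
  "outer_radius = max 2
    ((4 * upper_const * 2 powr (real DIM('a) + \<alpha>) * (sphere_area TYPE('a) / (\<alpha> - \<delta>))) powr (1 / (\<alpha> - \<delta>)))"

lemma upper_const_pos: "upper_const > 0"
  using upper_const_ge(3) C0 by linarith

lemma unit_ball_vol_neq_0: "n \<ge> 0 \<Longrightarrow> unit_ball_vol n \<noteq> 0"
  by (rule less_imp_neq[OF unit_ball_vol_pos, symmetric])

lemma inner_radius_pos: "inner_radius > 0"
  using upper_const_pos by (simp add: inner_radius_def unit_ball_vol_neq_0)

lemma inner_radius_powr: "upper_const * unit_ball_vol (real DIM('a)) * inner_radius powr (real DIM('a) + \<delta>) = 1 / 4"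
proof -
  have "real DIM('a) + \<delta> \<noteq> 0" using delta dim_ge_1 by linarith
  then show ?thesis using upper_const_pos by (simp add: inner_radius_def powr_powr unit_ball_vol_neq_0)
qed

lemma outer_radius_ge_2: "outer_radius \<ge> 2"
  by (simp add: outer_radius_def)

lemma outer_radius_powr:
  "upper_const * 2 powr (real DIM('a) + \<alpha>) * (sphere_area TYPE('a) / (\<alpha> - \<delta>)) * outer_radius powr (\<delta> - \<alpha>) \<le> 1 / 4"
proof -
  define Q where "Q = 4 * upper_const * 2 powr (real DIM('a) + \<alpha>) * (sphere_area TYPE('a) / (\<alpha> - \<delta>))"
  have "Q \<ge> 0" using upper_const_pos delta by (simp add: Q_def)
  then have "Q = (Q powr (1 / (\<alpha> - \<delta>))) powr (\<alpha> - \<delta>)" using delta by (simp add: powr_powr)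
  also have "\<dots> \<le> outer_radius powr (\<alpha> - \<delta>)" using delta by (intro powr_mono2) (auto simp: outer_radius_def Q_def)
  finally have "Q * outer_radius powr (\<delta> - \<alpha>) \<le> outer_radius powr (\<alpha> - \<delta>) * outer_radius powr (\<delta> - \<alpha>)"
    by (intro mult_right_mono) auto
  also have "\<dots> = 1" unfolding powr_add[symmetric] using outer_radius_ge_2 by simp
  finally show ?thesis by (simp add: Q_def mult_ac)
qed

lemma pt_le_boundary_decay_profile: "t > 0 \<Longrightarrow> pt t x z \<le> upper_const * (boundary_decay t x * profile t (x - z))"
  using pt_upper[of t x z] mult_right_le_one_le[of "boundary_decay t x" "boundary_decay t z"]
    mult_right_mono[of "boundary_decay t x * boundary_decay t z" "boundary_decay t x" "profile t (x - z)"]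
    upper_const_pos boundary_decay_le_1[of t z] profile_nonneg[of t "x - z"]
  by (auto simp: sharp_profile_def intro: order_trans mult_left_mono)

lemma killed_norm_powr_inner_le:
  assumes t: "t > 0" and x: "norm x \<le> scale t"
  shows "killed t (\<lambda>z. norm_powr z * indicator (cball 0 (inner_radius * scale t)) z) x \<le> ennreal (norm x powr \<delta> / 4)"
proof -
  let ?d = "real DIM('a)" and ?R = "inner_radius * scale t"
  let ?b = "upper_const * (boundary_decay t x * t powr (- ?d / \<alpha>)) * ?R powr \<delta>"
  have R: "?R > 0" using inner_radius_pos t by simp
  have "pt t x z * norm z powr \<delta> \<le> ?b" if "norm z \<le> ?R" for z
  proof (intro mult_mono powr_mono2)
    have "upper_const * (boundary_decay t x * profile t (x - z))
        \<le> upper_const * (boundary_decay t x * t powr (- ?d / \<alpha>))"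
      using upper_const_pos stable_profile_le_sup[of \<alpha> t "x - z"] by (intro mult_left_mono) auto
    then show "pt t x z \<le> upper_const * (boundary_decay t x * t powr (- ?d / \<alpha>))"
      by (rule order_trans[OF pt_le_boundary_decay_profile[OF t]])
  qed (use that delta upper_const_pos in auto)
  then have "killed t (\<lambda>z. norm_powr z * indicator (cball 0 ?R) z) x \<le> (\<integral>\<^sup>+z\<in>cball (0::'a) ?R. ennreal ?b \<partial>lborel)"
    unfolding killed_def using t by (intro nn_integral_mono) (auto simp: indicator_def intro: ennreal_leI simp
        flip: ennreal_mult)
  also have "\<dots> = ennreal (?b * (unit_ball_vol ?d * ?R powr ?d))"
    using R upper_const_pos by (simp add: nn_integral_cmult_indicator borel_closed emeasure_cball powr_realpow
        flip: ennreal_mult)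
  also have "?b * (unit_ball_vol ?d * ?R powr ?d)
      = (upper_const * unit_ball_vol ?d * inner_radius powr (?d + \<delta>)) * (boundary_decay t x * t powr (\<delta> / \<alpha>))"
    using t inner_radius_pos by (simp add: powr_mult powr_powr powr_add powr_minus)
  also have "\<dots> = norm x powr \<delta> / 4" unfolding inner_radius_powr boundary_decay_scale[OF assms] by simp
  finally show ?thesis .
qed

lemma pt_mult_norm_powr_le_tail:
  assumes t: "t > 0" and x: "norm x \<le> scale t" and z: "2 * scale t \<le> norm z"
  shows "pt t x z * norm z powr \<delta>
    \<le> upper_const * 2 powr (real DIM('a) + \<alpha>) * (boundary_decay t x * t) * norm z powr (- (real DIM('a) + \<alpha> - \<delta>))"
proof -
  let ?e = "real DIM('a) + \<alpha>"
  have "scale t > 0" using t by simp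
  then have half: "norm z / 2 \<le> norm (x - z)" "0 < norm z / 2"
    using z x norm_triangle_ineq2[of z x] norm_minus_commute[of z x] by linarith+
  then have "x - z \<noteq> 0" by auto
  then have "profile t (x - z) \<le> t / norm (x - z) powr ?e" by (rule stable_profile_le_tail)
  also have "\<dots> \<le> t / (norm z / 2) powr ?e" using t half alpha by (intro frac_le powr_mono2) auto
  also have "\<dots> = 2 powr ?e * t * norm z powr (- ?e)" by (simp add: powr_divide powr_minus_divide del: minus_add_distrib)
  finally have "upper_const * (boundary_decay t x * profile t (x - z))
      \<le> upper_const * (boundary_decay t x * (2 powr ?e * t * norm z powr (- ?e)))"
    using upper_const_pos by (intro mult_left_mono) auto
  also have "\<dots> = upper_const * 2 powr ?e * (boundary_decay t x * t) * norm z powr (- ?e)" by (simp only: mult_ac)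
  finally have "pt t x z * norm z powr \<delta>
      \<le> upper_const * 2 powr ?e * (boundary_decay t x * t) * norm z powr (- ?e) * norm z powr \<delta>"
    by (intro mult_right_mono order_trans[OF pt_le_boundary_decay_profile[OF t]]) auto
  moreover have "norm z powr (- ?e) * norm z powr \<delta> = norm z powr (- (?e - \<delta>))"
    unfolding powr_add[symmetric] by (simp add: algebra_simps)
  ultimately show ?thesis by (simp only: mult.assoc)
qed

lemma killed_norm_powr_outer_le:
  assumes t: "t > 0" and x: "norm x \<le> scale t"
  shows "killed t (\<lambda>z. norm_powr z * indicator {z. outer_radius * scale t \<le> norm z} z) x \<le> ennreal (norm x powr \<delta> / 4)"
proof -
  let ?e = "real DIM('a) + \<alpha>" and ?R = "outer_radius * scale t" and ?S = "sphere_area TYPE('a) / (\<alpha> - \<delta>)"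
  define b where "b = upper_const * 2 powr ?e * (boundary_decay t x * t)"
  have scale: "scale t > 0" using t by simp
  then have R: "2 * scale t \<le> ?R" using outer_radius_ge_2 by (intro mult_right_mono) auto
  have b: "b \<ge> 0" using upper_const_pos t by (simp add: b_def)
  have pointwise: "pt t x z * norm z powr \<delta> \<le> b * norm z powr (- (?e - \<delta>))" if "?R \<le> norm z" for z
    unfolding b_def by (rule pt_mult_norm_powr_le_tail[OF t x]) (use R that in linarith)
  have "killed t (\<lambda>z. norm_powr z * indicator {z. ?R \<le> norm z} z) x
      \<le> (\<integral>\<^sup>+z. ennreal b * (ennreal (norm z powr (- (?e - \<delta>))) * indicator {z::'a. ?R \<le> norm z} z) \<partial>lborel)"
    unfolding killed_def using t b pointwise
    by (intro nn_integral_mono) (auto simp: indicator_def intro: ennreal_leI simp flip: ennreal_mult)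
  also have "\<dots> = ennreal (b * (?S * ?R powr (\<delta> - \<alpha>)))"
    using nn_integral_norm_powr_outside[where 'a='a, of "?e - \<delta>" ?R] delta scale R b
    by (simp add: nn_integral_cmult flip: ennreal_mult')
  also have "b * (?S * ?R powr (\<delta> - \<alpha>))
      = (upper_const * 2 powr ?e * ?S * outer_radius powr (\<delta> - \<alpha>)) * (boundary_decay t x * t powr (\<delta> / \<alpha>))"
  proof -
    have scale_powr: "t powr (\<delta> / \<alpha>) = t * scale t powr (\<delta> - \<alpha>)"
      using t alpha by (simp add: powr_powr diff_divide_distrib powr_diff)
    have "?R powr (\<delta> - \<alpha>) = outer_radius powr (\<delta> - \<alpha>) * scale t powr (\<delta> - \<alpha>)"
      using outer_radius_ge_2 by (simp add: powr_mult)
    then show ?thesis by (simp only: b_def scale_powr mult_ac)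
  qed
  also have "\<dots> \<le> 1 / 4 * norm x powr \<delta>"
    unfolding boundary_decay_scale[OF assms] by (intro mult_right_mono outer_radius_powr) simp
  finally show ?thesis by (simp add: ennreal_leI)
qed

definition annulus :: "real \<Rightarrow> 'a set" where
  "annulus t = {z. inner_radius * scale t \<le> norm z \<and> norm z \<le> outer_radius * scale t}"

lemma annulus_measurable [measurable]: "annulus t \<in> sets borel"
  unfolding annulus_def by measurable

definition annulus_mass_const :: real where
  "annulus_mass_const = outer_radius powr (- \<delta>) / 2"

text \<open>The invariance of \<open>|z|\<^sup>\<delta>\<close> forces mass into the annulus: by the upper bound, the small ball and the
  complement of the large ball together carry at most half of \<open>\<integral> pt t x z |z|\<^sup>\<delta> dz = |x|\<^sup>\<delta>\<close>.\<close>

lemma annulus_mass: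
  assumes t: "t > 0" and x: "norm x \<le> scale t"
  shows "annulus_mass_const * boundary_decay t x \<le> (LINT z|lborel. indicator (annulus t) z * pt t x z)"
proof -
  note [measurable] = measurable_pt[OF t, of x]
  have [measurable]: "cball (0::'a) r \<in> sets borel" for r by (simp add: borel_closed)
  let ?inner = "\<lambda>z. norm_powr z * indicator (cball 0 (inner_radius * scale t)) z"
  let ?outer = "\<lambda>z. norm_powr z * indicator {z. outer_radius * scale t \<le> norm z} z"
  let ?R = "outer_radius * scale t" and ?mass = "LINT z|lborel. indicator (annulus t) z * pt t x z"
  have mass: "killed t (indicator (annulus t)) x = ennreal ?mass"
    using integrable_mult_indicator[OF _ integrable_pt[OF t, of x], of "annulus t"] t
    unfolding killed_def by (subst nn_integral_eq_integral[symmetric]) (auto simp: indicator_def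
        intro!: nn_integral_cong)
  have mass_nonneg: "?mass \<ge> 0" using t by (simp add: indicator_def)
  have "norm_powr z \<le> ennreal (?R powr \<delta>) * indicator (annulus t) z + (?inner z + ?outer z)" for z
    using delta outer_radius_ge_2 by (auto simp: annulus_def indicator_def intro!: ennreal_leI powr_mono2)
  then have "killed t norm_powr x
      \<le> killed t (\<lambda>z. ennreal (?R powr \<delta>) * indicator (annulus t) z + (?inner z + ?outer z)) x"
    by (rule killed_mono)
  also have "\<dots> = ennreal (?R powr \<delta>) * killed t (indicator (annulus t)) x + (killed t ?inner x + killed t ?outer x)"
    by (simp add: killed_add[OF t] killed_cmult[OF t])
  also have "\<dots> \<le> ennreal (?R powr \<delta>) * ennreal ?mass + (ennreal (norm x powr \<delta> / 4) + ennreal (norm x powr \<delta> / 4))"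
    unfolding mass by (intro add_mono order_refl killed_norm_powr_inner_le killed_norm_powr_outer_le t x)
  also have "\<dots> = ennreal (?R powr \<delta> * ?mass + norm x powr \<delta> / 2)"
    using mass_nonneg by (simp flip: ennreal_mult' ennreal_plus)
  finally have "norm_powr x \<le> ennreal (?R powr \<delta> * ?mass + norm x powr \<delta> / 2)" by (simp only: killed_norm_powr[OF t])
  then have "norm x powr \<delta> \<le> ?R powr \<delta> * ?mass + norm x powr \<delta> / 2"
    using mass_nonneg by (subst (asm) ennreal_le_iff) auto
  then have "?R powr (- \<delta>) * (norm x powr \<delta> / 2) \<le> ?R powr (- \<delta>) * (?R powr \<delta> * ?mass)"
    by (intro mult_left_mono) auto
  also have "?R powr (- \<delta>) * (?R powr \<delta> * ?mass) = (?R powr (- \<delta>) * ?R powr \<delta>) * ?mass" by simp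
  also have "?R powr (- \<delta>) * ?R powr \<delta> = 1" using outer_radius_ge_2 t unfolding powr_add[symmetric] by simp
  also have "?R powr (- \<delta>) * (norm x powr \<delta> / 2) = annulus_mass_const * boundary_decay t x"
    using t outer_radius_ge_2
    by (simp add: annulus_mass_const_def boundary_decay_scale[OF assms, symmetric] powr_mult powr_powr powr_minus)
  finally show ?thesis by simp
qed

definition spread_const :: real where
  "spread_const = 2 powr (1 + real DIM('a) / \<alpha>) * (outer_radius + 2) powr (real DIM('a) + \<alpha>)"

lemma spread_const_pos: "spread_const > 0"
  using outer_radius_ge_2 by (simp add: spread_const_def)

lemma profile_double_le_annulus:
  assumes t: "t > 0" and x: "norm x \<le> scale t" and z: "z \<in> annulus t"
  shows "profile (2 * t) (x - y) \<le> spread_const * profile t (z - y)"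
proof -
  have "norm (z - y) \<le> norm (x - y) + norm (z - x)" using norm_triangle_ineq[of "x - y" "z - x"]
    by (simp add: algebra_simps)
  also have "norm (z - x) \<le> (outer_radius + 1) * scale t"
    using z x norm_triangle_ineq4[of z x] by (simp add: annulus_def algebra_simps)
  finally have "profile t (x - y) \<le> (outer_radius + 1 + 1) powr (real DIM('a) + \<alpha>) * profile t (z - y)"
    using outer_radius_ge_2 by (intro profile_le_shift[OF t]) auto
  then have shift: "profile t (x - y) \<le> (outer_radius + 2) powr (real DIM('a) + \<alpha>) * profile t (z - y)"
    by (simp add: add.assoc)
  have "profile (2 * t) (x - y) \<le> 2 powr (1 + real DIM('a) / \<alpha>) * 1 powr (real DIM('a) + \<alpha>) * profile t (x - y)"
    using t alpha by (intro stable_profile_compare) auto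
  also have "\<dots> \<le> 2 powr (1 + real DIM('a) / \<alpha>) * ((outer_radius + 2) powr (real DIM('a) + \<alpha>) * profile t (z - y))"
    using shift by simp
  finally show ?thesis by (simp add: spread_const_def mult.assoc)
qed

lemma pt_ge_via_annulus:
  assumes t: "t > 0" and x: "norm x \<le> scale t" and L: "L \<ge> 0"
    and away: "\<And>z. inner_radius * scale t \<le> norm z \<Longrightarrow> L * profile t (z - y) \<le> pt t z y"
  shows "annulus_mass_const / spread_const * (L * (boundary_decay t x * profile (2 * t) (x - y))) \<le> pt (2 * t) x y"
proof -
  let ?Q = "L * (profile (2 * t) (x - y) / spread_const)"
  have Q: "?Q \<ge> 0" using L spread_const_pos profile_nonneg[of "2 * t" "x - y"] t by simp
  have lower: "?Q \<le> pt t z y" if z: "z \<in> annulus t" for z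
  proof -
    have "profile (2 * t) (x - y) / spread_const \<le> profile t (z - y)"
      using profile_double_le_annulus[OF t x z, of y] spread_const_pos by (simp add: pos_divide_le_eq mult.commute)
    then have "?Q \<le> L * profile t (z - y)" using L by (rule mult_left_mono)
    then show ?thesis using away[of z] z by (simp add: annulus_def)
  qed
  have integrable_annulus: "integrable lborel (\<lambda>z. indicator (annulus t) z * pt t x z)"
    using integrable_mult_indicator[OF _ integrable_pt[OF t, of x], of "annulus t"] by simp
  have "?Q * (annulus_mass_const * boundary_decay t x) \<le> ?Q * (LINT z|lborel. indicator (annulus t) z * pt t x z)"
    by (rule mult_left_mono[OF annulus_mass[OF t x] Q])
  also have "\<dots> = (LINT z|lborel. ?Q * (indicator (annulus t) z * pt t x z))" by simp
  also have "\<dots> \<le> (LINT z|lborel. pt t x z * pt t z y)"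
  proof (rule integral_mono[OF integrable_mult_right[OF integrable_annulus] integrable_pt_mult_pt[OF t t]])
    show "?Q * (indicator (annulus t) z * pt t x z) \<le> pt t x z * pt t z y" for z
    proof (cases "z \<in> annulus t")
      case True
      then show ?thesis using mult_left_mono[OF lower[OF True] pt_nonneg[OF t, of x z]] by (simp add: mult.commute)
    qed (use t in simp)
  qed
  also have "\<dots> = pt (2 * t) x y" by (simp only: mult_2 pt_add[OF t t])
  finally show ?thesis by (simp add: mult_ac)
qed

definition lower_factor :: real where
  "lower_factor = min 1 (annulus_mass_const / spread_const)"

lemma lower_factor_bounds: "0 < lower_factor" "lower_factor \<le> 1" "lower_factor \<le> annulus_mass_const / spread_const"
  using spread_const_pos outer_radius_ge_2 by (auto simp: lower_factor_def annulus_mass_const_def)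

definition away_radius :: real where
  "away_radius = min inner_radius (2 powr (- 1 / \<alpha>))"

lemma away_radius_bounds: "0 < away_radius" "away_radius \<le> inner_radius" "away_radius \<le> 2 powr (- 1 / \<alpha>)"
  using inner_radius_pos by (auto simp: away_radius_def)

text \<open>A lower bound for starting points away from the origin propagates to all starting points through the
  annulus. It is used first with a weight supported away from the origin in \<open>y\<close> and then, by symmetry of \<open>pt\<close>,
  with the outcome as the weight.\<close>

lemma pt_lower_propagate:
  assumes w_nonneg: "\<And>t y. t > 0 \<Longrightarrow> 0 \<le> w t y"
    and w_antimono: "\<And>s t y. 0 < s \<Longrightarrow> s \<le> t \<Longrightarrow> w t y \<le> w s y"
    and away: "\<And>t x y. t > 0 \<Longrightarrow> away_radius * scale t \<le> norm x \<Longrightarrow> w t y * profile t (x - y) \<le> pt t x y"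
    and t: "t > 0"
  shows "lower_factor * w t y * (boundary_decay t x * profile t (x - y)) \<le> pt t x y"
proof (cases "norm x \<le> scale (t / 2)")
  case True
  let ?s = "t / 2"
  have s: "?s > 0" using t by simp
  have "annulus_mass_const / spread_const * (w t y * (boundary_decay ?s x * profile (2 * ?s) (x - y)))
      \<le> pt (2 * ?s) x y"
  proof (rule pt_ge_via_annulus[OF s True w_nonneg[OF t]])
    fix z :: 'a assume "inner_radius * scale ?s \<le> norm z"
    then have "away_radius * scale ?s \<le> norm z" using mult_right_mono[OF away_radius_bounds(2), of "scale ?s"] by simp
    then have "w ?s y * profile ?s (z - y) \<le> pt ?s z y" by (rule away[OF s])
    then show "w t y * profile ?s (z - y) \<le> pt ?s z y"
      using mult_right_mono[OF w_antimono[OF s] profile_nonneg[OF s], of t y "z - y"] t by simp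
  qed
  moreover have "lower_factor * (w t y * (boundary_decay t x * profile t (x - y)))
      \<le> annulus_mass_const / spread_const * (w t y * (boundary_decay ?s x * profile t (x - y)))"
    using t lower_factor_bounds w_nonneg[OF t, of y] profile_nonneg[OF t, of "x - y"] boundary_decay_antimono[of ?s t x]
    by (intro mult_mono mult_left_mono mult_right_mono mult_nonneg_nonneg) auto
  ultimately show ?thesis by (simp add: mult.assoc)
next
  case False
  have "scale (t / 2) = 2 powr (- 1 / \<alpha>) * scale t" using t by (simp add: powr_divide powr_minus_divide)
  then have "away_radius * scale t \<le> norm x" using False mult_right_mono[OF away_radius_bounds(3), of "scale t"] by simp
  then have "w t y * profile t (x - y) \<le> pt t x y" by (rule away[OF t])
  moreover have "(lower_factor * boundary_decay t x) * (w t y * profile t (x - y)) \<le> 1 * (w t y * profile t (x - y))"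
    using lower_factor_bounds boundary_decay_le_1[OF t] w_nonneg[OF t] profile_nonneg[OF t]
    by (intro mult_right_mono mult_le_one mult_nonneg_nonneg) auto
  ultimately show ?thesis by (simp add: mult_ac)
qed

definition away_lower_const :: real where
  "away_lower_const = away_const away_radius / C0"

lemma away_lower_const_pos: "away_lower_const > 0"
  using away_const_pos C0 by (simp add: away_lower_const_def)

lemma pt_lower_away:
  assumes "t > 0" "away_radius * scale t \<le> norm x" "away_radius * scale t \<le> norm y"
  shows "away_lower_const * profile t (x - y) \<le> pt t x y"
proof -
  have "away_lower_const * profile t (x - y) \<le> away_const away_radius * p t (y - x)"
    using mult_left_mono[OF p_lower[OF assms(1), of "y - x"] less_imp_le[OF away_const_pos]]
    by (simp add: away_lower_const_def stable_profile_minus_commute[of \<alpha> t x y])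
  also have "\<dots> \<le> pt t x y" by (rule pt_ge_away[OF away_radius_bounds(1) assms])
  finally show ?thesis .
qed

lemma pt_lower_away_left:
  assumes t: "t > 0" and y: "away_radius * scale t \<le> norm y"
  shows "lower_factor * away_lower_const * (boundary_decay t x * profile t (x - y)) \<le> pt t x y"
proof -
  let ?w = "\<lambda>t y. if away_radius * scale t \<le> norm y then away_lower_const else 0"
  have "lower_factor * ?w t y * (boundary_decay t x * profile t (x - y)) \<le> pt t x y"
  proof (rule pt_lower_propagate[OF _ _ _ t])
    show "?w t y \<le> ?w s y" if s: "0 < s" "s \<le> t" for s t and y :: 'a
    proof -
      have "away_radius * scale s \<le> away_radius * scale t"
        using s alpha away_radius_bounds by (intro mult_left_mono powr_mono2) auto
      then show ?thesis using away_lower_const_pos by auto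
    qed
  qed (use pt_lower_away away_lower_const_pos in auto)
  then show ?thesis using y by simp
qed

definition lower_const :: real where
  "lower_const = lower_factor * (lower_factor * away_lower_const)"

lemma lower_const_pos: "lower_const > 0"
  using lower_factor_bounds(1) away_lower_const_pos by (simp add: lower_const_def)

theorem pt_lower:
  assumes t: "t > 0"
  shows "lower_const * sharp_profile t x y \<le> pt t x y"
proof -
  let ?b = "lower_factor * away_lower_const"
  have b: "?b > 0" using lower_factor_bounds(1) away_lower_const_pos by simp
  have "lower_factor * (?b * boundary_decay t y) * (boundary_decay t x * profile t (x - y)) \<le> pt t x y"
  proof (rule pt_lower_propagate[OF _ _ _ t])
    show "?b * boundary_decay t y \<le> ?b * boundary_decay s y" if "0 < s" "s \<le> t" for s t and y :: 'a
      using that b by (intro mult_left_mono boundary_decay_antimono) auto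
    show "?b * boundary_decay t y * profile t (x - y) \<le> pt t x y" if "t > 0" "away_radius * scale t \<le> norm x" for t x y
      using pt_lower_away_left[OF that, of y] pt_commute[OF that(1), of x y]
      by (simp add: stable_profile_minus_commute[of \<alpha> t x y] mult.assoc)
  qed (use b in simp)
  then show ?thesis by (simp add: lower_const_def sharp_profile_def mult_ac)
qed

section \<open>Joint continuity\<close>

lemma pt_tendsto_0:
  assumes T: "(T \<longlongrightarrow> t) F" "t > 0" and Z: "(Z \<longlongrightarrow> 0) F"
  shows "((\<lambda>v. pt (T v) (Z v) (Y v)) \<longlongrightarrow> 0) F"
proof (rule Lim_null_comparison)
  let ?bound = "\<lambda>t x. near_upper_const * t powr (- real DIM('a) / \<alpha>) * (norm x powr \<delta> * t powr (- \<delta> / \<alpha>))"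
  have "\<forall>\<^sub>F v in F. T v > 0" by (rule order_tendstoD(1)[OF T])
  then show "\<forall>\<^sub>F v in F. norm (pt (T v) (Z v) (Y v)) \<le> ?bound (T v) (Z v)"
  proof eventually_elim
    case (elim v)
    have "boundary_decay (T v) (Z v) * boundary_decay (T v) (Y v) \<le> norm (Z v) powr \<delta> * T v powr (- \<delta> / \<alpha>) * 1"
      using elim by (intro mult_mono boundary_decay_le_power boundary_decay_le_1) auto
    then have "near_upper_const * T v powr (- real DIM('a) / \<alpha>)
        * (boundary_decay (T v) (Z v) * boundary_decay (T v) (Y v)) \<le> ?bound (T v) (Z v)"
      using near_upper_const_pos by (intro mult_left_mono) auto
    then show ?case using pt_upper_near[OF elim, of "Z v" "Y v"] elim by simp
  qed
  have "((\<lambda>v. ?bound (T v) (Z v)) \<longlongrightarrow> near_upper_const * t powr (- real DIM('a) / \<alpha>)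
      * (norm (0::'a) powr \<delta> * t powr (- \<delta> / \<alpha>))) F"
    using T delta by (intro tendsto_mult tendsto_const tendsto_powr tendsto_powr' tendsto_norm Z) auto
  then show "((\<lambda>v. ?bound (T v) (Z v)) \<longlongrightarrow> 0) F" by simp
qed

theorem continuous_pt: "continuous_on ({0<..} \<times> UNIV \<times> UNIV) (\<lambda>(t, x, y). pt t x y)"
  unfolding continuous_on_def
proof (rule ballI)
  fix u :: "real \<times> 'a \<times> 'a" assume "u \<in> {0<..} \<times> UNIV \<times> UNIV"
  then obtain t x y where u: "u = (t, x, y)" and t: "t > 0" by auto
  let ?F = "at u within {0<..} \<times> UNIV \<times> UNIV"
  have limits: "(fst \<longlongrightarrow> t) ?F" "((\<lambda>v. fst (snd v)) \<longlongrightarrow> x) ?F" "((\<lambda>v. snd (snd v)) \<longlongrightarrow> y) ?F"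
    using tendsto_fst[OF tendsto_ident_at, of u] tendsto_fst[OF tendsto_snd[OF tendsto_ident_at, of u]]
      tendsto_snd[OF tendsto_snd[OF tendsto_ident_at, of u]] by (auto simp: u)
  have "((\<lambda>v. pt (fst v) (fst (snd v)) (snd (snd v))) \<longlongrightarrow> pt t x y) ?F"
  proof -
    consider "x = 0" | "y = 0" | "x \<noteq> 0" "y \<noteq> 0" by blast
    then show ?thesis
    proof cases
      assume "x = 0"
      then show ?thesis using pt_tendsto_0[OF limits(1) t, of "\<lambda>v. fst (snd v)"] limits(2) t by simp
    next
      assume "y = 0"
      then have "((\<lambda>v. pt (fst v) (snd (snd v)) (fst (snd v))) \<longlongrightarrow> 0) ?F"
        using pt_tendsto_0[OF limits(1) t, of "\<lambda>v. snd (snd v)"] limits(3) by simp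
      moreover have "\<forall>\<^sub>F v in ?F. pt (fst v) (snd (snd v)) (fst (snd v)) = pt (fst v) (fst (snd v)) (snd (snd v))"
        using order_tendstoD(1)[OF limits(1) t] by eventually_elim (rule pt_commute)
      ultimately show ?thesis using \<open>y = 0\<close> t by (auto intro: Lim_transform_eventually)
    next
      assume nonzero: "x \<noteq> 0" "y \<noteq> 0"
      have "open ({0<..} \<times> (UNIV - {0}) \<times> (UNIV - {0}) :: (real \<times> 'a \<times> 'a) set)" by (intro open_Times) auto
      then have "((\<lambda>(t, x, y). pt t x y) \<longlongrightarrow> pt t x y) (at u)"
        using continuous_pt_off_axes nonzero t by (simp add: continuous_on_eq_continuous_at continuous_at u)
      from tendsto_within_subset[OF this subset_UNIV] show ?thesis by (simp add: case_prod_unfold)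
    qed
  qed
  then show "((\<lambda>(t, x, y). pt t x y) \<longlongrightarrow> (case u of (t, x, y) \<Rightarrow> pt t x y)) ?F" by (simp add: u case_prod_unfold)
qed

lemma Fbound_eq: "Fbound DIM('a) \<alpha> \<delta> t x y = sharp_profile t x y"
  by (simp add: Fbound_def sharp_profile_def boundary_decay_def stable_profile_def)

end

theorem theorem1p1:
  fixes M :: "'b measure" and X :: "real \<Rightarrow> 'b \<Rightarrow> 'a::euclidean_space"
    and pt :: "real \<Rightarrow> 'a \<Rightarrow> 'a \<Rightarrow> real" and \<alpha> \<delta> :: real
  assumes "0 < \<alpha>" and "\<alpha> < min (real DIM('a)) 2"
    and "0 < \<delta>" and "\<delta> < \<alpha>"
    and "is_stable_process M \<alpha> X"
    and "is_FK_heat_kernel M (kappa DIM('a) \<alpha> \<delta>) \<alpha> X pt"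
  shows "continuous_on ({0<..} \<times> UNIV \<times> UNIV) (\<lambda>(t, x, y). pt t x y)
    \<and> (\<exists>c\<ge>1. \<forall>t>0. \<forall>x y.
          Fbound DIM('a) \<alpha> \<delta> t x y / c \<le> pt t x y \<and> pt t x y \<le> c * Fbound DIM('a) \<alpha> \<delta> t x y)"
proof -
  have alpha: "\<alpha> < 2" "\<alpha> < real DIM('a)" using assms(2) by auto
  obtain C0 and p :: "real \<Rightarrow> 'a \<Rightarrow> real" where "stable_kernel \<alpha> C0 p"
    using stable_kernel_exists[OF assms(1) alpha] by blast
  then interpret stable_kernel \<alpha> C0 p .
  interpret fk_kernel \<alpha> C0 p M X \<delta> pt
    using assms by unfold_locales
  define c where "c = max 1 (max upper_const (1 / lower_const))"
  have c_ge: "1 \<le> c" "upper_const \<le> c" and "1 / lower_const \<le> c" by (simp_all add: c_def)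
  then have inverse_c: "1 / c \<le> lower_const" using lower_const_pos by (simp add: field_simps)
  have "sharp_profile t x y / c \<le> pt t x y \<and> pt t x y \<le> c * sharp_profile t x y" if t: "t > 0" for t x y
    using pt_lower[OF t, of x y] pt_upper[OF t, of x y]
      mult_right_mono[OF inverse_c sharp_profile_nonneg[OF t, of x y]]
      mult_right_mono[OF c_ge(2) sharp_profile_nonneg[OF t, of x y]]
    by simp
  then show ?thesis using continuous_pt c_ge(1) unfolding Fbound_eq by blast
qed

end
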